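(* (Provable in $\mathsf{ACA}_0^\omega$.) Every countable set $A\subset[0,1]$ has weak measure zero.
   Context: Work in $\mathsf{ACA}_0^\omega$, i.e. Kohlenbach's base theory $\mathsf{RCA}_0^\omega$ plus $(\exists^2)$: there is $\varphi^2\le_2 1$ with $(\exists n)(f(n)=0)\leftrightarrow \varphi(f)=0$ for all $f\in\mathbb{N}^{\mathbb{N}}$. Sets of reals (and of pairs of reals) are given by characteristic functions. $A\subset[0,1]$ is countable if there is $Y:[0,1]\to\mathbb{N}$ injective on $A$, i.e. $(\forall x,y\in A)(Y(x)=Y(y)\to x=y)$. A set $A\subset\mathbb{R}$ has weak measure zero if for every $\varepsilon>0$ there are a sequence of reals $(\varepsilon_n)_{n\in\mathbb{N}}$, a set $B\subset\mathbb{R}^2$ of pairs $(b,c)$ (representing intervals), and $Z:\mathbb{R}^2\to\mathbb{N}$ injective on $B$, such that $(\forall a\in A)(\exists (b,c)\in B)(a\in(b,c))$, $(\forall (b,c)\in B)(\forall n\in\mathbb{N})(Z((b,c))=n\to |b-c|\le\varepsilon_n)$, and $\varepsilon\ge\sum_{n=0}^\infty\varepsilon_n$. *)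

theory Defs
  imports Main
begin

section \<open>The language of finite types\<close>

datatype ty = N | Fn ty ty (infixr "\<rightarrow>\<^sub>t" 60)

text \<open>
  A variable is an index together with its sort. Terms are built from zero, successor, the
  combinators \<open>\<Pi>\<close> (here \<open>Kc\<close>) and \<open>\<Sigma>\<close> (here \<open>Sc\<close>), and the recursor \<open>R\<^sub>0\<close> (here \<open>Rc\<close>) that
  produces objects of type 0 only. There is no binding on the level of terms.
\<close>

type_synonym var = "nat \<times> ty"

datatype tm =
    Var var
  | Zero
  | Succ
  | Kc ty ty
  | Sc ty ty ty
  | Rc
  | App tm tm (infixl "\<cdot>" 110)

fun cod :: "ty \<Rightarrow> ty" where
  "cod (\<rho> \<rightarrow>\<^sub>t \<tau>) = \<tau>"
| "cod N = N"

text \<open>The value of \<open>ty_of\<close> is meaningful for terms satisfying \<open>wt\<close> only.\<close>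

primrec ty_of :: "tm \<Rightarrow> ty" where
  "ty_of (Var x) = snd x"
| "ty_of Zero = N"
| "ty_of Succ = N \<rightarrow>\<^sub>t N"
| "ty_of (Kc \<rho> \<tau>) = \<rho> \<rightarrow>\<^sub>t \<tau> \<rightarrow>\<^sub>t \<rho>"
| "ty_of (Sc \<delta> \<rho> \<tau>) = (\<delta> \<rightarrow>\<^sub>t \<rho> \<rightarrow>\<^sub>t \<tau>) \<rightarrow>\<^sub>t (\<delta> \<rightarrow>\<^sub>t \<rho>) \<rightarrow>\<^sub>t \<delta> \<rightarrow>\<^sub>t \<tau>"
| "ty_of Rc = N \<rightarrow>\<^sub>t N \<rightarrow>\<^sub>t (N \<rightarrow>\<^sub>t N \<rightarrow>\<^sub>t N) \<rightarrow>\<^sub>t N"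
| "ty_of (s \<cdot> t) = cod (ty_of s)"

primrec wt :: "tm \<Rightarrow> bool" where
  "wt (Var x) = True"
| "wt Zero = True"
| "wt Succ = True"
| "wt (Kc \<rho> \<tau>) = True"
| "wt (Sc \<delta> \<rho> \<tau>) = True"
| "wt Rc = True"
| "wt (s \<cdot> t) = (wt s \<and> wt t \<and> ty_of s = ty_of t \<rightarrow>\<^sub>t cod (ty_of s))"

primrec tsubst :: "(var \<Rightarrow> tm) \<Rightarrow> tm \<Rightarrow> tm" where
  "tsubst \<theta> (Var x) = \<theta> x"
| "tsubst \<theta> Zero = Zero"
| "tsubst \<theta> Succ = Succ"
| "tsubst \<theta> (Kc \<rho> \<tau>) = Kc \<rho> \<tau>"
| "tsubst \<theta> (Sc \<delta> \<rho> \<tau>) = Sc \<delta> \<rho> \<tau>"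
| "tsubst \<theta> Rc = Rc"
| "tsubst \<theta> (s \<cdot> t) = tsubst \<theta> s \<cdot> tsubst \<theta> t"

text \<open>
  Equality of type 0 is the only primitive predicate. Formulas use de Bruijn indices, counted
  separately for each sort: \<open>Forall \<rho> \<phi>\<close> binds the variable \<open>(0, \<rho>)\<close> of \<open>\<phi>\<close>; a variable
  \<open>(Suc i, \<rho>)\<close> inside \<open>\<phi>\<close> denotes \<open>(i, \<rho>)\<close> outside, and variables of other sorts keep their
  index.
\<close>

datatype fm =
    Bot ("\<^bold>\<bottom>")
  | Eq tm tm (infix "\<^bold>=" 50)
  | Imp fm fm (infixr "\<^bold>\<longrightarrow>" 25)
  | Forall ty fm

primrec wff :: "fm \<Rightarrow> bool" where
  "wff \<^bold>\<bottom> = True"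
| "wff (s \<^bold>= t) = (wt s \<and> wt t \<and> ty_of s = N \<and> ty_of t = N)"
| "wff (\<phi> \<^bold>\<longrightarrow> \<psi>) = (wff \<phi> \<and> wff \<psi>)"
| "wff (Forall \<rho> \<phi>) = wff \<phi>"

primrec qf :: "fm \<Rightarrow> bool" where
  "qf \<^bold>\<bottom> = True"
| "qf (s \<^bold>= t) = True"
| "qf (\<phi> \<^bold>\<longrightarrow> \<psi>) = (qf \<phi> \<and> qf \<psi>)"
| "qf (Forall \<rho> \<phi>) = False"

definition shift :: "ty \<Rightarrow> var \<Rightarrow> var" where
  "shift \<rho> x = (if snd x = \<rho> then (Suc (fst x), \<rho>) else x)"

text \<open>\<open>scons \<rho> t \<theta>\<close> sends \<open>(0, \<rho>)\<close> to \<open>t\<close> and treats the remaining variables, moved down by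
  one in sort \<open>\<rho>\<close>, like \<open>\<theta>\<close>.\<close>

definition scons :: "ty \<Rightarrow> tm \<Rightarrow> (var \<Rightarrow> tm) \<Rightarrow> var \<Rightarrow> tm" where
  "scons \<rho> t \<theta> x =
     (if snd x = \<rho> then (case fst x of 0 \<Rightarrow> t | Suc i \<Rightarrow> \<theta> (i, \<rho>)) else \<theta> x)"

primrec subst :: "(var \<Rightarrow> tm) \<Rightarrow> fm \<Rightarrow> fm" where
  "subst \<theta> \<^bold>\<bottom> = \<^bold>\<bottom>"
| "subst \<theta> (s \<^bold>= t) = (tsubst \<theta> s \<^bold>= tsubst \<theta> t)"
| "subst \<theta> (\<phi> \<^bold>\<longrightarrow> \<psi>) = (subst \<theta> \<phi> \<^bold>\<longrightarrow> subst \<theta> \<psi>)"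
| "subst \<theta> (Forall \<rho> \<phi>) =
     Forall \<rho> (subst (scons \<rho> (Var (0, \<rho>)) (\<lambda>x. tsubst (Var \<circ> shift \<rho>) (\<theta> x))) \<phi>)"

definition lift :: "ty \<Rightarrow> fm \<Rightarrow> fm" where
  "lift \<rho> \<phi> = subst (Var \<circ> shift \<rho>) \<phi>"

definition inst :: "ty \<Rightarrow> tm \<Rightarrow> fm \<Rightarrow> fm" where
  "inst \<rho> t \<phi> = subst (scons \<rho> t Var) \<phi>"


section \<open>Classical many-sorted natural deduction\<close>

text \<open>
  \<open>derives T \<Gamma> \<phi>\<close>: the formula \<open>\<phi>\<close> follows from the axioms \<open>T\<close> and the open assumptions \<open>\<Gamma>\<close>.
  Free variables of axioms are implicitly universally quantified, those of assumptions are not.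
\<close>

abbreviation Neg :: "fm \<Rightarrow> fm" ("\<^bold>\<not> _" [40] 40) where
  "\<^bold>\<not> \<phi> \<equiv> \<phi> \<^bold>\<longrightarrow> \<^bold>\<bottom>"

inductive derives :: "fm set \<Rightarrow> fm list \<Rightarrow> fm \<Rightarrow> bool" for T where
  axm:  "\<phi> \<in> T \<Longrightarrow> wff \<phi> \<Longrightarrow> derives T \<Gamma> \<phi>"
| asm:  "\<phi> \<in> set \<Gamma> \<Longrightarrow> wff \<phi> \<Longrightarrow> derives T \<Gamma> \<phi>"
| impI: "wff \<phi> \<Longrightarrow> derives T (\<phi> # \<Gamma>) \<psi> \<Longrightarrow> derives T \<Gamma> (\<phi> \<^bold>\<longrightarrow> \<psi>)"
| impE: "derives T \<Gamma> (\<phi> \<^bold>\<longrightarrow> \<psi>) \<Longrightarrow> derives T \<Gamma> \<phi> \<Longrightarrow> derives T \<Gamma> \<psi>"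
| raa:  "wff \<phi> \<Longrightarrow> derives T ((\<^bold>\<not> \<phi>) # \<Gamma>) \<^bold>\<bottom> \<Longrightarrow> derives T \<Gamma> \<phi>"
| allI: "derives T (map (lift \<rho>) \<Gamma>) \<phi> \<Longrightarrow> derives T \<Gamma> (Forall \<rho> \<phi>)"
| allE: "derives T \<Gamma> (Forall \<rho> \<phi>) \<Longrightarrow> wt t \<Longrightarrow> ty_of t = \<rho> \<Longrightarrow> derives T \<Gamma> (inst \<rho> t \<phi>)"

definition provable :: "fm set \<Rightarrow> fm \<Rightarrow> bool" (infix "\<tturnstile>" 55) where
  "T \<tturnstile> \<phi> \<longleftrightarrow> derives T [] \<phi>"


section \<open>Named variables\<close>

text \<open>
  To write formulas legibly we quantify over a named variable \<open>x\<close>: \<open>all_v x \<phi>\<close> turns the free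
  occurrences of \<open>x\<close> in \<open>\<phi>\<close> into the variable bound by \<open>Forall\<close>.
\<close>

definition all_v :: "var \<Rightarrow> fm \<Rightarrow> fm" ("(3\<^bold>\<forall>_./ _)" [0, 10] 10) where
  "(\<^bold>\<forall>x. \<phi>) = Forall (snd x) (subst ((Var \<circ> shift (snd x))(x := Var (0, snd x))) \<phi>)"

abbreviation ex_v :: "var \<Rightarrow> fm \<Rightarrow> fm" ("(3\<^bold>\<exists>_./ _)" [0, 10] 10) where
  "(\<^bold>\<exists>x. \<phi>) \<equiv> \<^bold>\<not> (\<^bold>\<forall>x. \<^bold>\<not> \<phi>)"

abbreviation Dis :: "fm \<Rightarrow> fm \<Rightarrow> fm" (infixr "\<^bold>\<or>" 30) where
  "\<phi> \<^bold>\<or> \<psi> \<equiv> \<^bold>\<not> \<phi> \<^bold>\<longrightarrow> \<psi>"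

abbreviation Con :: "fm \<Rightarrow> fm \<Rightarrow> fm" (infixr "\<^bold>\<and>" 35) where
  "\<phi> \<^bold>\<and> \<psi> \<equiv> \<^bold>\<not> (\<phi> \<^bold>\<longrightarrow> \<^bold>\<not> \<psi>)"

abbreviation Iff :: "fm \<Rightarrow> fm \<Rightarrow> fm" (infix "\<^bold>\<longleftrightarrow>" 25) where
  "\<phi> \<^bold>\<longleftrightarrow> \<psi> \<equiv> (\<phi> \<^bold>\<longrightarrow> \<psi>) \<^bold>\<and> (\<psi> \<^bold>\<longrightarrow> \<phi>)"

definition replace :: "fm \<Rightarrow> var \<Rightarrow> tm \<Rightarrow> fm" where
  "replace \<phi> x t = subst (Var(x := t)) \<phi>"

primrec bound :: "tm \<Rightarrow> nat" where
  "bound (Var x) = Suc (fst x)"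
| "bound Zero = 0"
| "bound Succ = 0"
| "bound (Kc \<rho> \<tau>) = 0"
| "bound (Sc \<delta> \<rho> \<tau>) = 0"
| "bound Rc = 0"
| "bound (s \<cdot> t) = max (bound s) (bound t)"

text \<open>\<open>newv k \<rho> ts\<close> is the \<open>k\<close>-th of a supply of variables of sort \<open>\<rho>\<close> not occurring in \<open>ts\<close>.
  Defined predicates quantify over such variables, so that their arguments are never captured.\<close>

definition newv :: "nat \<Rightarrow> ty \<Rightarrow> tm list \<Rightarrow> var" where
  "newv k \<rho> ts = (foldr max (map bound ts) 0 + k, \<rho>)"

primrec tvars :: "tm \<Rightarrow> var set" where
  "tvars (Var x) = {x}"
| "tvars Zero = {}"
| "tvars Succ = {}"
| "tvars (Kc \<rho> \<tau>) = {}"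
| "tvars (Sc \<delta> \<rho> \<tau>) = {}"
| "tvars Rc = {}"
| "tvars (s \<cdot> t) = tvars s \<union> tvars t"

primrec fv :: "fm \<Rightarrow> var set" where
  "fv \<^bold>\<bottom> = {}"
| "fv (s \<^bold>= t) = tvars s \<union> tvars t"
| "fv (\<phi> \<^bold>\<longrightarrow> \<psi>) = fv \<phi> \<union> fv \<psi>"
| "fv (Forall \<rho> \<phi>) = {x. shift \<rho> x \<in> fv \<phi>}"

text \<open>
  \<open>\<^bold>\<lambda>x. t\<close> is bracket abstraction: a combinator term without \<open>x\<close> that represents \<open>t\<close> as a
  function of \<open>x\<close>. Variables of \<open>t\<close> other than \<open>x\<close> stay free.
\<close>

primrec lam :: "var \<Rightarrow> tm \<Rightarrow> tm" ("(3\<^bold>\<lambda>_./ _)" [0, 10] 10) where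
  "(\<^bold>\<lambda>x. Var y) =
     (if y = x then Sc (snd x) (snd x \<rightarrow>\<^sub>t snd x) (snd x) \<cdot> Kc (snd x) (snd x \<rightarrow>\<^sub>t snd x) \<cdot> Kc (snd x) (snd x)
      else Kc (snd y) (snd x) \<cdot> Var y)"
| "(\<^bold>\<lambda>x. Zero) = Kc (ty_of Zero) (snd x) \<cdot> Zero"
| "(\<^bold>\<lambda>x. Succ) = Kc (ty_of Succ) (snd x) \<cdot> Succ"
| "(\<^bold>\<lambda>x. Kc \<rho> \<tau>) = Kc (ty_of (Kc \<rho> \<tau>)) (snd x) \<cdot> Kc \<rho> \<tau>"
| "(\<^bold>\<lambda>x. Sc \<delta> \<rho> \<tau>) = Kc (ty_of (Sc \<delta> \<rho> \<tau>)) (snd x) \<cdot> Sc \<delta> \<rho> \<tau>"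
| "(\<^bold>\<lambda>x. Rc) = Kc (ty_of Rc) (snd x) \<cdot> Rc"
| "(\<^bold>\<lambda>x. s \<cdot> t) =
     (if x \<in> tvars (s \<cdot> t) then Sc (snd x) (ty_of t) (ty_of (s \<cdot> t)) \<cdot> (\<^bold>\<lambda>x. s) \<cdot> (\<^bold>\<lambda>x. t)
      else Kc (ty_of (s \<cdot> t)) (snd x) \<cdot> (s \<cdot> t))"



section \<open>The axioms\<close>

abbreviation T1 :: ty where "T1 \<equiv> N \<rightarrow>\<^sub>t N"
abbreviation T2 :: ty where "T2 \<equiv> T1 \<rightarrow>\<^sub>t N"

abbreviation one :: tm where "one \<equiv> Succ \<cdot> Zero"

text \<open>Equality of higher type is an abbreviation for pointwise equality.\<close>

primrec eq_at :: "ty \<Rightarrow> tm \<Rightarrow> tm \<Rightarrow> fm" where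
  "eq_at N s t = (s \<^bold>= t)"
| "eq_at (\<rho> \<rightarrow>\<^sub>t \<tau>) s t =
     (let z = newv 0 \<rho> [s, t] in \<^bold>\<forall>z. eq_at \<tau> (s \<cdot> Var z) (t \<cdot> Var z))"

inductive_set E_PRA_omega :: "fm set" where
  eq_refl: "(Var (0, N) \<^bold>= Var (0, N)) \<in> E_PRA_omega"
| eq_sym: "(Var (0, N) \<^bold>= Var (1, N) \<^bold>\<longrightarrow> Var (1, N) \<^bold>= Var (0, N)) \<in> E_PRA_omega"
| eq_trans:
    "(Var (0, N) \<^bold>= Var (1, N) \<^bold>\<longrightarrow> Var (1, N) \<^bold>= Var (2, N) \<^bold>\<longrightarrow> Var (0, N) \<^bold>= Var (2, N))
       \<in> E_PRA_omega"
| extensionality: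
    "(eq_at \<rho> (Var (0, \<rho>)) (Var (1, \<rho>)) \<^bold>\<longrightarrow>
      eq_at \<tau> (Var (2, \<rho> \<rightarrow>\<^sub>t \<tau>) \<cdot> Var (0, \<rho>)) (Var (2, \<rho> \<rightarrow>\<^sub>t \<tau>) \<cdot> Var (1, \<rho>))) \<in> E_PRA_omega"
| succ_nonzero: "(\<^bold>\<not> Succ \<cdot> Var (0, N) \<^bold>= Zero) \<in> E_PRA_omega"
| succ_inj:
    "(Succ \<cdot> Var (0, N) \<^bold>= Succ \<cdot> Var (1, N) \<^bold>\<longrightarrow> Var (0, N) \<^bold>= Var (1, N)) \<in> E_PRA_omega"
| Kc_eq: "eq_at \<rho> (Kc \<rho> \<tau> \<cdot> Var (0, \<rho>) \<cdot> Var (1, \<tau>)) (Var (0, \<rho>)) \<in> E_PRA_omega"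
| Sc_eq:
    "x = Var (0, \<delta> \<rightarrow>\<^sub>t \<rho> \<rightarrow>\<^sub>t \<tau>) \<Longrightarrow> y = Var (1, \<delta> \<rightarrow>\<^sub>t \<rho>) \<Longrightarrow> z = Var (2, \<delta>) \<Longrightarrow>
     eq_at \<tau> (Sc \<delta> \<rho> \<tau> \<cdot> x \<cdot> y \<cdot> z) (x \<cdot> z \<cdot> (y \<cdot> z)) \<in> E_PRA_omega"
| Rc_zero:
    "y = Var (1, N) \<Longrightarrow> z = Var (2, N \<rightarrow>\<^sub>t N \<rightarrow>\<^sub>t N) \<Longrightarrow>
     (Rc \<cdot> Zero \<cdot> y \<cdot> z \<^bold>= y) \<in> E_PRA_omega"
| Rc_succ:
    "x = Var (0, N) \<Longrightarrow> y = Var (1, N) \<Longrightarrow> z = Var (2, N \<rightarrow>\<^sub>t N \<rightarrow>\<^sub>t N) \<Longrightarrow>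
     (Rc \<cdot> (Succ \<cdot> x) \<cdot> y \<cdot> z \<^bold>= z \<cdot> (Rc \<cdot> x \<cdot> y \<cdot> z) \<cdot> x) \<in> E_PRA_omega"
| QF_induction:
    "qf \<phi> \<Longrightarrow> wff \<phi> \<Longrightarrow> x = (i, N) \<Longrightarrow>
     (replace \<phi> x Zero \<^bold>\<and> (\<^bold>\<forall>x. \<phi> \<^bold>\<longrightarrow> replace \<phi> x (Succ \<cdot> Var x)) \<^bold>\<longrightarrow> (\<^bold>\<forall>x. \<phi>)) \<in> E_PRA_omega"

inductive_set QF_AC_1_0 :: "fm set" where
  "qf \<phi> \<Longrightarrow> wff \<phi> \<Longrightarrow> f = (i, T1) \<Longrightarrow> n = (j, N) \<Longrightarrow> F = (k, T2) \<Longrightarrow> F \<notin> fv \<phi> \<Longrightarrow>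
   ((\<^bold>\<forall>f. \<^bold>\<exists>n. \<phi>) \<^bold>\<longrightarrow> (\<^bold>\<exists>F. \<^bold>\<forall>f. replace \<phi> n (Var F \<cdot> Var f))) \<in> QF_AC_1_0"

definition RCA0_omega :: "fm set" where
  "RCA0_omega = E_PRA_omega \<union> QF_AC_1_0"


section \<open>Arithmetic\<close>

abbreviation nx :: var where "nx \<equiv> (0, N)"
abbreviation ny :: var where "ny \<equiv> (1, N)"
abbreviation nr :: var where "nr \<equiv> (2, N)"
abbreviation ni :: var where "ni \<equiv> (3, N)"

definition plus_tm :: tm where
  "plus_tm = (\<^bold>\<lambda>nx. \<^bold>\<lambda>ny. Rc \<cdot> Var ny \<cdot> Var nx \<cdot> (\<^bold>\<lambda>nr. \<^bold>\<lambda>ni. Succ \<cdot> Var nr))"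

definition add :: "tm \<Rightarrow> tm \<Rightarrow> tm" (infixl "\<^bold>+" 65) where
  "s \<^bold>+ t = plus_tm \<cdot> s \<cdot> t"

definition pred_tm :: tm where
  "pred_tm = (\<^bold>\<lambda>nx. Rc \<cdot> Var nx \<cdot> Zero \<cdot> (\<^bold>\<lambda>nr. \<^bold>\<lambda>ni. Var ni))"

definition monus_tm :: tm where
  "monus_tm = (\<^bold>\<lambda>nx. \<^bold>\<lambda>ny. Rc \<cdot> Var ny \<cdot> Var nx \<cdot> (\<^bold>\<lambda>nr. \<^bold>\<lambda>ni. pred_tm \<cdot> Var nr))"

definition monus :: "tm \<Rightarrow> tm \<Rightarrow> tm" (infixl "\<^bold>-" 65) where
  "s \<^bold>- t = monus_tm \<cdot> s \<cdot> t"

definition times_tm :: tm where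
  "times_tm = (\<^bold>\<lambda>nx. \<^bold>\<lambda>ny. Rc \<cdot> Var ny \<cdot> Zero \<cdot> (\<^bold>\<lambda>nr. \<^bold>\<lambda>ni. Var nr \<^bold>+ Var nx))"

definition mult :: "tm \<Rightarrow> tm \<Rightarrow> tm" (infixl "\<^bold>*" 70) where
  "s \<^bold>* t = times_tm \<cdot> s \<cdot> t"

definition pow2_tm :: tm where
  "pow2_tm = (\<^bold>\<lambda>nx. Rc \<cdot> Var nx \<cdot> one \<cdot> (\<^bold>\<lambda>nr. \<^bold>\<lambda>ni. Var nr \<^bold>+ Var nr))"

definition leq :: "tm \<Rightarrow> tm \<Rightarrow> fm" (infix "\<^bold>\<le>" 50) where
  "s \<^bold>\<le> t = (s \<^bold>- t \<^bold>= Zero)"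

definition lt :: "tm \<Rightarrow> tm \<Rightarrow> fm" (infix "\<^bold><" 50) where
  "s \<^bold>< t = (Succ \<cdot> s \<^bold>\<le> t)"

text \<open>
  The Cantor pairing function \<open>(x, y) \<mapsto> tri (x + y) + y\<close> with its two inverses; \<open>root z\<close> is the
  largest \<open>w\<close> such that \<open>tri w \<le> z\<close>.
\<close>

definition tri_tm :: tm where
  "tri_tm = (\<^bold>\<lambda>nx. Rc \<cdot> Var nx \<cdot> Zero \<cdot> (\<^bold>\<lambda>nr. \<^bold>\<lambda>ni. Var nr \<^bold>+ Succ \<cdot> Var ni))"

definition root_tm :: tm where
  "root_tm = (\<^bold>\<lambda>nx. Rc \<cdot> Var nx \<cdot> Zero \<cdot>
     (\<^bold>\<lambda>nr. \<^bold>\<lambda>ni. Rc \<cdot> (tri_tm \<cdot> (Succ \<cdot> Var nr) \<^bold>- Succ \<cdot> Var ni) \<cdot> (Succ \<cdot> Var nr) \<cdot>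
        (Kc (N \<rightarrow>\<^sub>t N) N \<cdot> (Kc N N \<cdot> Var nr))))"

definition pair_tm :: tm where
  "pair_tm = (\<^bold>\<lambda>nx. \<^bold>\<lambda>ny. tri_tm \<cdot> (Var nx \<^bold>+ Var ny) \<^bold>+ Var ny)"

definition pair :: "tm \<Rightarrow> tm \<Rightarrow> tm" where
  "pair s t = pair_tm \<cdot> s \<cdot> t"

definition second_tm :: tm where
  "second_tm = (\<^bold>\<lambda>nx. Var nx \<^bold>- tri_tm \<cdot> (root_tm \<cdot> Var nx))"

definition first_tm :: tm where
  "first_tm = (\<^bold>\<lambda>nx. root_tm \<cdot> Var nx \<^bold>- second_tm \<cdot> Var nx)"

text \<open>
  The axiom \<open>(\<exists>\<^sup>2)\<close>, where \<open>\<le>\<close> is pointwise: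
  \<open>\<exists>\<phi> \<le> 1. \<forall>f. (\<exists>n. f n = 0) \<longleftrightarrow> \<phi> f = 0\<close>.
\<close>

definition Exists2 :: fm where
  "Exists2 =
     (let p = (0, T2); f = (0, T1); n = (0, N) in
      \<^bold>\<exists>p. (\<^bold>\<forall>f. Var p \<cdot> Var f \<^bold>\<le> one) \<^bold>\<and>
          (\<^bold>\<forall>f. (\<^bold>\<exists>n. Var f \<cdot> Var n \<^bold>= Zero) \<^bold>\<longleftrightarrow> Var p \<cdot> Var f \<^bold>= Zero))"

definition ACA0_omega :: "fm set" where
  "ACA0_omega = RCA0_omega \<union> {Exists2}"


section \<open>Rational and real numbers\<close>

text \<open>The number \<open>pair (pair a b) c\<close> codes the rational \<open>(a - b) / (c + 1)\<close>.\<close>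

definition mk_rat :: "tm \<Rightarrow> tm \<Rightarrow> tm \<Rightarrow> tm" where
  "mk_rat a b d = pair (pair a b) (pred_tm \<cdot> d)"

definition pos :: "tm \<Rightarrow> tm" where "pos q = first_tm \<cdot> (first_tm \<cdot> q)"
definition neg :: "tm \<Rightarrow> tm" where "neg q = second_tm \<cdot> (first_tm \<cdot> q)"
definition den :: "tm \<Rightarrow> tm" where "den q = Succ \<cdot> (second_tm \<cdot> q)"

definition ratadd_tm :: tm where
  "ratadd_tm =
     (\<^bold>\<lambda>nx. \<^bold>\<lambda>ny. mk_rat (pos (Var nx) \<^bold>* den (Var ny) \<^bold>+ pos (Var ny) \<^bold>* den (Var nx))
                       (neg (Var nx) \<^bold>* den (Var ny) \<^bold>+ neg (Var ny) \<^bold>* den (Var nx))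
                       (den (Var nx) \<^bold>* den (Var ny)))"

definition ratadd :: "tm \<Rightarrow> tm \<Rightarrow> tm" where
  "ratadd q r = ratadd_tm \<cdot> q \<cdot> r"

definition ratminus_tm :: tm where
  "ratminus_tm = (\<^bold>\<lambda>nx. mk_rat (neg (Var nx)) (pos (Var nx)) (den (Var nx)))"

definition ratabs_tm :: tm where
  "ratabs_tm =
     (\<^bold>\<lambda>nx. mk_rat ((pos (Var nx) \<^bold>- neg (Var nx)) \<^bold>+ (neg (Var nx) \<^bold>- pos (Var nx))) Zero
                  (den (Var nx)))"

definition ratdist :: "tm \<Rightarrow> tm \<Rightarrow> tm" where
  "ratdist q r = ratabs_tm \<cdot> ratadd q (ratminus_tm \<cdot> r)"

definition ratle :: "tm \<Rightarrow> tm \<Rightarrow> fm" (infix "\<^bold>\<le>\<^sub>Q" 50) where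
  "q \<^bold>\<le>\<^sub>Q r = (pos q \<^bold>* den r \<^bold>+ neg r \<^bold>* den q \<^bold>\<le> pos r \<^bold>* den q \<^bold>+ neg q \<^bold>* den r)"

definition ratless :: "tm \<Rightarrow> tm \<Rightarrow> fm" (infix "\<^bold><\<^sub>Q" 50) where
  "q \<^bold><\<^sub>Q r = (pos q \<^bold>* den r \<^bold>+ neg r \<^bold>* den q \<^bold>< pos r \<^bold>* den q \<^bold>+ neg q \<^bold>* den r)"

abbreviation zeroQ :: tm where "zeroQ \<equiv> mk_rat Zero Zero one"
abbreviation oneQ :: tm where "oneQ \<equiv> mk_rat one Zero one"

text \<open>\<open>eps n\<close> and \<open>eps2 n\<close> are the rationals \<open>2\<^sup>-\<^sup>n\<close> and \<open>2\<^sup>-\<^sup>n\<^sup>+\<^sup>1\<close>.\<close>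

definition eps :: "tm \<Rightarrow> tm" where
  "eps n = mk_rat one Zero (pow2_tm \<cdot> n)"

definition eps2 :: "tm \<Rightarrow> tm" where
  "eps2 n = mk_rat (Succ \<cdot> one) Zero (pow2_tm \<cdot> n)"

text \<open>
  A real is an object \<open>q\<close> of type 1 enumerating (codes of) rationals such that
  \<open>\<bar>q\<^sub>n - q\<^sub>n\<^sub>+\<^sub>i\<bar> < 2\<^sup>-\<^sup>n\<close> for all \<open>n\<close> and \<open>i\<close>.
\<close>

definition is_real :: "tm \<Rightarrow> fm" where
  "is_real x = (let n = newv 0 N [x]; i = newv 1 N [x] in
     \<^bold>\<forall>n. \<^bold>\<forall>i. ratdist (x \<cdot> Var n) (x \<cdot> (Var n \<^bold>+ Var i)) \<^bold><\<^sub>Q eps (Var n))"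

definition realeq :: "tm \<Rightarrow> tm \<Rightarrow> fm" (infix "\<^bold>=\<^sub>R" 50) where
  "x \<^bold>=\<^sub>R y = (let n = newv 0 N [x, y] in
     \<^bold>\<forall>n. ratdist (x \<cdot> Var n) (y \<cdot> Var n) \<^bold>\<le>\<^sub>Q eps2 (Var n))"

definition realle :: "tm \<Rightarrow> tm \<Rightarrow> fm" (infix "\<^bold>\<le>\<^sub>R" 50) where
  "x \<^bold>\<le>\<^sub>R y = (let n = newv 0 N [x, y] in
     \<^bold>\<forall>n. x \<cdot> Var n \<^bold>\<le>\<^sub>Q ratadd (y \<cdot> Var n) (eps2 (Var n)))"

definition realless :: "tm \<Rightarrow> tm \<Rightarrow> fm" (infix "\<^bold><\<^sub>R" 50) where
  "x \<^bold><\<^sub>R y = (let n = newv 0 N [x, y] in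
     \<^bold>\<exists>n. ratadd (x \<cdot> Var n) (eps2 (Var n)) \<^bold><\<^sub>Q y \<cdot> Var n)"

definition real_of_rat :: "tm \<Rightarrow> tm" where
  "real_of_rat q = Kc N N \<cdot> q"

text \<open>The distance \<open>\<bar>x - y\<bar>\<close>; the shift of the index restores the rate of convergence.\<close>

definition realdist :: "tm \<Rightarrow> tm \<Rightarrow> tm" where
  "realdist x y = (let k = newv 0 N [x, y] in
     \<^bold>\<lambda>k. ratdist (x \<cdot> (Succ \<cdot> Var k)) (y \<cdot> (Succ \<cdot> Var k)))"

text \<open>
  The partial sum \<open>\<Sum>i<m. e i\<close> of a sequence \<open>e\<close> of reals, an object of type \<open>0 \<rightarrow> 1\<close>. Its \<open>k\<close>-th
  approximation adds the \<open>(k + m)\<close>-th approximations of the summands, which suffices as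
  \<open>m * 2\<^sup>-\<^sup>(\<^sup>k\<^sup>+\<^sup>m\<^sup>) < 2\<^sup>-\<^sup>k\<close>.
\<close>

definition partial_sum :: "tm \<Rightarrow> tm \<Rightarrow> tm" where
  "partial_sum e m =
     (let k = newv 0 N [e, m]; r = newv 1 N [e, m]; i = newv 2 N [e, m] in
      \<^bold>\<lambda>k. Rc \<cdot> m \<cdot> zeroQ \<cdot>
        (\<^bold>\<lambda>r. \<^bold>\<lambda>i. ratadd (Var r) (e \<cdot> Var i \<cdot> (Var k \<^bold>+ m))))"

abbreviation all_real :: "var \<Rightarrow> fm \<Rightarrow> fm" ("(3\<^bold>\<forall>_\<^bold>\<in>\<real>./ _)" [0, 10] 10) where
  "(\<^bold>\<forall>x\<^bold>\<in>\<real>. \<phi>) \<equiv> \<^bold>\<forall>x. is_real (Var x) \<^bold>\<longrightarrow> \<phi>"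

abbreviation ex_real :: "var \<Rightarrow> fm \<Rightarrow> fm" ("(3\<^bold>\<exists>_\<^bold>\<in>\<real>./ _)" [0, 10] 10) where
  "(\<^bold>\<exists>x\<^bold>\<in>\<real>. \<phi>) \<equiv> \<^bold>\<exists>x. is_real (Var x) \<^bold>\<and> \<phi>"

definition series_sums :: "tm \<Rightarrow> tm \<Rightarrow> fm" where
  "series_sums e s =
     (let k = newv 0 N [e, s]; m = newv 1 N [e, s]; n = newv 2 N [e, s] in
      \<^bold>\<forall>k. \<^bold>\<exists>m. \<^bold>\<forall>n. Var m \<^bold>\<le> Var n \<^bold>\<longrightarrow>
        realdist (partial_sum e (Var n)) s \<^bold>\<le>\<^sub>R real_of_rat (eps (Var k)))"


section \<open>Sets of reals\<close>

abbreviation T11 :: ty where "T11 \<equiv> T1 \<rightarrow>\<^sub>t T1 \<rightarrow>\<^sub>t N"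

definition in_unit :: "tm \<Rightarrow> fm" where
  "in_unit x = (real_of_rat zeroQ \<^bold>\<le>\<^sub>R x \<^bold>\<and> x \<^bold>\<le>\<^sub>R real_of_rat oneQ)"

text \<open>
  A set of reals is a characteristic function \<open>F : \<real> \<rightarrow> {0, 1}\<close>. As all functions on the reals, it
  has to respect equality of reals.
\<close>

definition mem :: "tm \<Rightarrow> tm \<Rightarrow> fm" (infix "\<^bold>\<in>" 50) where
  "x \<^bold>\<in> F = (F \<cdot> x \<^bold>= one)"

definition is_set :: "tm \<Rightarrow> fm" where
  "is_set F = (let x = newv 0 T1 [F]; y = newv 1 T1 [F] in
     (\<^bold>\<forall>x\<^bold>\<in>\<real>. F \<cdot> Var x \<^bold>\<le> one) \<^bold>\<and>
     (\<^bold>\<forall>x\<^bold>\<in>\<real>. \<^bold>\<forall>y\<^bold>\<in>\<real>. Var x \<^bold>=\<^sub>R Var y \<^bold>\<longrightarrow> F \<cdot> Var x \<^bold>= F \<cdot> Var y))"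

definition subset_unit :: "tm \<Rightarrow> fm" where
  "subset_unit A = (let x = newv 0 T1 [A] in \<^bold>\<forall>x\<^bold>\<in>\<real>. Var x \<^bold>\<in> A \<^bold>\<longrightarrow> in_unit (Var x))"

text \<open>Functions \<open>Y : [0,1] \<rightarrow> \<nat>\<close>; the values of \<open>Y\<close> elsewhere are irrelevant.\<close>

definition unit_fun :: "tm \<Rightarrow> fm" where
  "unit_fun Y = (let x = newv 0 T1 [Y]; y = newv 1 T1 [Y] in
     \<^bold>\<forall>x\<^bold>\<in>\<real>. \<^bold>\<forall>y\<^bold>\<in>\<real>. in_unit (Var x) \<^bold>\<longrightarrow> in_unit (Var y) \<^bold>\<longrightarrow>
       Var x \<^bold>=\<^sub>R Var y \<^bold>\<longrightarrow> Y \<cdot> Var x \<^bold>= Y \<cdot> Var y)"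

definition inj_on_set :: "tm \<Rightarrow> tm \<Rightarrow> fm" where
  "inj_on_set Y A = (let x = newv 0 T1 [Y, A]; y = newv 1 T1 [Y, A] in
     \<^bold>\<forall>x\<^bold>\<in>\<real>. \<^bold>\<forall>y\<^bold>\<in>\<real>. Var x \<^bold>\<in> A \<^bold>\<longrightarrow> Var y \<^bold>\<in> A \<^bold>\<longrightarrow>
       Y \<cdot> Var x \<^bold>= Y \<cdot> Var y \<^bold>\<longrightarrow> Var x \<^bold>=\<^sub>R Var y)"

definition countable_set :: "tm \<Rightarrow> fm" where
  "countable_set A = (let Y = newv 0 T2 [A] in \<^bold>\<exists>Y. unit_fun (Var Y) \<^bold>\<and> inj_on_set (Var Y) A)"

text \<open>
  Functions \<open>Z : \<real>\<^sup>2 \<rightarrow> \<nat>\<close> and sets \<open>B \<subseteq> \<real>\<^sup>2\<close> take the two components of a pair as successive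
  arguments.
\<close>

definition fun2 :: "tm \<Rightarrow> fm" where
  "fun2 Z = (let b = newv 0 T1 [Z]; c = newv 1 T1 [Z]; b' = newv 2 T1 [Z]; c' = newv 3 T1 [Z] in
     \<^bold>\<forall>b\<^bold>\<in>\<real>. \<^bold>\<forall>c\<^bold>\<in>\<real>. \<^bold>\<forall>b'\<^bold>\<in>\<real>. \<^bold>\<forall>c'\<^bold>\<in>\<real>. Var b \<^bold>=\<^sub>R Var b' \<^bold>\<longrightarrow> Var c \<^bold>=\<^sub>R Var c' \<^bold>\<longrightarrow>
       Z \<cdot> Var b \<cdot> Var c \<^bold>= Z \<cdot> Var b' \<cdot> Var c')"

definition is_set2 :: "tm \<Rightarrow> fm" where
  "is_set2 B = (let b = newv 0 T1 [B]; c = newv 1 T1 [B] in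
     (\<^bold>\<forall>b\<^bold>\<in>\<real>. \<^bold>\<forall>c\<^bold>\<in>\<real>. B \<cdot> Var b \<cdot> Var c \<^bold>\<le> one) \<^bold>\<and> fun2 B)"

definition mem2 :: "tm \<Rightarrow> tm \<Rightarrow> tm \<Rightarrow> fm" where
  "mem2 b c B = (B \<cdot> b \<cdot> c \<^bold>= one)"

definition inj_on_set2 :: "tm \<Rightarrow> tm \<Rightarrow> fm" where
  "inj_on_set2 Z B =
     (let b = newv 0 T1 [Z, B]; c = newv 1 T1 [Z, B]; b' = newv 2 T1 [Z, B]; c' = newv 3 T1 [Z, B] in
      \<^bold>\<forall>b\<^bold>\<in>\<real>. \<^bold>\<forall>c\<^bold>\<in>\<real>. \<^bold>\<forall>b'\<^bold>\<in>\<real>. \<^bold>\<forall>c'\<^bold>\<in>\<real>.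
        mem2 (Var b) (Var c) B \<^bold>\<longrightarrow> mem2 (Var b') (Var c') B \<^bold>\<longrightarrow>
        Z \<cdot> Var b \<cdot> Var c \<^bold>= Z \<cdot> Var b' \<cdot> Var c' \<^bold>\<longrightarrow> Var b \<^bold>=\<^sub>R Var b' \<^bold>\<and> Var c \<^bold>=\<^sub>R Var c')"

definition covers :: "tm \<Rightarrow> tm \<Rightarrow> fm" where
  "covers B A =
     (let a = newv 0 T1 [B, A]; b = newv 1 T1 [B, A]; c = newv 2 T1 [B, A] in
      \<^bold>\<forall>a\<^bold>\<in>\<real>. Var a \<^bold>\<in> A \<^bold>\<longrightarrow>
        (\<^bold>\<exists>b\<^bold>\<in>\<real>. \<^bold>\<exists>c\<^bold>\<in>\<real>. mem2 (Var b) (Var c) B \<^bold>\<and>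
           Var b \<^bold><\<^sub>R Var a \<^bold>\<and> Var a \<^bold><\<^sub>R Var c))"

definition lengths_bounded :: "tm \<Rightarrow> tm \<Rightarrow> tm \<Rightarrow> fm" where
  "lengths_bounded B Z e =
     (let b = newv 0 T1 [B, Z, e]; c = newv 1 T1 [B, Z, e]; n = newv 0 N [B, Z, e] in
      \<^bold>\<forall>b\<^bold>\<in>\<real>. \<^bold>\<forall>c\<^bold>\<in>\<real>. mem2 (Var b) (Var c) B \<^bold>\<longrightarrow>
        (\<^bold>\<forall>n. Z \<cdot> Var b \<cdot> Var c \<^bold>= Var n \<^bold>\<longrightarrow> realdist (Var b) (Var c) \<^bold>\<le>\<^sub>R e \<cdot> Var n))"

text \<open>
  The bounds \<open>e n\<close> are taken to be non-negative, as is understood for bounds on lengths: if indices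
  outside the range of \<open>Z\<close> could carry negative summands, every bounded set would have weak measure
  zero.
\<close>

definition nonneg_reals :: "tm \<Rightarrow> fm" where
  "nonneg_reals e = (let n = newv 0 N [e] in
     \<^bold>\<forall>n. is_real (e \<cdot> Var n) \<^bold>\<and> real_of_rat zeroQ \<^bold>\<le>\<^sub>R e \<cdot> Var n)"

definition series_le :: "tm \<Rightarrow> tm \<Rightarrow> fm" where
  "series_le e d = (let s = newv 0 T1 [e, d] in
     \<^bold>\<exists>s\<^bold>\<in>\<real>. series_sums e (Var s) \<^bold>\<and> Var s \<^bold>\<le>\<^sub>R d)"

definition weak_measure_zero :: "tm \<Rightarrow> fm" where
  "weak_measure_zero A =
     (let d = newv 0 T1 [A]; e = newv 0 (N \<rightarrow>\<^sub>t T1) [A]; B = newv 0 T11 [A]; Z = newv 1 T11 [A] in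
      \<^bold>\<forall>d\<^bold>\<in>\<real>. real_of_rat zeroQ \<^bold><\<^sub>R Var d \<^bold>\<longrightarrow>
        (\<^bold>\<exists>e. \<^bold>\<exists>B. \<^bold>\<exists>Z.
           nonneg_reals (Var e) \<^bold>\<and> is_set2 (Var B) \<^bold>\<and> fun2 (Var Z) \<^bold>\<and>
           inj_on_set2 (Var Z) (Var B) \<^bold>\<and>
           covers (Var B) A \<^bold>\<and>
           lengths_bounded (Var B) (Var Z) (Var e) \<^bold>\<and>
           series_le (Var e) (Var d)))"

definition countable_sets_weak_measure_zero :: fm where
  "countable_sets_weak_measure_zero =
     (let A = (0, T2) in
      \<^bold>\<forall>A. is_set (Var A) \<^bold>\<and> subset_unit (Var A) \<^bold>\<and> countable_set (Var A) \<^bold>\<longrightarrow>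
        weak_measure_zero (Var A))"

end

theory Submission
  imports Defs "HOL-Library.Countable" "HOL-Computational_Algebra.Fraction_Field"
begin

text \<open>
  The calculus is complete: an unprovable formula fails in a term model obtained from a Henkin set,
  in which the free variables serve as witnesses. We therefore argue semantically in an arbitrary
  extensional model of \<open>ACA0_omega\<close>. Its numbers satisfy primitive recursive arithmetic and embed
  into an ordered field, where codes of rationals and the approximations of reals can be evaluated.

  Given \<open>A\<close>, \<open>Y\<close> and \<open>d > 0\<close>, fix \<open>K\<close> with \<open>2^-K \<le> d\<close> and select the intervals
  \<open>(a - r, a + r)\<close> with \<open>a \<in> A\<close> and \<open>r = 2^-(K + 2 + Y a)\<close>. The point \<open>a\<close> is recovered
  as the midpoint of the interval, so membership of a pair of reals in this set is a matter of
  equality of reals, which \<open>(\<exists>\<^sup>2)\<close> decides; no choice of the points \<open>a\<close> is needed. An interval is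
  indexed by \<open>Y a\<close>, and the lengths \<open>2^-(K + 1 + n)\<close> sum to \<open>2^-K\<close>.
\<close>

text \<open>A formal derivation would have to push every rational estimate through combinator terms;
  in a model the same estimates are field arithmetic in HOL. The obstacle is that the model may be
  nonstandard and satisfies induction for quantifier-free formulas only. Hence its numbers cannot be
  identified with \<open>nat\<close>, every induction over them has to exhibit a quantifier-free
  formula, and limits are replaced by exact identities such as
  \<open>partial sum + 2^-(K + n) = 2^-K\<close>. The field may likewise fail to be Archimedean; the
  substitute is that the numbers of the model are cofinal in it. Reals are not identified with
  points of the field: they remain sequences of approximations with a rate of convergence.

  Two choices make the intervals fit the definitions. \<open>Y\<close> respects equality of reals
  only inside the unit interval, so the index of a pair with midpoint \<open>m\<close> is
  \<open>A m * Y m\<close>, which vanishes off \<open>A\<close>. And the radius is a single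
  rational, so shifting a real by it, like taking a midpoint, preserves the rate of
  convergence.\<close>

declare split_paired_All [simp del] split_paired_Ex [simp del]

section \<open>Substitution\<close>

text \<open>Polymorphic in the values: on terms this is \<open>scons\<close>, on elements of a model
  it extends a valuation at a quantifier. One set of lemmas serves both.\<close>

definition vcons :: "ty \<Rightarrow> 'a \<Rightarrow> (var \<Rightarrow> 'a) \<Rightarrow> var \<Rightarrow> 'a" where
  "vcons \<rho> a e x =
     (if snd x = \<rho> then (case fst x of 0 \<Rightarrow> a | Suc i \<Rightarrow> e (i, \<rho>)) else e x)"

lemma scons_vcons: "scons = vcons"
  by (simp add: fun_eq_iff scons_def vcons_def)

lemma vcons_shift [simp]: "vcons \<rho> a e (shift \<rho> x) = e x"
  by (cases x) (auto simp: vcons_def shift_def)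

lemma vcons_zero [simp]: "vcons \<rho> a e (0, \<rho>) = a"
  by (simp add: vcons_def)

lemma snd_shift [simp]: "snd (shift \<rho> x) = snd x"
  by (simp add: shift_def)

lemma shift_cases:
  obtains "x = (0, \<rho>)" | y where "x = shift \<rho> y"
proof (cases "snd x = \<rho>")
  case True
  then show ?thesis
    using that by (cases "fst x") (auto simp: shift_def prod_eq_iff intro: that(2)[of "(n, \<rho>)" for n])
next
  case False
  then show ?thesis using that(2)[of x] by (simp add: shift_def)
qed

text \<open>\<open>shift \<rho>\<close> misses exactly \<open>(0, \<rho>)\<close>, so two cases
  determine a map on variables. The laws of substitution are checked this way, without index
  arithmetic.\<close>

lemma vcons_eqI:
  "f (0, \<rho>) = a \<Longrightarrow> (\<And>y. f (shift \<rho> y) = e y) \<Longrightarrow> vcons \<rho> a e = f"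
  by (rule ext, rule_tac x = x and \<rho> = \<rho> in shift_cases) auto

lemma tsubst_Var [simp]: "tsubst Var t = t"
  by (induction t) auto

lemma tsubst_tsubst: "tsubst \<theta> (tsubst \<sigma> t) = tsubst (\<lambda>x. tsubst \<theta> (\<sigma> x)) t"
  by (induction t) auto

definition ups :: "ty \<Rightarrow> (var \<Rightarrow> tm) \<Rightarrow> var \<Rightarrow> tm" where
  "ups \<rho> \<theta> = vcons \<rho> (Var (0, \<rho>)) (\<lambda>x. tsubst (Var \<circ> shift \<rho>) (\<theta> x))"

lemma subst_Forall [simp]: "subst \<theta> (Forall \<rho> \<phi>) = Forall \<rho> (subst (ups \<rho> \<theta>) \<phi>)"
  by (simp add: ups_def scons_vcons)

declare subst.simps(4) [simp del]

lemma ups_comp: "(\<lambda>x. tsubst (ups \<rho> \<theta>) (ups \<rho> \<sigma> x)) = ups \<rho> (\<lambda>x. tsubst \<theta> (\<sigma> x))"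
  unfolding ups_def[of \<rho> "\<lambda>x. tsubst \<theta> (\<sigma> x)"]
  by (rule vcons_eqI[symmetric]) (simp_all add: ups_def tsubst_tsubst comp_def)

lemma subst_subst: "subst \<theta> (subst \<sigma> \<phi>) = subst (\<lambda>x. tsubst \<theta> (\<sigma> x)) \<phi>"
  by (induction \<phi> arbitrary: \<theta> \<sigma>) (simp_all add: tsubst_tsubst ups_comp)

lemma ups_Var [simp]: "ups \<rho> Var = Var"
  unfolding ups_def by (rule vcons_eqI) simp_all

lemma subst_Var [simp]: "subst Var \<phi> = \<phi>"
  by (induction \<phi>) simp_all

lemma tsubst_cong: "(\<And>x. x \<in> tvars t \<Longrightarrow> \<theta> x = \<sigma> x) \<Longrightarrow> tsubst \<theta> t = tsubst \<sigma> t"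
  by (induction t) auto

lemma ups_cong:
  assumes "\<And>y. shift \<rho> y \<in> X \<Longrightarrow> \<theta> y = \<sigma> y" and "x \<in> X"
  shows "ups \<rho> \<theta> x = ups \<rho> \<sigma> x"
proof (rule shift_cases[of x \<rho>])
  fix y assume "x = shift \<rho> y"
  then show ?thesis using assms(1)[of y] assms(2) by (simp add: ups_def)
qed (simp add: ups_def)

lemma subst_cong: "(\<And>x. x \<in> fv \<phi> \<Longrightarrow> \<theta> x = \<sigma> x) \<Longrightarrow> subst \<theta> \<phi> = subst \<sigma> \<phi>"
proof (induction \<phi> arbitrary: \<theta> \<sigma>)
  case (Eq s t)
  then show ?case by (auto intro: tsubst_cong)
next
  case (Imp \<phi> \<psi>)
  have "subst \<theta> \<phi> = subst \<sigma> \<phi>" by (rule Imp.IH(1), rule Imp.prems) simp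
  moreover have "subst \<theta> \<psi> = subst \<sigma> \<psi>" by (rule Imp.IH(2), rule Imp.prems) simp
  ultimately show ?case by simp
next
  case (Forall \<rho> \<phi>)
  have "subst (ups \<rho> \<theta>) \<phi> = subst (ups \<rho> \<sigma>) \<phi>"
    by (rule Forall.IH, rule ups_cong[of \<rho> "fv \<phi>"]) (use Forall.prems in auto)
  then show ?case by simp
qed simp

lemma inj_shift: "inj (shift \<rho>)"
  by (auto simp: inj_def shift_def prod_eq_iff split: if_splits)

lemma finite_tvars: "finite (tvars t)"
  by (induction t) auto

lemma finite_fv: "finite (fv \<phi>)"
proof (induction \<phi>)
  case (Forall \<rho> \<phi>)
  have "{x. shift \<rho> x \<in> fv \<phi>} = shift \<rho> -` fv \<phi>" by auto
  then show ?case using finite_vimageI[OF Forall.IH inj_shift] by simp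
qed (auto simp: finite_tvars)

section \<open>Type preservation and commutation of substitutions\<close>

definition wt_subst :: "(var \<Rightarrow> tm) \<Rightarrow> bool" where
  "wt_subst \<theta> \<longleftrightarrow> (\<forall>x. wt (\<theta> x) \<and> ty_of (\<theta> x) = snd x)"

lemma wt_substD: "wt_subst \<theta> \<Longrightarrow> wt (\<theta> x)" "wt_subst \<theta> \<Longrightarrow> ty_of (\<theta> x) = snd x"
  unfolding wt_subst_def by blast+

lemma ty_of_tsubst [simp]: "wt_subst \<theta> \<Longrightarrow> ty_of (tsubst \<theta> t) = ty_of t"
  by (induction t) (auto simp: wt_subst_def)

lemma wt_tsubst [simp]: "wt_subst \<theta> \<Longrightarrow> wt t \<Longrightarrow> wt (tsubst \<theta> t)"
  by (induction t) (auto simp: wt_substD)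

lemma wt_subst_Var [simp]: "wt_subst Var" "wt_subst (Var \<circ> shift \<rho>)"
  by (auto simp: wt_subst_def)

lemma wt_subst_vcons [simp]:
  "wt_subst \<theta> \<Longrightarrow> wt t \<Longrightarrow> ty_of t = \<rho> \<Longrightarrow> wt_subst (vcons \<rho> t \<theta>)"
  by (auto simp: wt_subst_def vcons_def split: nat.splits)

lemma wt_subst_upd [simp]:
  "wt_subst \<theta> \<Longrightarrow> wt t \<Longrightarrow> ty_of t = snd x \<Longrightarrow> wt_subst (\<theta>(x := t))"
  by (auto simp: wt_subst_def)

lemma wt_subst_ups [simp]: "wt_subst \<theta> \<Longrightarrow> wt_subst (ups \<rho> \<theta>)"
  unfolding ups_def by (rule wt_subst_vcons) (auto simp: wt_subst_def[of "\<lambda>x. tsubst _ (\<theta> x)"] wt_substD)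

lemma wff_subst [simp]: "wt_subst \<theta> \<Longrightarrow> wff \<phi> \<Longrightarrow> wff (subst \<theta> \<phi>)"
  by (induction \<phi> arbitrary: \<theta>) auto

lemma wff_inst [simp]: "wff \<phi> \<Longrightarrow> wt t \<Longrightarrow> ty_of t = \<rho> \<Longrightarrow> wff (inst \<rho> t \<phi>)"
  by (simp add: inst_def scons_vcons)

lemma subst_lift: "subst (ups \<rho> \<theta>) (lift \<rho> \<phi>) = lift \<rho> (subst \<theta> \<phi>)"
  by (simp add: lift_def subst_subst ups_def comp_def)

lemma inst_subst: "inst \<rho> t (subst (ups \<rho> \<theta>) \<phi>) = subst (vcons \<rho> t \<theta>) \<phi>"
proof -
  have "vcons \<rho> t \<theta> = (\<lambda>x. tsubst (vcons \<rho> t Var) (ups \<rho> \<theta> x))"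
    by (rule vcons_eqI) (simp_all add: ups_def tsubst_tsubst)
  then show ?thesis by (simp add: inst_def scons_vcons subst_subst)
qed

lemma subst_inst: "subst \<theta> (inst \<rho> t \<phi>) = inst \<rho> (tsubst \<theta> t) (subst (ups \<rho> \<theta>) \<phi>)"
proof -
  have "vcons \<rho> (tsubst \<theta> t) \<theta> = (\<lambda>x. tsubst \<theta> (vcons \<rho> t Var x))"
    by (rule vcons_eqI) simp_all
  then show ?thesis by (simp add: inst_subst) (simp add: inst_def scons_vcons subst_subst)
qed


section \<open>Derivations\<close>

lemma derives_wff: "derives T \<Gamma> \<phi> \<Longrightarrow> wff \<phi>"
  by (induction rule: derives.induct) auto

text \<open>Inclusion of the underlying sets covers weakening, exchange and contraction at
  once.\<close>

lemma derives_weaken: "derives T \<Gamma> \<phi> \<Longrightarrow> set \<Gamma> \<subseteq> set \<Gamma>' \<Longrightarrow> derives T \<Gamma>' \<phi>"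
proof (induction arbitrary: \<Gamma>' rule: derives.induct)
  case (impI \<phi> \<Gamma> \<psi>)
  then have "derives T (\<phi> # \<Gamma>') \<psi>" by (intro impI.IH) auto
  with impI.hyps(1) show ?case by (rule derives.impI)
next
  case (raa \<phi> \<Gamma>)
  then have "derives T ((\<^bold>\<not> \<phi>) # \<Gamma>') \<^bold>\<bottom>" by (intro raa.IH) auto
  with raa.hyps(1) show ?case by (rule derives.raa)
next
  case (allI \<rho> \<Gamma> \<phi>)
  then have "derives T (map (lift \<rho>) \<Gamma>') \<phi>" by (intro allI.IH) auto
  then show ?case by (rule derives.allI)
next
  case (impE \<Gamma> \<phi> \<psi>)
  from impE.IH(1)[OF impE.prems] impE.IH(2)[OF impE.prems] show ?case by (rule derives.impE)
next
  case (allE \<Gamma> \<rho> \<phi> t)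
  from allE.IH[OF allE.prems] allE.hyps(2,3) show ?case by (rule derives.allE)
next
  case (axm \<phi> \<Gamma>)
  then show ?case by (simp add: derives.axm)
next
  case (asm \<phi> \<Gamma>)
  then show ?case by (simp add: derives.asm subsetD)
qed

text \<open>
  Substitutions that replace finitely many variables of each sort, shifting the others down. They
  are iterated instances, and \<open>shift\<close> provides them with a section.
\<close>

fun iterated_cons :: "ty list \<Rightarrow> (var \<Rightarrow> tm) \<Rightarrow> var \<Rightarrow> tm" where
  "iterated_cons [] \<theta> = Var"
| "iterated_cons (\<rho> # \<rho>s) \<theta> =
     vcons \<rho> (\<theta> (0, \<rho>)) (iterated_cons \<rho>s (\<theta> \<circ> shift \<rho>))"

lemma iterated_cons_section:
  "\<exists>r. wt_subst (Var \<circ> r) \<and> (\<forall>x. iterated_cons \<rho>s \<theta> (r x) = Var x)"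
proof (induction \<rho>s arbitrary: \<theta>)
  case Nil
  show ?case by (rule exI[of _ "\<lambda>x. x"]) (simp add: wt_subst_def)
next
  case (Cons \<rho> \<rho>s)
  then obtain r where "wt_subst (Var \<circ> r)" "\<forall>x. iterated_cons \<rho>s (\<theta> \<circ> shift \<rho>) (r x) = Var x"
    by blast
  then show ?case by (intro exI[of _ "shift \<rho> \<circ> r"]) (simp add: wt_subst_def)
qed

text \<open>The premise ranges over all contexts because generalization lifts the context above
  it.\<close>

lemma derives_inst:
  "(\<And>\<Gamma>. derives T \<Gamma> \<phi>) \<Longrightarrow> wt t \<Longrightarrow> ty_of t = \<rho> \<Longrightarrow> derives T \<Gamma> (inst \<rho> t \<phi>)"
  by (rule derives.allE[OF derives.allI])

lemma wt_subst_comp_shift: "wt_subst \<theta> \<Longrightarrow> wt_subst (\<theta> \<circ> shift \<rho>)"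
  by (simp add: wt_subst_def)

lemma derives_iterated_cons:
  "(\<And>\<Gamma>. derives T \<Gamma> \<phi>) \<Longrightarrow> wt_subst \<theta> \<Longrightarrow> derives T \<Gamma> (subst (iterated_cons \<rho>s \<theta>) \<phi>)"
proof (induction \<rho>s arbitrary: \<theta> \<phi> \<Gamma>)
  case (Cons \<rho> \<rho>s)
  let ?\<theta>' = "iterated_cons \<rho>s (\<theta> \<circ> shift \<rho>)"
  obtain r where r: "wt_subst (Var \<circ> r)" "\<forall>x. ?\<theta>' (r x) = Var x"
    using iterated_cons_section by blast
  \<comment> \<open>The remaining instances will also act on the inserted term; renaming it by
    \<open>r\<close> beforehand cancels their effect.\<close>
  let ?t = "tsubst (Var \<circ> r) (\<theta> (0, \<rho>))"
  have t: "wt ?t" "ty_of ?t = \<rho>" "tsubst ?\<theta>' ?t = \<theta> (0, \<rho>)"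
    using r Cons.prems(2) by (simp_all add: wt_substD tsubst_tsubst)
  have "derives T \<Gamma> (subst ?\<theta>' (inst \<rho> ?t \<phi>))"
    using Cons.prems t by (intro Cons.IH derives_inst wt_subst_comp_shift) auto
  also have "subst ?\<theta>' (inst \<rho> ?t \<phi>) = subst (iterated_cons (\<rho> # \<rho>s) \<theta>) \<phi>"
    by (simp only: subst_inst inst_subst t iterated_cons.simps)
  finally show ?case .
qed simp

lemma iterated_cons_eq: "fst x < count_list \<rho>s (snd x) \<Longrightarrow> iterated_cons \<rho>s \<theta> x = \<theta> x"
proof (induction \<rho>s arbitrary: x \<theta>)
  case (Cons \<rho> \<rho>s)
  show ?case
  proof (rule shift_cases[of x \<rho>])
    fix y assume y: "x = shift \<rho> y"
    then have "fst y < count_list \<rho>s (snd y)"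
      using Cons.prems by (auto simp: shift_def split: if_splits)
    then show ?thesis using Cons.IH y by simp
  qed simp
qed simp

text \<open>Finitely many variables are reached by listing each of their sorts often enough.\<close>

lemma ex_iterated_cons:
  assumes "finite X"
  shows "\<exists>\<rho>s. \<forall>x\<in>X. iterated_cons \<rho>s \<theta> x = \<theta> x"
proof -
  have "\<exists>\<rho>s. \<forall>x\<in>X. fst x < count_list \<rho>s (snd x)"
    using assms
  proof (induction X)
    case (insert x X)
    then obtain \<rho>s where \<rho>s: "\<forall>x\<in>X. fst x < count_list \<rho>s (snd x)" by blast
    have "count_list (replicate n \<rho>) \<rho> = n" for n and \<rho> :: ty by (induction n) auto
    then show ?case using \<rho>s
      by (intro exI[of _ "replicate (Suc (fst x)) (snd x) @ \<rho>s"]) (auto simp: count_list_append intro: trans_less_add2)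
  qed simp
  then show ?thesis using iterated_cons_eq by blast
qed

text \<open>Axioms may be open, and only one variable at a time can be instantiated. In the axiom
  case the substitution is therefore replaced by iterated instances that agree with it on the free
  variables.\<close>

lemma derives_subst:
  "derives T \<Gamma> \<phi> \<Longrightarrow> wt_subst \<theta> \<Longrightarrow> derives T (map (subst \<theta>) \<Gamma>) (subst \<theta> \<phi>)"
proof (induction arbitrary: \<theta> rule: derives.induct)
  case (axm \<phi> \<Gamma>)
  obtain \<rho>s where "\<forall>x\<in>fv \<phi>. iterated_cons \<rho>s \<theta> x = \<theta> x"
    using ex_iterated_cons finite_fv by blast
  then have "subst \<theta> \<phi> = subst (iterated_cons \<rho>s \<theta>) \<phi>"
    by (intro subst_cong) auto
  then show ?case using axm by (simp add: derives_iterated_cons derives.axm)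
next
  case (asm \<phi> \<Gamma>)
  then show ?case by (simp add: derives.asm)
next
  case (allI \<rho> \<Gamma> \<phi>)
  have "derives T (map (subst (ups \<rho> \<theta>)) (map (lift \<rho>) \<Gamma>)) (subst (ups \<rho> \<theta>) \<phi>)"
    using allI by simp
  then have "derives T (map (lift \<rho>) (map (subst \<theta>) \<Gamma>)) (subst (ups \<rho> \<theta>) \<phi>)"
    by (simp add: subst_lift comp_def)
  then show ?case by (simp add: derives.allI)
next
  case (allE \<Gamma> \<rho> \<phi> t)
  then have "derives T (map (subst \<theta>) \<Gamma>) (Forall \<rho> (subst (ups \<rho> \<theta>) \<phi>))" by simp
  then have "derives T (map (subst \<theta>) \<Gamma>) (inst \<rho> (tsubst \<theta> t) (subst (ups \<rho> \<theta>) \<phi>))"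
    using allE by (intro derives.allE[of T _ \<rho>]) simp_all
  then show ?case by (simp add: subst_inst)
next
  case (impE \<Gamma> \<phi> \<psi>)
  then have "derives T (map (subst \<theta>) \<Gamma>) (subst \<theta> \<phi> \<^bold>\<longrightarrow> subst \<theta> \<psi>)" by fastforce
  then show ?case using impE.IH(2)[OF impE.prems] by (rule derives.impE)
next
  case (raa \<phi> \<Gamma>)
  have "derives T ((\<^bold>\<not> subst \<theta> \<phi>) # map (subst \<theta>) \<Gamma>) \<^bold>\<bottom>"
    using raa.IH[OF raa.prems] by simp
  moreover have "wff (subst \<theta> \<phi>)" using raa by simp
  ultimately show ?case by (rule derives.raa[rotated])
next
  case (impI \<phi> \<Gamma> \<psi>)
  have "derives T (subst \<theta> \<phi> # map (subst \<theta>) \<Gamma>) (subst \<theta> \<psi>)"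
    using impI.IH[OF impI.prems] by simp
  moreover have "wff (subst \<theta> \<phi>)" using impI by simp
  ultimately show ?case by (simp add: derives.impI)
qed

text \<open>The rule \<open>allI\<close> for a fresh free variable instead of a de Bruijn index.
  Under the binder \<open>(k, \<rho>)\<close> reads \<open>(Suc k, \<rho>)\<close>, which explains
  the condition on \<open>\<chi>\<close>.\<close>

lemma derives_generalize:
  assumes "derives T \<Gamma> (inst \<rho> (Var (k, \<rho>)) \<chi>)"
    and "\<And>\<psi>. \<psi> \<in> set \<Gamma> \<Longrightarrow> (k, \<rho>) \<notin> fv \<psi>" and "(Suc k, \<rho>) \<notin> fv \<chi>"
  shows "derives T \<Gamma> (Forall \<rho> \<chi>)"
proof -
  \<comment> \<open>Moves the fresh variable to index 0 and shifts all others: on the context this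
    is \<open>lift\<close>, on the instance it restores \<open>\<chi>\<close>.\<close>
  define \<theta> where "\<theta> = (Var \<circ> shift \<rho>)((k, \<rho>) := Var (0, \<rho>))"
  have "wt_subst \<theta>" unfolding \<theta>_def by (rule wt_subst_upd) simp_all
  then have "derives T (map (subst \<theta>) \<Gamma>) (subst \<theta> (inst \<rho> (Var (k, \<rho>)) \<chi>))"
    using assms(1) derives_subst by blast
  also have "map (subst \<theta>) \<Gamma> = map (lift \<rho>) \<Gamma>"
    using assms(2) by (auto simp: lift_def \<theta>_def intro!: subst_cong)
  also have "subst \<theta> (inst \<rho> (Var (k, \<rho>)) \<chi>) = subst Var \<chi>"
    unfolding inst_def scons_vcons subst_subst
  proof (rule subst_cong)
    fix x assume x: "x \<in> fv \<chi>"
    show "tsubst \<theta> (vcons \<rho> (Var (k, \<rho>)) Var x) = Var x"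
    proof (rule shift_cases[of x \<rho>])
      fix y assume "x = shift \<rho> y"
      moreover from this have "y \<noteq> (k, \<rho>)" using x assms(3) by (auto simp: shift_def)
      ultimately show ?thesis by (simp add: \<theta>_def)
    qed (simp add: \<theta>_def)
  qed
  finally show ?thesis by (simp add: derives.allI)
qed


section \<open>Henkin sets\<close>

instance ty :: countable by countable_datatype
instance tm :: countable by countable_datatype
instance fm :: countable by countable_datatype

lemma ex_fresh: "finite (X :: var set) \<Longrightarrow> \<exists>k. \<forall>i\<ge>k. (i, \<rho>) \<notin> X"
proof -
  assume "finite (X :: var set)"
  then have "finite (fst ` X)" by simp
  then have "\<exists>k. \<forall>i\<in>fst ` X. i < k" by (simp only: finite_nat_set_iff_bounded)
  then obtain k where "\<forall>i\<in>fst ` X. i < k" ..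
  then show ?thesis by (force intro: exI[of _ k])
qed

definition consistent :: "fm set \<Rightarrow> fm list \<Rightarrow> bool" where
  "consistent T \<Gamma> \<longleftrightarrow> \<not> derives T \<Gamma> \<^bold>\<bottom>"

lemma henkin_step:
  assumes \<Gamma>: "consistent T \<Gamma>" and \<phi>: "wff \<phi>"
  shows "\<exists>\<Gamma>'. consistent T \<Gamma>' \<and> set \<Gamma> \<subseteq> set \<Gamma>' \<and>
    (\<phi> \<in> set \<Gamma>' \<or> (\<^bold>\<not> \<phi>) \<in> set \<Gamma>' \<and>
       (\<forall>\<rho> \<chi>. \<phi> = Forall \<rho> \<chi> \<longrightarrow> (\<exists>k. (\<^bold>\<not> inst \<rho> (Var (k, \<rho>)) \<chi>) \<in> set \<Gamma>')))"
proof (cases "consistent T (\<phi> # \<Gamma>)")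
  case True
  then show ?thesis by (intro exI[of _ "\<phi> # \<Gamma>"]) auto
next
  case False
  then have neg: "derives T \<Gamma> (\<^bold>\<not> \<phi>)"
    unfolding consistent_def using \<phi> by (intro derives.impI) auto
  have no: "\<not> derives T ((\<^bold>\<not> \<phi>) # \<Gamma>) \<phi>"
  proof
    assume "derives T ((\<^bold>\<not> \<phi>) # \<Gamma>) \<phi>"
    moreover have "derives T ((\<^bold>\<not> \<phi>) # \<Gamma>) (\<^bold>\<not> \<phi>)"
      using neg by (rule derives_weaken) auto
    ultimately have "derives T ((\<^bold>\<not> \<phi>) # \<Gamma>) \<^bold>\<bottom>" by (blast intro: derives.impE)
    then have "derives T \<Gamma> \<phi>" using \<phi> by (blast intro: derives.raa)
    then show False using \<Gamma> neg by (auto simp: consistent_def intro: derives.impE)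
  qed
  then have con: "consistent T ((\<^bold>\<not> \<phi>) # \<Gamma>)"
    unfolding consistent_def
    by (metis \<Gamma> \<phi> consistent_def derives.impE derives.raa neg)
  show ?thesis
  proof (cases "\<exists>\<rho> \<chi>. \<phi> = Forall \<rho> \<chi>")
    case True
    then obtain \<rho> \<chi> where \<chi>: "\<phi> = Forall \<rho> \<chi>" by blast
    let ?\<Delta> = "(\<^bold>\<not> \<phi>) # \<Gamma>"
    have "finite (\<Union> (fv ` set ?\<Delta>) \<union> fv \<chi>)" using finite_fv by auto
    from ex_fresh[OF this] obtain k where
      k: "\<forall>i\<ge>k. (i, \<rho>) \<notin> \<Union> (fv ` set ?\<Delta>) \<union> fv \<chi>" by metis
    let ?\<psi> = "inst \<rho> (Var (k, \<rho>)) \<chi>"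
    have w: "wff ?\<psi>" using \<phi> \<chi> by simp
    \<comment> \<open>A contradiction here would prove the instance at a fresh variable, hence
      \<open>\<phi>\<close> itself, against \<open>no\<close>.\<close>
    have "consistent T ((\<^bold>\<not> ?\<psi>) # ?\<Delta>)"
      unfolding consistent_def
    proof
      assume "derives T ((\<^bold>\<not> ?\<psi>) # ?\<Delta>) \<^bold>\<bottom>"
      then have "derives T ?\<Delta> ?\<psi>" using w by (rule derives.raa[rotated])
      moreover have "(Suc k, \<rho>) \<notin> fv \<chi>" using k by (metis UnCI le_SucI order_refl)
      moreover have "(k, \<rho>) \<notin> fv \<psi>" if "\<psi> \<in> set ?\<Delta>" for \<psi> using k that by blast
      ultimately have "derives T ?\<Delta> \<phi>"
        unfolding \<chi> by (intro derives_generalize[of T _ \<rho> k])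
      then show False using no by simp
    qed
    then show ?thesis using \<chi> by (intro exI[of _ "(\<^bold>\<not> ?\<psi>) # ?\<Delta>"]) auto
  next
    case False
    then show ?thesis using con by (intro exI[of _ "(\<^bold>\<not> \<phi>) # \<Gamma>"]) auto
  qed
qed

text \<open>The last clause is the witness property read contrapositively: a rejected universal
  formula has a rejected instance.\<close>

definition henkin_set :: "fm set \<Rightarrow> fm set \<Rightarrow> bool" where
  "henkin_set T H \<longleftrightarrow>
     (\<forall>\<Gamma> \<phi>. set \<Gamma> \<subseteq> H \<longrightarrow> derives T \<Gamma> \<phi> \<longrightarrow> \<phi> \<in> H) \<and> \<^bold>\<bottom> \<notin> H \<and>
     (\<forall>\<phi>. wff \<phi> \<longrightarrow> \<phi> \<in> H \<or> (\<^bold>\<not> \<phi>) \<in> H) \<and>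
     (\<forall>\<rho> \<chi>. wff \<chi> \<longrightarrow> (\<forall>t. wt t \<longrightarrow> ty_of t = \<rho> \<longrightarrow> inst \<rho> t \<chi> \<in> H) \<longrightarrow> Forall \<rho> \<chi> \<in> H)"

text \<open>Stage \<open>n\<close> treats the formula coded by \<open>n\<close>. Every stage is a
  finite list, so fresh variables never run out; a derivation uses finitely many assumptions, so the
  union inherits consistency.\<close>

lemma ex_henkin_set:
  assumes "consistent T \<Gamma>"
  shows "\<exists>H. henkin_set T H \<and> set \<Gamma> \<subseteq> H"
proof -
  \<comment> \<open>The enumeration also meets ill-formed formulas; at those stages only consistency
    and growth are demanded.\<close>
  define ok where "ok \<phi> \<Gamma> \<Gamma>' \<longleftrightarrow> consistent T \<Gamma>' \<and> set \<Gamma> \<subseteq> set \<Gamma>' \<and> (wff \<phi> \<longrightarrow>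
    (\<phi> \<in> set \<Gamma>' \<or> (\<^bold>\<not> \<phi>) \<in> set \<Gamma>' \<and>
       (\<forall>\<rho> \<chi>. \<phi> = Forall \<rho> \<chi> \<longrightarrow> (\<exists>k. (\<^bold>\<not> inst \<rho> (Var (k, \<rho>)) \<chi>) \<in> set \<Gamma>'))))"
    for \<phi> \<Gamma> \<Gamma>'
  have ok_ex: "\<exists>\<Gamma>'. ok \<phi> \<Gamma> \<Gamma>'" if "consistent T \<Gamma>" for \<phi> \<Gamma>
    using henkin_step[OF that, of \<phi>] that unfolding ok_def by (cases "wff \<phi>") auto
  define G where "G = rec_nat \<Gamma> (\<lambda>n \<Delta>. SOME \<Gamma>'. ok (from_nat n) \<Delta> \<Gamma>')"
  have G0: "G 0 = \<Gamma>" and GS: "G (Suc n) = (SOME \<Gamma>'. ok (from_nat n) (G n) \<Gamma>')" for n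
    by (simp_all add: G_def)
  have con: "consistent T (G n)" for n
  proof (induction n)
    case (Suc n)
    then show ?case using someI_ex[OF ok_ex[OF Suc, of "from_nat n"]] by (simp add: GS ok_def)
  qed (use assms G0 in simp)
  have ok: "ok (from_nat n) (G n) (G (Suc n))" for n
    using someI_ex[OF ok_ex[OF con, of "from_nat n"]] by (simp add: GS)
  have mono: "set (G m) \<subseteq> set (G n)" if "m \<le> n" for m n
    using that by (rule lift_Suc_mono_le[rotated]) (use ok in \<open>simp add: ok_def\<close>)
  define H where "H = (\<Union>n. set (G n))"
  have fin: "\<exists>n. set \<Delta> \<subseteq> set (G n)" if "set \<Delta> \<subseteq> H" for \<Delta>
    using that
  proof (induction \<Delta>)
    case (Cons \<phi> \<Delta>)
    then obtain m n where "set \<Delta> \<subseteq> set (G m)" "\<phi> \<in> set (G n)" by (auto simp: H_def)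
    then show ?case
      using mono[of m "max m n"] mono[of n "max m n"] by (intro exI[of _ "max m n"]) auto
  qed simp
  have H_con: "consistent T \<Delta>" if "set \<Delta> \<subseteq> H" for \<Delta>
    using fin[OF that] con unfolding consistent_def by (meson derives_weaken)
  have dec: "\<phi> \<in> H \<or> (\<^bold>\<not> \<phi>) \<in> H \<and>
       (\<forall>\<rho> \<chi>. \<phi> = Forall \<rho> \<chi> \<longrightarrow> (\<exists>k. (\<^bold>\<not> inst \<rho> (Var (k, \<rho>)) \<chi>) \<in> H))" if "wff \<phi>" for \<phi>
    using ok[of "to_nat \<phi>"] that unfolding ok_def H_def from_nat_to_nat by blast
  have closed: "\<phi> \<in> H" if "set \<Delta> \<subseteq> H" "derives T \<Delta> \<phi>" for \<Delta> \<phi>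
  proof (rule ccontr)
    assume "\<phi> \<notin> H"
    then have n: "(\<^bold>\<not> \<phi>) \<in> H" using dec derives_wff that by blast
    have "derives T ((\<^bold>\<not> \<phi>) # \<Delta>) \<phi>" using that(2) by (rule derives_weaken) auto
    moreover have "derives T ((\<^bold>\<not> \<phi>) # \<Delta>) (\<^bold>\<not> \<phi>)"
      using derives_wff[OF that(2)] by (intro derives.asm) auto
    ultimately have "\<not> consistent T ((\<^bold>\<not> \<phi>) # \<Delta>)"
      unfolding consistent_def by (blast intro: derives.impE)
    then show False using H_con[of "(\<^bold>\<not> \<phi>) # \<Delta>"] n that by auto
  qed
  have bot: "\<^bold>\<bottom> \<notin> H"
    using H_con[of "[\<^bold>\<bottom>]"] by (auto simp: consistent_def derives.asm)
  have wit: "Forall \<rho> \<chi> \<in> H"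
    if \<chi>: "wff \<chi>" "\<forall>t. wt t \<longrightarrow> ty_of t = \<rho> \<longrightarrow> inst \<rho> t \<chi> \<in> H" for \<rho> \<chi>
  proof (rule ccontr)
    assume "Forall \<rho> \<chi> \<notin> H"
    then obtain k where k: "(\<^bold>\<not> inst \<rho> (Var (k, \<rho>)) \<chi>) \<in> H"
      using dec[of "Forall \<rho> \<chi>"] \<chi>(1) by auto
    have i: "inst \<rho> (Var (k, \<rho>)) \<chi> \<in> H" using \<chi>(2) by simp
    have "derives T [\<^bold>\<not> inst \<rho> (Var (k, \<rho>)) \<chi>, inst \<rho> (Var (k, \<rho>)) \<chi>] \<^bold>\<bottom>" (is "derives T ?\<Gamma> _")
      by (rule derives.impE[of _ _ "inst \<rho> (Var (k, \<rho>)) \<chi>"])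
        (use \<chi>(1) in \<open>auto intro!: derives.asm\<close>)
    then show False using closed[of ?\<Gamma>] bot i k by simp
  qed
  have "henkin_set T H"
    unfolding henkin_set_def using closed bot dec wit by (intro conjI allI impI) metis+
  moreover have "set \<Gamma> \<subseteq> H" using G0 by (auto simp: H_def intro: exI[of _ 0])
  ultimately show ?thesis by blast
qed


section \<open>Structures\<close>

lemma newv_notin: "t \<in> set ts \<Longrightarrow> newv k \<rho> ts \<notin> tvars t"
proof -
  assume t: "t \<in> set ts"
  have "fst x < bound t" if "x \<in> tvars t" for x t
    using that by (induction t) auto
  moreover have "bound t \<le> foldr max (map bound ts) 0" using t by (induction ts) auto
  ultimately have "fst x < fst (newv k \<rho> ts)" if "x \<in> tvars t" for x
    using that by (fastforce simp: newv_def)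
  then show ?thesis by blast
qed

lemma newv_eq_iff [simp]: "newv k \<rho> ts = newv l \<tau> ts \<longleftrightarrow> k = l \<and> \<rho> = \<tau>"
  by (auto simp: newv_def)

lemma snd_newv [simp]: "snd (newv k \<rho> ts) = \<rho>"
  by (simp add: newv_def)

lemma wff_all_v [simp]: "wff \<phi> \<Longrightarrow> wff (\<^bold>\<forall>x. \<phi>)"
  unfolding all_v_def by simp

text \<open>The sorts are subsets \<open>D\<close> of one HOL type, because a family of types
  indexed by \<open>ty\<close> cannot be formed; application is a single untyped operation.\<close>

locale type_structure =
  fixes D :: "ty \<Rightarrow> 'd set"
    and ap :: "'d \<Rightarrow> 'd \<Rightarrow> 'd" (infixl "\<bullet>" 110)
    and zero suc rc :: 'd
    and kk :: "ty \<Rightarrow> ty \<Rightarrow> 'd"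
    and ss :: "ty \<Rightarrow> ty \<Rightarrow> ty \<Rightarrow> 'd"
begin

primrec tval :: "(var \<Rightarrow> 'd) \<Rightarrow> tm \<Rightarrow> 'd" where
  "tval e (Var x) = e x"
| "tval e Zero = zero"
| "tval e Succ = suc"
| "tval e (Kc \<rho> \<tau>) = kk \<rho> \<tau>"
| "tval e (Sc \<delta> \<rho> \<tau>) = ss \<delta> \<rho> \<tau>"
| "tval e Rc = rc"
| "tval e (s \<cdot> t) = tval e s \<bullet> tval e t"

primrec sat :: "(var \<Rightarrow> 'd) \<Rightarrow> fm \<Rightarrow> bool" where
  "sat e \<^bold>\<bottom> = False"
| "sat e (s \<^bold>= t) = (tval e s = tval e t)"
| "sat e (\<phi> \<^bold>\<longrightarrow> \<psi>) = (sat e \<phi> \<longrightarrow> sat e \<psi>)"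
| "sat e (Forall \<rho> \<phi>) = (\<forall>a\<in>D \<rho>. sat (vcons \<rho> a e) \<phi>)"

definition valid :: "(var \<Rightarrow> 'd) \<Rightarrow> bool" where
  "valid e \<longleftrightarrow> (\<forall>x. e x \<in> D (snd x))"

lemma valid_upd [simp]: "valid e \<Longrightarrow> a \<in> D (snd x) \<Longrightarrow> valid (e(x := a))"
  by (simp add: valid_def)

lemma tval_tsubst: "tval e (tsubst \<theta> t) = tval (\<lambda>x. tval e (\<theta> x)) t"
  by (induction t) auto

lemma sat_subst: "sat e (subst \<theta> \<phi>) = sat (\<lambda>x. tval e (\<theta> x)) \<phi>"
proof (induction \<phi> arbitrary: e \<theta>)
  case (Forall \<rho> \<phi>)
  have "(\<lambda>x. tval (vcons \<rho> a e) (ups \<rho> \<theta> x)) = vcons \<rho> a (\<lambda>x. tval e (\<theta> x))" for a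
    by (rule vcons_eqI[symmetric]) (simp_all add: ups_def tval_tsubst)
  then show ?case by (simp add: Forall.IH)
qed (simp_all add: tval_tsubst)

lemma sat_all_v [simp]: "sat e (\<^bold>\<forall>x. \<phi>) \<longleftrightarrow> (\<forall>a\<in>D (snd x). sat (e(x := a)) \<phi>)"
proof -
  have "(\<lambda>y. tval (vcons (snd x) a e) (((Var \<circ> shift (snd x))(x := Var (0, snd x))) y)) = e(x := a)" for a
    by (auto simp: fun_eq_iff)
  then show ?thesis by (simp add: all_v_def sat_subst)
qed

lemma sat_replace: "sat e (replace \<phi> x t) \<longleftrightarrow> sat (e(x := tval e t)) \<phi>"
proof -
  have "(\<lambda>y. tval e ((Var(x := t)) y)) = e(x := tval e t)" by (auto simp: fun_eq_iff)
  then show ?thesis by (simp add: replace_def sat_subst)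
qed

lemma tval_cong: "(\<And>x. x \<in> tvars t \<Longrightarrow> e x = e' x) \<Longrightarrow> tval e t = tval e' t"
  by (induction t) auto

lemma tval_upd_notin [simp]: "x \<notin> tvars t \<Longrightarrow> tval (e(x := a)) t = tval e t"
  by (rule tval_cong) auto

lemma tval_newv [simp]: "t \<in> set ts \<Longrightarrow> tval (e(newv k \<rho> ts := a)) t = tval e t"
  by (simp add: newv_notin)

end

text \<open>Equality at higher sorts is pointwise in the language. The assumption
  \<open>extensional\<close> makes it identity of elements, so that it can be used for rewriting in
  HOL.\<close>

locale extensional_model = type_structure +
  fixes T :: "fm set"
  assumes ap_in: "f \<in> D (\<rho> \<rightarrow>\<^sub>t \<tau>) \<Longrightarrow> a \<in> D \<rho> \<Longrightarrow> f \<bullet> a \<in> D \<tau>"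
    and zero_in [simp]: "zero \<in> D N"
    and suc_in [simp]: "suc \<in> D T1"
    and rc_in [simp]: "rc \<in> D (N \<rightarrow>\<^sub>t N \<rightarrow>\<^sub>t (N \<rightarrow>\<^sub>t N \<rightarrow>\<^sub>t N) \<rightarrow>\<^sub>t N)"
    and kk_in [simp]: "kk \<rho> \<tau> \<in> D (\<rho> \<rightarrow>\<^sub>t \<tau> \<rightarrow>\<^sub>t \<rho>)"
    and ss_in [simp]: "ss \<delta> \<rho> \<tau> \<in> D ((\<delta> \<rightarrow>\<^sub>t \<rho> \<rightarrow>\<^sub>t \<tau>) \<rightarrow>\<^sub>t (\<delta> \<rightarrow>\<^sub>t \<rho>) \<rightarrow>\<^sub>t \<delta> \<rightarrow>\<^sub>t \<tau>)"
    and extensional: "f \<in> D (\<rho> \<rightarrow>\<^sub>t \<tau>) \<Longrightarrow> g \<in> D (\<rho> \<rightarrow>\<^sub>t \<tau>) \<Longrightarrow> (\<And>a. a \<in> D \<rho> \<Longrightarrow> f \<bullet> a = g \<bullet> a) \<Longrightarrow> f = g"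
    and axioms: "\<phi> \<in> T \<Longrightarrow> wff \<phi> \<Longrightarrow> valid e \<Longrightarrow> sat e \<phi>"


section \<open>The term model of a Henkin set\<close>

locale henkin_model =
  fixes T H :: "fm set"
  assumes henkin: "henkin_set T H" and base: "E_PRA_omega \<subseteq> T"
begin

definition trm :: "ty \<Rightarrow> tm set" where
  "trm \<rho> = {t. wt t \<and> ty_of t = \<rho>}"

lemma trmD: "t \<in> trm \<rho> \<Longrightarrow> wt t" "t \<in> trm \<rho> \<Longrightarrow> ty_of t = \<rho>"
  by (auto simp: trm_def)

lemma trm_ap: "s \<in> trm (\<rho> \<rightarrow>\<^sub>t \<tau>) \<Longrightarrow> t \<in> trm \<rho> \<Longrightarrow> s \<cdot> t \<in> trm \<tau>"
  by (auto simp: trm_def)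

lemma H_closed: "set \<Gamma> \<subseteq> H \<Longrightarrow> derives T \<Gamma> \<phi> \<Longrightarrow> \<phi> \<in> H"
  using henkin unfolding henkin_set_def by blast

lemma Bot_notin_H: "\<^bold>\<bottom> \<notin> H"
  using henkin unfolding henkin_set_def by blast

lemma H_axiom: "\<phi> \<in> T \<Longrightarrow> wff \<phi> \<Longrightarrow> wt_subst \<theta> \<Longrightarrow> subst \<theta> \<phi> \<in> H"
  using derives_subst[of T "[]"] by (intro H_closed[of "[]"]) (auto simp: derives.axm)

lemma H_base: "\<phi> \<in> E_PRA_omega \<Longrightarrow> wff \<phi> \<Longrightarrow> wt_subst \<theta> \<Longrightarrow> subst \<theta> \<phi> \<in> H"
  using H_axiom base by blast

lemma H_Imp:
  assumes "wff \<phi>" "wff \<psi>"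
  shows "(\<phi> \<^bold>\<longrightarrow> \<psi>) \<in> H \<longleftrightarrow> (\<phi> \<in> H \<longrightarrow> \<psi> \<in> H)"
proof
  assume "(\<phi> \<^bold>\<longrightarrow> \<psi>) \<in> H"
  moreover have "derives T [\<phi> \<^bold>\<longrightarrow> \<psi>, \<phi>] \<psi>"
    by (rule derives.impE[of _ _ \<phi>]) (simp_all add: derives.asm assms)
  ultimately show "\<phi> \<in> H \<longrightarrow> \<psi> \<in> H" using H_closed[of "[\<phi> \<^bold>\<longrightarrow> \<psi>, \<phi>]" \<psi>] by simp
next
  assume imp: "\<phi> \<in> H \<longrightarrow> \<psi> \<in> H"
  show "(\<phi> \<^bold>\<longrightarrow> \<psi>) \<in> H"
  proof (cases "\<psi> \<in> H")
    case True
    moreover have "derives T [\<psi>] (\<phi> \<^bold>\<longrightarrow> \<psi>)"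
      by (rule derives.impI) (simp_all add: derives.asm assms)
    ultimately show ?thesis by (intro H_closed[of "[\<psi>]"]) simp_all
  next
    case False
    then have "(\<^bold>\<not> \<phi>) \<in> H" using imp henkin assms unfolding henkin_set_def by blast
    moreover have "derives T [\<^bold>\<not> \<psi>, \<phi>, \<^bold>\<not> \<phi>] \<^bold>\<bottom>"
      by (rule derives.impE[of _ _ \<phi>]) (simp_all add: derives.asm assms)
    then have "derives T [\<^bold>\<not> \<phi>] (\<phi> \<^bold>\<longrightarrow> \<psi>)"
      by (intro derives.impI derives.raa[of \<psi>] assms)
    ultimately show ?thesis by (intro H_closed[of "[\<^bold>\<not> \<phi>]"]) simp_all
  qed
qed

lemma H_Forall:
  assumes "wff \<phi>"
  shows "Forall \<rho> \<phi> \<in> H \<longleftrightarrow> (\<forall>t\<in>trm \<rho>. inst \<rho> t \<phi> \<in> H)"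
proof (intro iffI ballI)
  fix t assume "Forall \<rho> \<phi> \<in> H" "t \<in> trm \<rho>"
  moreover have "derives T [Forall \<rho> \<phi>] (Forall \<rho> \<phi>)"
    by (rule derives.asm) (use assms in auto)
  ultimately show "inst \<rho> t \<phi> \<in> H"
    by (intro H_closed[of "[Forall \<rho> \<phi>]"] derives.allE[of T _ \<rho>]) (auto simp: trm_def)
qed (use henkin assms in \<open>auto simp: henkin_set_def trm_def\<close>)

lemma H_subst_Forall:
  assumes "wff \<phi>" "wt_subst \<theta>"
  shows "subst \<theta> (Forall \<rho> \<phi>) \<in> H \<longleftrightarrow> (\<forall>t\<in>trm \<rho>. subst (vcons \<rho> t \<theta>) \<phi> \<in> H)"
  using assms by (simp add: H_Forall inst_subst)

lemma H_all_v:
  assumes "wff \<phi>" "wt_subst \<theta>"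
  shows "subst \<theta> (\<^bold>\<forall>x. \<phi>) \<in> H \<longleftrightarrow> (\<forall>t\<in>trm (snd x). subst (\<theta>(x := t)) \<phi> \<in> H)"
proof -
  have "(\<lambda>y. tsubst (vcons (snd x) t \<theta>) (((Var \<circ> shift (snd x))(x := Var (0, snd x))) y)) = \<theta>(x := t)" for t
    by (auto simp: fun_eq_iff)
  moreover have "wff (subst ((Var \<circ> shift (snd x))(x := Var (0, snd x))) \<phi>)"
    using assms(1) by (intro wff_subst wt_subst_upd) simp_all
  ultimately show ?thesis
    unfolding all_v_def using assms(2) by (simp only: H_subst_Forall subst_subst)
qed

text \<open>The meaning of \<open>eq_at\<close> for \<open>H\<close>: by the Henkin property its
  quantifiers range over the well-typed terms.\<close>

primrec eqv :: "ty \<Rightarrow> tm \<Rightarrow> tm \<Rightarrow> bool" where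
  "eqv N s t = ((s \<^bold>= t) \<in> H)"
| "eqv (\<rho> \<rightarrow>\<^sub>t \<tau>) s t = (\<forall>u\<in>trm \<rho>. eqv \<tau> (s \<cdot> u) (t \<cdot> u))"

lemma wff_eq_at: "s \<in> trm \<rho> \<Longrightarrow> t \<in> trm \<rho> \<Longrightarrow> wff (eq_at \<rho> s t)"
proof (induction \<rho> arbitrary: s t)
  case (Fn \<rho> \<tau>)
  then show ?case by (auto simp: Let_def trm_def intro!: wff_all_v Fn.IH)
qed (simp add: trm_def)

lemma H_eq_at:
  "wt_subst \<theta> \<Longrightarrow> s \<in> trm \<rho> \<Longrightarrow> t \<in> trm \<rho> \<Longrightarrow>
   subst \<theta> (eq_at \<rho> s t) \<in> H \<longleftrightarrow> eqv \<rho> (tsubst \<theta> s) (tsubst \<theta> t)"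
proof (induction \<rho> arbitrary: \<theta> s t)
  case (Fn \<rho> \<tau>)
  let ?z = "newv 0 \<rho> [s, t]"
  have z: "s \<cdot> Var ?z \<in> trm \<tau>" "t \<cdot> Var ?z \<in> trm \<tau>"
    using Fn.prems by (auto simp: trm_def)
  have e: "tsubst (\<theta>(?z := u)) s = tsubst \<theta> s" "tsubst (\<theta>(?z := u)) t = tsubst \<theta> t" for u
    using newv_notin[of s "[s, t]" 0 \<rho>] newv_notin[of t "[s, t]" 0 \<rho>]
    by (auto intro!: tsubst_cong)
  have "subst (\<theta>(?z := u)) (eq_at \<tau> (s \<cdot> Var ?z) (t \<cdot> Var ?z)) \<in> H \<longleftrightarrow>
      eqv \<tau> (tsubst \<theta> s \<cdot> u) (tsubst \<theta> t \<cdot> u)" if "u \<in> trm \<rho>" for u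
  proof -
    have "wt_subst (\<theta>(?z := u))" using Fn.prems that by (simp add: trm_def)
    from Fn.IH(2)[OF this z] show ?thesis by (simp only: tsubst.simps e fun_upd_same)
  qed
  then show ?case
    using Fn.prems(1) z by (simp add: Let_def H_all_v wff_eq_at)
qed simp

lemma eqv_refl: "s \<in> trm \<rho> \<Longrightarrow> eqv \<rho> s s"
proof (induction \<rho> arbitrary: s)
  case N
  have "subst (Var((0, N) := s)) (Var (0, N) \<^bold>= Var (0, N)) \<in> H"
    using N by (intro H_base E_PRA_omega.eq_refl wt_subst_upd) (simp_all add: trm_def)
  then show ?case by simp
qed (simp add: trm_ap)

lemma eqv_sym: "s \<in> trm \<rho> \<Longrightarrow> t \<in> trm \<rho> \<Longrightarrow> eqv \<rho> s t \<Longrightarrow> eqv \<rho> t s"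
proof (induction \<rho> arbitrary: s t)
  case N
  have "subst (Var((0, N) := s, (1, N) := t)) (Var (0, N) \<^bold>= Var (1, N) \<^bold>\<longrightarrow> Var (1, N) \<^bold>= Var (0, N)) \<in> H"
    using N by (intro H_base E_PRA_omega.eq_sym wt_subst_upd) (simp_all add: trm_def)
  then show ?case using N by (simp add: H_Imp trm_def)
qed (simp add: trm_ap)

lemma eqv_trans:
  "s \<in> trm \<rho> \<Longrightarrow> t \<in> trm \<rho> \<Longrightarrow> u \<in> trm \<rho> \<Longrightarrow> eqv \<rho> s t \<Longrightarrow> eqv \<rho> t u \<Longrightarrow> eqv \<rho> s u"
proof (induction \<rho> arbitrary: s t u)
  case N
  have "subst (Var((0, N) := s, (1, N) := t, (2, N) := u))
     (Var (0, N) \<^bold>= Var (1, N) \<^bold>\<longrightarrow> Var (1, N) \<^bold>= Var (2, N) \<^bold>\<longrightarrow> Var (0, N) \<^bold>= Var (2, N)) \<in> H"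
    using N by (intro H_base E_PRA_omega.eq_trans wt_subst_upd) (simp_all add: trm_def)
  then show ?case using N by (simp add: H_Imp trm_def)
next
  case (Fn \<rho> \<tau>)
  show ?case unfolding eqv.simps
  proof
    fix v assume "v \<in> trm \<rho>"
    then show "eqv \<tau> (s \<cdot> v) (u \<cdot> v)"
      using Fn.prems by (intro Fn.IH(2)[of "s \<cdot> v" "t \<cdot> v" "u \<cdot> v"]) (auto intro: trm_ap)
  qed
qed

text \<open>The extensionality axiom changes the argument, the pointwise definition of
  \<open>eqv\<close> then changes the function.\<close>

lemma eqv_ap:
  assumes "f \<in> trm (\<rho> \<rightarrow>\<^sub>t \<tau>)" "g \<in> trm (\<rho> \<rightarrow>\<^sub>t \<tau>)" "u \<in> trm \<rho>" "v \<in> trm \<rho>"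
    and "eqv (\<rho> \<rightarrow>\<^sub>t \<tau>) f g" "eqv \<rho> u v"
  shows "eqv \<tau> (f \<cdot> u) (g \<cdot> v)"
proof -
  let ?\<theta> = "Var((0, \<rho>) := u, (1, \<rho>) := v, (2, \<rho> \<rightarrow>\<^sub>t \<tau>) := f)"
  let ?l = "eq_at \<rho> (Var (0, \<rho>)) (Var (1, \<rho>))"
  let ?r = "eq_at \<tau> (Var (2, \<rho> \<rightarrow>\<^sub>t \<tau>) \<cdot> Var (0, \<rho>)) (Var (2, \<rho> \<rightarrow>\<^sub>t \<tau>) \<cdot> Var (1, \<rho>))"
  have w: "wff ?l" "wff ?r" by (auto intro!: wff_eq_at simp: trm_def)
  have \<theta>: "wt_subst ?\<theta>" using assms by (simp add: trm_def)
  have "subst ?\<theta> (?l \<^bold>\<longrightarrow> ?r) \<in> H"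
    using \<theta> w by (intro H_base E_PRA_omega.extensionality) simp_all
  then have "subst ?\<theta> ?l \<in> H \<longrightarrow> subst ?\<theta> ?r \<in> H" using \<theta> w by (simp add: H_Imp del: fun_upd_apply)
  then have "eqv \<tau> (f \<cdot> u) (f \<cdot> v)"
    using \<theta> assms(6) by (simp add: H_eq_at trm_def)
  moreover have "eqv \<tau> (f \<cdot> v) (g \<cdot> v)" using assms by simp
  ultimately show ?thesis
    using assms by (intro eqv_trans[of "f \<cdot> u" \<tau> "f \<cdot> v" "g \<cdot> v"]) (auto intro: trm_ap)
qed

section \<open>The quotient by provable equality, on chosen representatives\<close>

definition nf :: "tm \<Rightarrow> tm" where
  "nf t = (SOME s. s \<in> trm (ty_of t) \<and> eqv (ty_of t) t s)"

lemma nf: assumes "t \<in> trm \<rho>" shows "nf t \<in> trm \<rho>" "eqv \<rho> t (nf t)"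
proof -
  have "\<exists>s. s \<in> trm (ty_of t) \<and> eqv (ty_of t) t s"
    using assms eqv_refl trmD by blast
  from someI_ex[OF this] assms show "nf t \<in> trm \<rho>" "eqv \<rho> t (nf t)"
    unfolding nf_def using trmD(2) by auto
qed

text \<open>Equivalent terms satisfy the same choice predicate, so the same representative is
  chosen. Representatives stand in for a quotient type, which could not depend on
  \<open>H\<close>.\<close>

lemma nf_eq_iff:
  assumes "s \<in> trm \<rho>" "t \<in> trm \<rho>"
  shows "nf s = nf t \<longleftrightarrow> eqv \<rho> s t"
proof
  assume "nf s = nf t"
  then show "eqv \<rho> s t" using nf assms eqv_trans eqv_sym by metis
next
  assume "eqv \<rho> s t"
  then have "s' \<in> trm \<rho> \<Longrightarrow> eqv \<rho> s s' \<longleftrightarrow> eqv \<rho> t s'" for s'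
    using assms eqv_trans eqv_sym by metis
  then show "nf s = nf t" unfolding nf_def using assms by (simp add: trm_def cong: conj_cong)
qed

definition ntrm :: "ty \<Rightarrow> tm set" where
  "ntrm \<rho> = nf ` trm \<rho>"

definition nap :: "tm \<Rightarrow> tm \<Rightarrow> tm" where
  "nap s t = nf (s \<cdot> t)"

lemma ntrm_trm: "t \<in> ntrm \<rho> \<Longrightarrow> t \<in> trm \<rho>"
  by (auto simp: ntrm_def nf)

lemma nf_nf: "t \<in> ntrm \<rho> \<Longrightarrow> nf t = t"
  using nf nf_eq_iff eqv_sym unfolding ntrm_def by (metis imageE)

lemma nf_in: "t \<in> trm \<rho> \<Longrightarrow> nf t \<in> ntrm \<rho>"
  by (simp add: ntrm_def)

lemma nap_nf: "s \<in> trm (\<rho> \<rightarrow>\<^sub>t \<tau>) \<Longrightarrow> t \<in> trm \<rho> \<Longrightarrow> nap (nf s) (nf t) = nf (s \<cdot> t)"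
  unfolding nap_def by (subst nf_eq_iff[of _ \<tau>]) (auto intro: trm_ap nf eqv_ap eqv_sym)

sublocale type_structure ntrm nap "nf Zero" "nf Succ" "nf Rc" "\<lambda>\<rho> \<tau>. nf (Kc \<rho> \<tau>)"
  "\<lambda>\<delta> \<rho> \<tau>. nf (Sc \<delta> \<rho> \<tau>)" .

lemma tval_nf: "wt_subst \<theta> \<Longrightarrow> wt t \<Longrightarrow> tval (\<lambda>x. nf (\<theta> x)) t = nf (tsubst \<theta> t)"
proof (induction t)
  case (App s t)
  then have "tsubst \<theta> s \<in> trm (ty_of t \<rightarrow>\<^sub>t cod (ty_of s))" "tsubst \<theta> t \<in> trm (ty_of t)"
    by (auto simp: trm_def)
  from nap_nf[OF this] show ?case using App by simp
qed auto

text \<open>The truth lemma. At a quantifier, the elements of the model are normal forms of terms,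
  and \<open>H\<close> contains a universal formula as soon as it contains all instances at
  terms.\<close>

lemma sat_iff_H: "wt_subst \<theta> \<Longrightarrow> wff \<phi> \<Longrightarrow> sat (\<lambda>x. nf (\<theta> x)) \<phi> \<longleftrightarrow> subst \<theta> \<phi> \<in> H"
proof (induction \<phi> arbitrary: \<theta>)
  case Bot
  show ?case by (simp add: Bot_notin_H)
next
  case (Eq s t)
  then have "tsubst \<theta> s \<in> trm N" "tsubst \<theta> t \<in> trm N"
    by (auto simp: trm_def)
  then show ?case using Eq by (simp add: tval_nf nf_eq_iff[of _ N])
next
  case (Imp \<phi> \<psi>)
  then show ?case by (simp add: H_Imp)
next
  case (Forall \<rho> \<phi>)
  have "vcons \<rho> (nf t) (\<lambda>x. nf (\<theta> x)) = (\<lambda>x. nf (vcons \<rho> t \<theta> x))" for t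
    by (rule vcons_eqI) simp_all
  moreover have "wt_subst (vcons \<rho> t \<theta>)" if "t \<in> trm \<rho>" for t
    using that Forall.prems by (simp add: trm_def)
  moreover have "sat e (Forall \<rho> \<phi>) \<longleftrightarrow> (\<forall>t\<in>trm \<rho>. sat (vcons \<rho> (nf t) e) \<phi>)" for e
    by (simp add: ntrm_def[of \<rho>])
  ultimately show ?case
    using Forall by (simp add: H_subst_Forall del: subst_Forall sat.simps)
qed

text \<open>Elements of the model are terms, so a valuation is itself a substitution. With
  \<open>sat_iff_H\<close>, the validity of an axiom becomes membership of its substitution
  instances in \<open>H\<close>.\<close>

lemma valid_nf: "valid e \<Longrightarrow> wt_subst e" "valid e \<Longrightarrow> (\<lambda>x. nf (e x)) = e"
  unfolding valid_def wt_subst_def by (blast dest: ntrm_trm trmD, use nf_nf in blast)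

sublocale extensional_model ntrm nap "nf Zero" "nf Succ" "nf Rc" "\<lambda>\<rho> \<tau>. nf (Kc \<rho> \<tau>)"
  "\<lambda>\<delta> \<rho> \<tau>. nf (Sc \<delta> \<rho> \<tau>)" T
proof
  fix f g \<rho> \<tau> a
  assume "f \<in> ntrm (\<rho> \<rightarrow>\<^sub>t \<tau>)" "a \<in> ntrm \<rho>"
  then show "nap f a \<in> ntrm \<tau>" unfolding nap_def by (intro nf_in trm_ap ntrm_trm)
next
  fix f g \<rho> \<tau>
  assume f: "f \<in> ntrm (\<rho> \<rightarrow>\<^sub>t \<tau>)" and g: "g \<in> ntrm (\<rho> \<rightarrow>\<^sub>t \<tau>)"
    and eq: "\<And>a. a \<in> ntrm \<rho> \<Longrightarrow> nap f a = nap g a"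
  have "eqv \<tau> (f \<cdot> a) (g \<cdot> a)" if a: "a \<in> trm \<rho>" for a
  proof -
    have "nf (f \<cdot> a) = nf (g \<cdot> a)"
      using eq[OF nf_in[OF a]] a f g nap_nf[of f \<rho> \<tau> a] nap_nf[of g \<rho> \<tau> a]
      by (simp add: nf_nf ntrm_trm)
    then show ?thesis using nf_eq_iff[of _ \<tau>] trm_ap ntrm_trm a f g by metis
  qed
  then have "nf f = nf g" using f g nf_eq_iff[of f "\<rho> \<rightarrow>\<^sub>t \<tau>" g] ntrm_trm by simp
  then show "f = g" using f g nf_nf by metis
next
  fix \<phi> e
  assume "\<phi> \<in> T" "wff \<phi>" "valid e"
  then show "sat e \<phi>" using sat_iff_H[of e \<phi>] valid_nf[of e] H_axiom by simp
qed (auto intro!: nf_in simp: trm_def)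

end


section \<open>Bracket abstraction\<close>

lemma tvars_lam [simp]: "tvars (\<^bold>\<lambda>x. t) = tvars t - {x}"
  by (induction t) auto

lemma ty_of_lam [simp]: "ty_of (\<^bold>\<lambda>x. t) = snd x \<rightarrow>\<^sub>t ty_of t"
  by (induction t) auto

lemma wt_lam [simp]: "wt t \<Longrightarrow> wt (\<^bold>\<lambda>x. t)"
  by (induction t) auto

declare lam.simps [simp del]


section \<open>Well-typed terms of the language\<close>

lemma closed_plus: "tvars plus_tm = {}" "wt plus_tm" "ty_of plus_tm = N \<rightarrow>\<^sub>t N \<rightarrow>\<^sub>t N"
  by (auto simp: plus_tm_def)

lemma closed_pred [simp]: "tvars pred_tm = {}" "wt pred_tm" "ty_of pred_tm = N \<rightarrow>\<^sub>t N"
  by (auto simp: pred_tm_def)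

lemma closed_monus: "tvars monus_tm = {}" "wt monus_tm" "ty_of monus_tm = N \<rightarrow>\<^sub>t N \<rightarrow>\<^sub>t N"
  by (auto simp: monus_tm_def)

lemma add_tm [simp]:
  "tvars (s \<^bold>+ t) = tvars s \<union> tvars t"
  "wt (s \<^bold>+ t) \<longleftrightarrow> wt s \<and> wt t \<and> ty_of s = N \<and> ty_of t = N" "ty_of (s \<^bold>+ t) = N"
  by (auto simp: add_def closed_plus)

lemma monus_tm [simp]:
  "tvars (s \<^bold>- t) = tvars s \<union> tvars t"
  "wt (s \<^bold>- t) \<longleftrightarrow> wt s \<and> wt t \<and> ty_of s = N \<and> ty_of t = N" "ty_of (s \<^bold>- t) = N"
  by (auto simp: monus_def closed_monus)

lemma closed_times: "tvars times_tm = {}" "wt times_tm" "ty_of times_tm = N \<rightarrow>\<^sub>t N \<rightarrow>\<^sub>t N"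
  by (auto simp: times_tm_def)

lemma mult_tm [simp]:
  "tvars (s \<^bold>* t) = tvars s \<union> tvars t"
  "wt (s \<^bold>* t) \<longleftrightarrow> wt s \<and> wt t \<and> ty_of s = N \<and> ty_of t = N" "ty_of (s \<^bold>* t) = N"
  by (auto simp: mult_def closed_times)

lemma closed_pow2 [simp]: "tvars pow2_tm = {}" "wt pow2_tm" "ty_of pow2_tm = N \<rightarrow>\<^sub>t N"
  by (auto simp: pow2_tm_def)

lemma leq_fm [simp]: "qf (s \<^bold>\<le> t)" "wff (s \<^bold>\<le> t) \<longleftrightarrow> wt s \<and> wt t \<and> ty_of s = N \<and> ty_of t = N"
  by (auto simp: leq_def)

lemma lt_fm [simp]: "qf (s \<^bold>< t)" "wff (s \<^bold>< t) \<longleftrightarrow> wt s \<and> wt t \<and> ty_of s = N \<and> ty_of t = N"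
  by (auto simp: lt_def)

lemma closed_tri [simp]: "tvars tri_tm = {}" "wt tri_tm" "ty_of tri_tm = T1"
  by (auto simp: tri_tm_def)

lemma closed_root [simp]: "tvars root_tm = {}" "wt root_tm" "ty_of root_tm = T1"
  by (auto simp: root_tm_def)

lemma closed_second [simp]: "tvars second_tm = {}" "wt second_tm" "ty_of second_tm = T1"
  by (auto simp: second_tm_def)

lemma closed_first [simp]: "tvars first_tm = {}" "wt first_tm" "ty_of first_tm = T1"
  by (auto simp: first_tm_def)

lemma closed_pair: "tvars pair_tm = {}" "wt pair_tm" "ty_of pair_tm = N \<rightarrow>\<^sub>t N \<rightarrow>\<^sub>t N"
  by (auto simp: pair_tm_def)

lemma pair_wt [simp]:
  "tvars (pair s t) = tvars s \<union> tvars t"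
  "wt (pair s t) \<longleftrightarrow> wt s \<and> wt t \<and> ty_of s = N \<and> ty_of t = N" "ty_of (pair s t) = N"
  by (auto simp: pair_def closed_pair)

lemma mk_rat_wt [simp]:
  "tvars (mk_rat s t u) = tvars s \<union> tvars t \<union> tvars u"
  "wt (mk_rat s t u) \<longleftrightarrow> wt s \<and> wt t \<and> wt u \<and> ty_of s = N \<and> ty_of t = N \<and> ty_of u = N"
  "ty_of (mk_rat s t u) = N"
  by (auto simp: mk_rat_def)

lemma pos_neg_den_wt [simp]:
  "tvars (pos q) = tvars q" "tvars (neg q) = tvars q" "tvars (den q) = tvars q"
  "wt (pos q) \<longleftrightarrow> wt q \<and> ty_of q = N" "wt (neg q) \<longleftrightarrow> wt q \<and> ty_of q = N"
  "wt (den q) \<longleftrightarrow> wt q \<and> ty_of q = N"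
  "ty_of (pos q) = N" "ty_of (neg q) = N" "ty_of (den q) = N"
  by (auto simp: pos_def neg_def den_def)

lemma closed_ratadd: "tvars ratadd_tm = {}" "wt ratadd_tm" "ty_of ratadd_tm = N \<rightarrow>\<^sub>t N \<rightarrow>\<^sub>t N"
  by (auto simp: ratadd_tm_def)

lemma closed_ratminus [simp]: "tvars ratminus_tm = {}" "wt ratminus_tm" "ty_of ratminus_tm = T1"
  by (auto simp: ratminus_tm_def)

lemma closed_ratabs [simp]: "tvars ratabs_tm = {}" "wt ratabs_tm" "ty_of ratabs_tm = T1"
  by (auto simp: ratabs_tm_def)

lemma ratadd_wt [simp]:
  "tvars (ratadd s t) = tvars s \<union> tvars t"
  "wt (ratadd s t) \<longleftrightarrow> wt s \<and> wt t \<and> ty_of s = N \<and> ty_of t = N" "ty_of (ratadd s t) = N"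
  by (auto simp: ratadd_def closed_ratadd)

lemma ratdist_wt [simp]:
  "tvars (ratdist s t) = tvars s \<union> tvars t"
  "wt (ratdist s t) \<longleftrightarrow> wt s \<and> wt t \<and> ty_of s = N \<and> ty_of t = N" "ty_of (ratdist s t) = N"
  by (auto simp: ratdist_def)

lemma rat_fm [simp]:
  "qf (s \<^bold>\<le>\<^sub>Q t)" "wff (s \<^bold>\<le>\<^sub>Q t) \<longleftrightarrow> wt s \<and> wt t \<and> ty_of s = N \<and> ty_of t = N"
  "wff (s \<^bold><\<^sub>Q t) \<longleftrightarrow> wt s \<and> wt t \<and> ty_of s = N \<and> ty_of t = N"
  by (auto simp: ratle_def ratless_def)

lemma eps_wt [simp]:
  "tvars (eps t) = tvars t" "wt (eps t) \<longleftrightarrow> wt t \<and> ty_of t = N" "ty_of (eps t) = N"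
  "tvars (eps2 t) = tvars t" "wt (eps2 t) \<longleftrightarrow> wt t \<and> ty_of t = N" "ty_of (eps2 t) = N"
  by (auto simp: eps_def eps2_def)

lemma real_of_rat_wt [simp]:
  "wt (real_of_rat q) \<longleftrightarrow> wt q \<and> ty_of q = N" "ty_of (real_of_rat q) = T1"
  by (auto simp: real_of_rat_def)

lemma realdist_wt [simp]:
  "wt x \<Longrightarrow> ty_of x = T1 \<Longrightarrow> wt y \<Longrightarrow> ty_of y = T1 \<Longrightarrow> wt (realdist x y)"
  "ty_of (realdist x y) = T1"
  by (auto simp: realdist_def Let_def)

lemma partial_sum_wt [simp]:
  "wt s \<Longrightarrow> ty_of s = N \<rightarrow>\<^sub>t T1 \<Longrightarrow> wt m \<Longrightarrow> ty_of m = N \<Longrightarrow> wt (partial_sum s m)"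
  "ty_of m = N \<Longrightarrow> ty_of (partial_sum s m) = T1"
  by (auto simp: partial_sum_def Let_def)

lemma real_fm [simp]:
  assumes "wt x" "ty_of x = T1"
  shows "wff (is_real x)" "wt y \<Longrightarrow> ty_of y = T1 \<Longrightarrow> wff (x \<^bold>=\<^sub>R y)"
    "wt y \<Longrightarrow> ty_of y = T1 \<Longrightarrow> wff (x \<^bold>\<le>\<^sub>R y)" "wt y \<Longrightarrow> ty_of y = T1 \<Longrightarrow> wff (x \<^bold><\<^sub>R y)"
  using assms by (simp_all add: is_real_def realeq_def realle_def realless_def Let_def)

lemma wff_countable_sets_weak_measure_zero: "wff countable_sets_weak_measure_zero"
  by (simp add: countable_sets_weak_measure_zero_def is_set_def subset_unit_def countable_set_def
      unit_fun_def inj_on_set_def weak_measure_zero_def nonneg_reals_def is_set2_def fun2_def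
      inj_on_set2_def covers_def lengths_bounded_def series_le_def series_sums_def mem_def mem2_def
      in_unit_def Let_def)

lemma wff_Exists2: "wff Exists2"
  by (simp add: Exists2_def Let_def)

section \<open>Models of the base theory\<close>

locale pra_model = extensional_model +
  assumes base: "E_PRA_omega \<subseteq> T"
begin

text \<open>Constant functions with value zero inhabit every sort. Valuations are total, and
  \<open>dflt\<close> takes care of the variables that do not matter.\<close>

primrec dflt_ty :: "ty \<Rightarrow> 'a" where
  "dflt_ty N = zero"
| "dflt_ty (\<rho> \<rightarrow>\<^sub>t \<tau>) = kk \<tau> \<rho> \<bullet> dflt_ty \<tau>"

definition dflt :: "var \<Rightarrow> 'a" where
  "dflt x = dflt_ty (snd x)"

lemma valid_dflt [simp]: "valid dflt"
proof -
  have "dflt_ty \<rho> \<in> D \<rho>" for \<rho>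
    by (induction \<rho>) (auto intro: ap_in[OF kk_in])
  then show ?thesis by (simp add: valid_def dflt_def)
qed

lemma validD [simp]: "valid e \<Longrightarrow> snd x = \<rho> \<Longrightarrow> e x \<in> D \<rho>"
  by (auto simp: valid_def)

lemma tval_in: "valid e \<Longrightarrow> wt t \<Longrightarrow> tval e t \<in> D (ty_of t)"
proof (induction t)
  case (App s t)
  then show ?case using ap_in[of "tval e s" "ty_of t" "cod (ty_of s)" "tval e t"] by simp
qed (simp_all)

lemma tval_in' [simp]: "valid e \<Longrightarrow> wt t \<Longrightarrow> ty_of t = \<rho> \<Longrightarrow> tval e t \<in> D \<rho>"
  using tval_in by blast

lemma sat_eq_at:
  "valid e \<Longrightarrow> wt s \<Longrightarrow> wt t \<Longrightarrow> ty_of s = \<rho> \<Longrightarrow> ty_of t = \<rho> \<Longrightarrow>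
   sat e (eq_at \<rho> s t) \<longleftrightarrow> tval e s = tval e t"
proof (induction \<rho> arbitrary: e s t)
  case (Fn \<rho> \<tau>)
  let ?z = "newv 0 \<rho> [s, t]"
  have "sat (e(?z := a)) (eq_at \<tau> (s \<cdot> Var ?z) (t \<cdot> Var ?z)) \<longleftrightarrow> tval e s \<bullet> a = tval e t \<bullet> a"
    if "a \<in> D \<rho>" for a
  proof -
    have "valid (e(?z := a))" using Fn.prems that by simp
    from Fn.IH(2)[OF this, of "s \<cdot> Var ?z" "t \<cdot> Var ?z"] Fn.prems show ?thesis
      by (simp del: fun_upd_apply add: fun_upd_same)
  qed
  then have "sat e (eq_at (\<rho> \<rightarrow>\<^sub>t \<tau>) s t) \<longleftrightarrow> (\<forall>a\<in>D \<rho>. tval e s \<bullet> a = tval e t \<bullet> a)"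
    by (simp add: Let_def)
  also have "\<dots> \<longleftrightarrow> tval e s = tval e t"
    using extensional[of "tval e s" \<rho> \<tau> "tval e t"] Fn.prems by auto
  finally show ?case .
qed simp

lemma base_axiom: "\<phi> \<in> E_PRA_omega \<Longrightarrow> wff \<phi> \<Longrightarrow> valid e \<Longrightarrow> sat e \<phi>"
  using axioms base by blast

lemma wff_eq_at: "wt s \<Longrightarrow> wt t \<Longrightarrow> ty_of s = \<rho> \<Longrightarrow> ty_of t = \<rho> \<Longrightarrow> wff (eq_at \<rho> s t)"
proof (induction \<rho> arbitrary: s t)
  case (Fn \<rho> \<tau>)
  then show ?case by (auto simp: Let_def intro!: wff_all_v Fn.IH)
qed simp

lemma kk_eq [simp]:
  assumes "a \<in> D \<rho>" "b \<in> D \<tau>"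
  shows "kk \<rho> \<tau> \<bullet> a \<bullet> b = a"
  using base_axiom[OF E_PRA_omega.Kc_eq[of \<rho> \<tau>], of "dflt((0, \<rho>) := a, (1, \<tau>) := b)"] assms
  by (simp add: sat_eq_at wff_eq_at)

lemma ss_eq [simp]:
  assumes "a \<in> D (\<delta> \<rightarrow>\<^sub>t \<rho> \<rightarrow>\<^sub>t \<tau>)" "b \<in> D (\<delta> \<rightarrow>\<^sub>t \<rho>)" "c \<in> D \<delta>"
  shows "ss \<delta> \<rho> \<tau> \<bullet> a \<bullet> b \<bullet> c = a \<bullet> c \<bullet> (b \<bullet> c)"
  using base_axiom[OF E_PRA_omega.Sc_eq[OF refl refl refl, of \<tau> \<delta> \<rho>],
      of "dflt((0, \<delta> \<rightarrow>\<^sub>t \<rho> \<rightarrow>\<^sub>t \<tau>) := a, (1, \<delta> \<rightarrow>\<^sub>t \<rho>) := b, (2, \<delta>) := c)"] assms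
  by (simp add: sat_eq_at wff_eq_at)

lemma rc_zero [simp]:
  assumes "a \<in> D N" "f \<in> D (N \<rightarrow>\<^sub>t N \<rightarrow>\<^sub>t N)"
  shows "rc \<bullet> zero \<bullet> a \<bullet> f = a"
  using base_axiom[OF E_PRA_omega.Rc_zero[OF refl refl],
      of "dflt((1, N) := a, (2, N \<rightarrow>\<^sub>t N \<rightarrow>\<^sub>t N) := f)"] assms by simp

lemma rc_suc [simp]:
  assumes "n \<in> D N" "a \<in> D N" "f \<in> D (N \<rightarrow>\<^sub>t N \<rightarrow>\<^sub>t N)"
  shows "rc \<bullet> (suc \<bullet> n) \<bullet> a \<bullet> f = f \<bullet> (rc \<bullet> n \<bullet> a \<bullet> f) \<bullet> n"
  using base_axiom[OF E_PRA_omega.Rc_succ[OF refl refl refl],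
      of "dflt((0, N) := n, (1, N) := a, (2, N \<rightarrow>\<^sub>t N \<rightarrow>\<^sub>t N) := f)"] assms by simp

lemma suc_nonzero [simp]: "n \<in> D N \<Longrightarrow> suc \<bullet> n \<noteq> zero"
  using base_axiom[OF E_PRA_omega.succ_nonzero, of "dflt((0, N) := n)"] by simp

lemma zero_nonsuc [simp]: "n \<in> D N \<Longrightarrow> zero \<noteq> suc \<bullet> n"
  using suc_nonzero by metis

lemma suc_eq [simp]: "m \<in> D N \<Longrightarrow> n \<in> D N \<Longrightarrow> suc \<bullet> m = suc \<bullet> n \<longleftrightarrow> m = n"
  using base_axiom[OF E_PRA_omega.succ_inj, of "dflt((0, N) := m, (1, N) := n)"] by auto

lemma suc_in' [simp]: "n \<in> D N \<Longrightarrow> suc \<bullet> n \<in> D N"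
  by (rule ap_in[OF suc_in])

lemma rc_in' [simp]:
  assumes "n \<in> D N" "a \<in> D N" "f \<in> D (N \<rightarrow>\<^sub>t N \<rightarrow>\<^sub>t N)"
  shows "rc \<bullet> n \<bullet> a \<bullet> f \<in> D N"
  using assms by (intro ap_in[OF ap_in[OF ap_in[OF rc_in]]])

text \<open>Bracket abstraction satisfies the beta rule in the model; as a simplification rule it
  evaluates all the closed terms of the language.\<close>

lemma lam_eq [simp]:
  assumes "valid e" "wt t" "a \<in> D (snd x)"
  shows "tval e (\<^bold>\<lambda>x. t) \<bullet> a = tval (e(x := a)) t"
  using assms(2)
proof (induction t)
  case (Var y)
  show ?case
  proof (cases "y = x")
    case True
    have "kk (snd x) (snd x) \<bullet> a \<in> D (snd x \<rightarrow>\<^sub>t snd x)"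
      using assms by (intro ap_in[OF kk_in])
    then show ?thesis using True assms by (simp add: lam.simps)
  qed (use assms in \<open>simp add: lam.simps\<close>)
next
  case (App s t)
  then have s: "wt s" and t: "wt t" and ty: "ty_of s = ty_of t \<rightarrow>\<^sub>t cod (ty_of s)" by auto
  have "tval e (\<^bold>\<lambda>x. s) \<in> D (snd x \<rightarrow>\<^sub>t ty_of t \<rightarrow>\<^sub>t cod (ty_of s))"
    using s ty assms(1) by (intro tval_in') simp_all
  moreover have "tval e (\<^bold>\<lambda>x. t) \<in> D (snd x \<rightarrow>\<^sub>t ty_of t)"
    using t assms(1) by simp
  moreover have "tval e s \<bullet> tval e t \<in> D (cod (ty_of s))"
    using s t ty assms(1) by (intro ap_in[of _ "ty_of t"]) simp_all
  ultimately show ?case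
    using assms(1,3) App.IH(1)[OF s] App.IH(2)[OF t]
    by (cases "x \<in> tvars (s \<cdot> t)") (simp_all add: lam.simps del: fun_upd_apply)
qed (use assms in \<open>simp_all add: lam.simps\<close>)

lemma induction:
  assumes "qf \<phi>" "wff \<phi>" "valid e"
    and "sat (e((i, N) := zero)) \<phi>"
    and "\<And>n. n \<in> D N \<Longrightarrow> sat (e((i, N) := n)) \<phi> \<Longrightarrow> sat (e((i, N) := suc \<bullet> n)) \<phi>"
    and "n \<in> D N"
  shows "sat (e((i, N) := n)) \<phi>"
proof -
  have "wff (replace \<phi> (i, N) Zero)" "wff (replace \<phi> (i, N) (Succ \<cdot> Var (i, N)))"
    unfolding replace_def using assms(2) by (auto intro!: wff_subst wt_subst_upd)
  then show ?thesis
    using base_axiom[OF E_PRA_omega.QF_induction[OF assms(1,2) refl, of i] _ assms(3)] assms(2,4-)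
    by (simp add: sat_replace)
qed

text \<open>A HOL predicate \<open>P\<close> on possibly nonstandard numbers may be proved by
  induction only if some quantifier-free formula expresses it. Every use names that formula and
  keeps the parameters in the valuation \<open>e\<close>.\<close>

lemma induction_nx:
  assumes "n \<in> D N" "valid e" "qf \<phi>" "wff \<phi>" "\<And>n. n \<in> D N \<Longrightarrow> P n \<longleftrightarrow> sat (e(nx := n)) \<phi>"
    and "P zero" "\<And>n. n \<in> D N \<Longrightarrow> P n \<Longrightarrow> P (suc \<bullet> n)"
  shows "P n"
  using induction[of \<phi> e 0 n] assms by simp


section \<open>Primitive recursive arithmetic in a model\<close>

definition pl where "pl a b = tval dflt plus_tm \<bullet> a \<bullet> b"
definition mo where "mo a b = tval dflt monus_tm \<bullet> a \<bullet> b"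
definition ti where "ti a b = tval dflt times_tm \<bullet> a \<bullet> b"
definition pred_el where "pred_el = tval dflt pred_tm"
definition pow2_el where "pow2_el = tval dflt pow2_tm"
abbreviation pd where "pd a \<equiv> pred_el \<bullet> a"
abbreviation p2 where "p2 a \<equiv> pow2_el \<bullet> a"

lemma tval_closed: "tvars t = {} \<Longrightarrow> tval e t = tval dflt t"
  by (rule tval_cong) simp

lemma tval_add [simp]:
  "tval e (s \<^bold>+ t) = pl (tval e s) (tval e t)"
  using tval_closed[of plus_tm e] by (auto simp: add_def closed_plus pl_def)

lemma tval_monus [simp]:
  "tval e (s \<^bold>- t) = mo (tval e s) (tval e t)"
  using tval_closed[of monus_tm e] by (auto simp: monus_def closed_monus mo_def)

lemma tval_mult [simp]:
  "tval e (s \<^bold>* t) = ti (tval e s) (tval e t)"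
  using tval_closed[of times_tm e] by (auto simp: mult_def closed_times ti_def)

lemma tval_closed_el [simp]: "tval e pred_tm = pred_el" "tval e pow2_tm = pow2_el"
  unfolding pred_el_def pow2_el_def by (rule tval_closed, simp)+

lemma T1_in: "f \<in> D T1 \<Longrightarrow> a \<in> D N \<Longrightarrow> f \<bullet> a \<in> D N"
  by (rule ap_in)

lemma el_in [simp]: "pred_el \<in> D T1" "pow2_el \<in> D T1"
  by (simp_all add: pred_el_def pow2_el_def del: tval_closed_el)

lemma arith_in [simp]:
  "a \<in> D N \<Longrightarrow> b \<in> D N \<Longrightarrow> pl a b \<in> D N"
  "a \<in> D N \<Longrightarrow> b \<in> D N \<Longrightarrow> mo a b \<in> D N"
  "a \<in> D N \<Longrightarrow> b \<in> D N \<Longrightarrow> ti a b \<in> D N"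
  "a \<in> D N \<Longrightarrow> pd a \<in> D N"
  "a \<in> D N \<Longrightarrow> p2 a \<in> D N"
  unfolding pl_def mo_def ti_def
  by (auto intro!: ap_in[of _ N] simp: closed_plus closed_monus closed_times)

lemma pl_rec [simp]:
  "a \<in> D N \<Longrightarrow> pl a zero = a"
  "a \<in> D N \<Longrightarrow> b \<in> D N \<Longrightarrow> pl a (suc \<bullet> b) = suc \<bullet> pl a b"
  by (simp_all add: pl_def plus_tm_def)

lemma pd_rec [simp]: "pd zero = zero" "a \<in> D N \<Longrightarrow> pd (suc \<bullet> a) = a"
  by (simp_all add: pred_el_def pred_tm_def del: tval_closed_el)

lemma mo_rec [simp]:
  "a \<in> D N \<Longrightarrow> mo a zero = a"
  "a \<in> D N \<Longrightarrow> b \<in> D N \<Longrightarrow> mo a (suc \<bullet> b) = pd (mo a b)"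
  by (simp_all add: mo_def monus_tm_def)

lemma ti_rec [simp]:
  "a \<in> D N \<Longrightarrow> ti a zero = zero"
  "a \<in> D N \<Longrightarrow> b \<in> D N \<Longrightarrow> ti a (suc \<bullet> b) = pl (ti a b) a"
  by (simp_all add: ti_def times_tm_def)

lemma p2_rec [simp]:
  "p2 zero = suc \<bullet> zero"
  "a \<in> D N \<Longrightarrow> p2 (suc \<bullet> a) = pl (p2 a) (p2 a)"
  by (simp_all add: pow2_el_def pow2_tm_def del: tval_closed_el)

section \<open>Semiring laws and truncated subtraction\<close>

lemma pl_zero_left [simp]: "a \<in> D N \<Longrightarrow> pl zero a = a"
  by (rule induction_nx[of a dflt "Zero \<^bold>+ Var nx \<^bold>= Var nx"]) simp_all

lemma pl_suc_left [simp]: "a \<in> D N \<Longrightarrow> b \<in> D N \<Longrightarrow> pl (suc \<bullet> b) a = suc \<bullet> pl b a"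
  by (rule induction_nx[of a "dflt(ny := b)" "Succ \<cdot> Var ny \<^bold>+ Var nx \<^bold>= Succ \<cdot> (Var ny \<^bold>+ Var nx)"])
    simp_all

lemma pl_comm: "a \<in> D N \<Longrightarrow> b \<in> D N \<Longrightarrow> pl b a = pl a b"
  by (rule induction_nx[of a "dflt(ny := b)" "Var ny \<^bold>+ Var nx \<^bold>= Var nx \<^bold>+ Var ny"]) simp_all

lemma pl_assoc:
  "a \<in> D N \<Longrightarrow> b \<in> D N \<Longrightarrow> c \<in> D N \<Longrightarrow> pl (pl b c) a = pl b (pl c a)"
  by (rule induction_nx[of a "dflt(ny := b, nr := c)"
        "Var ny \<^bold>+ Var nr \<^bold>+ Var nx \<^bold>= Var ny \<^bold>+ (Var nr \<^bold>+ Var nx)"]) simp_all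

lemma pl_left_comm:
  "a \<in> D N \<Longrightarrow> b \<in> D N \<Longrightarrow> c \<in> D N \<Longrightarrow> pl b (pl a c) = pl a (pl b c)"
  using pl_comm pl_assoc by metis

lemma pl_cancel [simp]:
  assumes "a \<in> D N" "b \<in> D N" "c \<in> D N"
  shows "pl b a = pl c a \<longleftrightarrow> b = c"
proof -
  have "pl b a = pl c a \<longrightarrow> b = c"
    by (rule induction_nx[of a "dflt(ny := b, nr := c)"
        "Var ny \<^bold>+ Var nx \<^bold>= Var nr \<^bold>+ Var nx \<^bold>\<longrightarrow> Var ny \<^bold>= Var nr"])
      (use assms in simp_all)
  then show ?thesis by blast
qed

lemma N_cases: "a \<in> D N \<Longrightarrow> a = zero \<or> a = suc \<bullet> pd a"
  by (rule induction_nx[of a dflt "Var nx \<^bold>= Zero \<^bold>\<or> Var nx \<^bold>= Succ \<cdot> (pred_tm \<cdot> Var nx)"]) auto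

lemma pl_eq_zero: "a \<in> D N \<Longrightarrow> b \<in> D N \<Longrightarrow> pl a b = zero \<Longrightarrow> b = zero"
  using N_cases[of b] pl_rec(2)[of a "pd b"] by fastforce

lemma mo_suc_suc [simp]: "a \<in> D N \<Longrightarrow> b \<in> D N \<Longrightarrow> mo (suc \<bullet> b) (suc \<bullet> a) = mo b a"
  by (rule induction_nx[of a "dflt(ny := b)" "Succ \<cdot> Var ny \<^bold>- Succ \<cdot> Var nx \<^bold>= Var ny \<^bold>- Var nx"])
    (simp_all del: mo_rec(2), simp_all)

lemma mo_self [simp]: "a \<in> D N \<Longrightarrow> mo a a = zero"
  by (rule induction_nx[of a dflt "Var nx \<^bold>- Var nx \<^bold>= Zero"]) (simp_all del: mo_rec(2))

lemma mo_pl [simp]: "a \<in> D N \<Longrightarrow> b \<in> D N \<Longrightarrow> mo (pl b a) a = b"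
  by (rule induction_nx[of a "dflt(ny := b)" "(Var ny \<^bold>+ Var nx) \<^bold>- Var nx \<^bold>= Var ny"])
    (simp_all del: mo_rec(2))

lemma mo_pl_self [simp]: "a \<in> D N \<Longrightarrow> b \<in> D N \<Longrightarrow> mo b (pl b a) = zero"
  by (rule induction_nx[of a "dflt(ny := b)" "Var ny \<^bold>- (Var ny \<^bold>+ Var nx) \<^bold>= Zero"])
    simp_all

text \<open>Totality of the order with the truncated difference as explicit witness. This keeps the
  statement quantifier-free and hence open to induction.\<close>

lemma mo_total:
  assumes a: "a \<in> D N" and b: "b \<in> D N"
  shows "(mo b a = zero \<longrightarrow> pl b (mo a b) = a) \<and> (mo b a \<noteq> zero \<longrightarrow> pl a (mo b a) = b)"
proof (rule induction_nx[of a "dflt(ny := b)" "(Var ny \<^bold>- Var nx \<^bold>= Zero \<^bold>\<longrightarrow> Var ny \<^bold>+ (Var nx \<^bold>- Var ny) \<^bold>= Var nx) \<^bold>\<and>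
     (\<^bold>\<not> Var ny \<^bold>- Var nx \<^bold>= Zero \<^bold>\<longrightarrow> Var nx \<^bold>+ (Var ny \<^bold>- Var nx) \<^bold>= Var ny)"])
  fix n assume n: "n \<in> D N"
    and IH: "(mo b n = zero \<longrightarrow> pl b (mo n b) = n) \<and> (mo b n \<noteq> zero \<longrightarrow> pl n (mo b n) = b)"
  show "(mo b (suc \<bullet> n) = zero \<longrightarrow> pl b (mo (suc \<bullet> n) b) = suc \<bullet> n) \<and>
      (mo b (suc \<bullet> n) \<noteq> zero \<longrightarrow> pl (suc \<bullet> n) (mo b (suc \<bullet> n)) = b)"
  proof (cases "mo b n = zero")
    case True
    define d where "d = mo n b"
    have d: "d \<in> D N" "n = pl b d" using IH True n b by (auto simp: d_def)
    have "mo (suc \<bullet> n) b = mo (pl (suc \<bullet> d) b) b" using d b pl_comm[of b d] by simp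
    also have "\<dots> = suc \<bullet> d" using d b by (simp del: pl_suc_left)
    finally show ?thesis using True d b n by simp
  next
    case False
    define w where "w = pd (mo b n)"
    have w: "mo b n = suc \<bullet> w" "w \<in> D N" using N_cases[of "mo b n"] False n b by (auto simp: w_def)
    have "b = suc \<bullet> pl n w" using IH False w n by simp
    then show ?thesis using w n b by (cases "w = zero") simp_all
  qed
qed (use a b in auto)

lemma ti_zero_left [simp]: "a \<in> D N \<Longrightarrow> ti zero a = zero"
  by (rule induction_nx[of a dflt "Zero \<^bold>* Var nx \<^bold>= Zero"]) simp_all

lemma ti_suc_left [simp]: "a \<in> D N \<Longrightarrow> b \<in> D N \<Longrightarrow> ti (suc \<bullet> b) a = pl (ti b a) a"
  by (rule induction_nx[of a "dflt(ny := b)" "Succ \<cdot> Var ny \<^bold>* Var nx \<^bold>= Var ny \<^bold>* Var nx \<^bold>+ Var nx"])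
    (simp_all add: pl_assoc pl_comm pl_left_comm)

lemma ti_comm: "a \<in> D N \<Longrightarrow> b \<in> D N \<Longrightarrow> ti b a = ti a b"
  by (rule induction_nx[of a "dflt(ny := b)" "Var ny \<^bold>* Var nx \<^bold>= Var nx \<^bold>* Var ny"]) simp_all

lemma ti_distrib:
  "a \<in> D N \<Longrightarrow> b \<in> D N \<Longrightarrow> c \<in> D N \<Longrightarrow> ti (pl b c) a = pl (ti b a) (ti c a)"
  by (rule induction_nx[of a "dflt(ny := b, nr := c)"
        "(Var ny \<^bold>+ Var nr) \<^bold>* Var nx \<^bold>= Var ny \<^bold>* Var nx \<^bold>+ Var nr \<^bold>* Var nx"])
    (simp_all add: pl_assoc pl_comm pl_left_comm)

lemma ti_assoc:
  "a \<in> D N \<Longrightarrow> b \<in> D N \<Longrightarrow> c \<in> D N \<Longrightarrow> ti (ti b c) a = ti b (ti c a)"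
  by (rule induction_nx[of a "dflt(ny := b, nr := c)"
        "Var ny \<^bold>* Var nr \<^bold>* Var nx \<^bold>= Var ny \<^bold>* (Var nr \<^bold>* Var nx)"])
    (simp_all add: ti_comm[of _ b] ti_distrib)

lemma ti_eq_zero: "a \<in> D N \<Longrightarrow> b \<in> D N \<Longrightarrow> ti a b = zero \<Longrightarrow> a = zero \<or> b = zero"
proof (rule ccontr)
  assume a: "a \<in> D N" and b: "b \<in> D N" and ab: "ti a b = zero" "\<not> (a = zero \<or> b = zero)"
  then have "a = suc \<bullet> pd a" "b = suc \<bullet> pd b" using N_cases by blast+
  then have "ti a b = suc \<bullet> pl (ti a (pd b)) (pd a)" using a b ti_rec(2)[of a "pd b"] pl_rec(2)
    by (metis arith_in(3,4))
  then show False using ab a b by simp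
qed

end


section \<open>Ordered fields of fractions\<close>

text \<open>The laws from which an ordered field of fractions is built, relative to a carrier so
  that they can be asserted inside a model. Discreteness, in the form of \<open>pred\<close>, is
  what later bounds fractions by numbers.\<close>

locale nat_semiring_on =
  fixes C :: "'a set" and z u :: 'a and p t :: "'a \<Rightarrow> 'a \<Rightarrow> 'a"
  assumes z_in: "z \<in> C" and u_in: "u \<in> C"
    and p_in: "a \<in> C \<Longrightarrow> b \<in> C \<Longrightarrow> p a b \<in> C"
    and t_in: "a \<in> C \<Longrightarrow> b \<in> C \<Longrightarrow> t a b \<in> C"
    and p_assoc: "a \<in> C \<Longrightarrow> b \<in> C \<Longrightarrow> c \<in> C \<Longrightarrow> p (p a b) c = p a (p b c)"
    and p_comm: "a \<in> C \<Longrightarrow> b \<in> C \<Longrightarrow> p a b = p b a"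
    and p_z: "a \<in> C \<Longrightarrow> p z a = a"
    and p_cancel: "a \<in> C \<Longrightarrow> b \<in> C \<Longrightarrow> c \<in> C \<Longrightarrow> p a b = p a c \<Longrightarrow> b = c"
    and t_assoc: "a \<in> C \<Longrightarrow> b \<in> C \<Longrightarrow> c \<in> C \<Longrightarrow> t (t a b) c = t a (t b c)"
    and t_comm: "a \<in> C \<Longrightarrow> b \<in> C \<Longrightarrow> t a b = t b a"
    and t_u: "a \<in> C \<Longrightarrow> t u a = a"
    and t_z: "a \<in> C \<Longrightarrow> t z a = z"
    and distrib: "a \<in> C \<Longrightarrow> b \<in> C \<Longrightarrow> c \<in> C \<Longrightarrow> t (p a b) c = p (t a c) (t b c)"
    and z_neq_u: "z \<noteq> u"
    and t_eq_z: "a \<in> C \<Longrightarrow> b \<in> C \<Longrightarrow> t a b = z \<Longrightarrow> a = z \<or> b = z"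
    and p_eq_z: "a \<in> C \<Longrightarrow> b \<in> C \<Longrightarrow> p a b = z \<Longrightarrow> b = z"
    and pred: "a \<in> C \<Longrightarrow> a \<noteq> z \<Longrightarrow> \<exists>b\<in>C. a = p u b"
    and total: "a \<in> C \<Longrightarrow> b \<in> C \<Longrightarrow> \<exists>c\<in>C. a = p b c \<or> b = p a c"

text \<open>Transports the standard numbers along an injection, to obtain an instance on terms that
  depends on no hypothesis.\<close>

lemma nat_semiring_on_image:
  fixes f :: "nat \<Rightarrow> 'a"
  assumes "inj f"
  shows "nat_semiring_on (range f) (f 0) (f 1)
    (\<lambda>a b. f (inv f a + inv f b)) (\<lambda>a b. f (inv f a * inv f b))"
proof
  fix a b assume "a \<in> range f" "b \<in> range f"
  then obtain m n where "a = f m" "b = f n" by blast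
  then show "\<exists>c\<in>range f. a = f (inv f b + inv f c) \<or> b = f (inv f a + inv f c)"
    using assms le_Suc_ex[of m n] le_Suc_ex[of n m] nat_le_linear[of m n] by auto
next
  fix a assume a: "a \<in> range f" "a \<noteq> f 0"
  obtain m where m: "a = f m" using a(1) by blast
  have "m \<noteq> 0" using a(2) m by metis
  with m show "\<exists>b\<in>range f. a = f (inv f (f 1) + inv f b)"
    by (intro bexI[of _ "f (m - 1)"]) (simp_all add: inv_f_f[OF assms])
qed (use assms in \<open>auto simp: algebra_simps inj_eq\<close>)

sublocale pra_model \<subseteq> numbers: nat_semiring_on "D N" zero "suc \<bullet> zero" pl ti
proof
  fix a b assume a: "a \<in> D N" and b: "b \<in> D N"
  then show "\<exists>c\<in>D N. a = pl b c \<or> b = pl a c"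
    using mo_total[OF a b] arith_in(2)[OF a b] arith_in(2)[OF b a] by metis
next
  fix a assume "a \<in> D N" "a \<noteq> zero"
  then show "\<exists>b\<in>D N. a = pl (suc \<bullet> zero) b" using N_cases[of a] by (intro bexI[of _ "pd a"]) simp_all
next
  fix a b assume "a \<in> D N" "b \<in> D N" "ti a b = zero"
  then show "a = zero \<or> b = zero" by (rule ti_eq_zero)
next
  fix a b assume "a \<in> D N" "b \<in> D N" "pl a b = zero"
  then show "b = zero" by (rule pl_eq_zero)
next
  fix a b c assume "a \<in> D N" "b \<in> D N" "c \<in> D N" "pl a b = pl a c"
  then show "b = c" using pl_cancel pl_comm by metis
qed (simp_all add: pl_assoc ti_assoc ti_distrib, simp_all add: pl_comm ti_comm)

text \<open>
  A type cannot depend on a model given only inside a proof. We therefore fix globally the numbers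
  of a putative countermodel, with the standard numbers as a fallback.
\<close>

definition refuting_set :: "fm set" where
  "refuting_set = (SOME H. henkin_set ACA0_omega H \<and> (\<^bold>\<not> countable_sets_weak_measure_zero) \<in> H)"

type_synonym 'a semiring_data = "'a set \<times> 'a \<times> 'a \<times> ('a \<Rightarrow> 'a \<Rightarrow> 'a) \<times> ('a \<Rightarrow> 'a \<Rightarrow> 'a)"

text \<open>The constants of the model are applied to explicit parameters: whether
  \<open>refuting_set\<close> is a Henkin set is not known here, so no interpretation is
  available.\<close>

definition refuting_data :: "tm semiring_data" where
  "refuting_data =
     (let H = refuting_set; nf = henkin_model.nf H; ap = henkin_model.nap H;
        zero = nf Zero; suc = nf Succ; rc = nf Rc; kk = (\<lambda>\<rho> \<tau>. nf (Kc \<rho> \<tau>));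
        ss = (\<lambda>\<delta> \<rho> \<tau>. nf (Sc \<delta> \<rho> \<tau>))
      in (henkin_model.ntrm H N, zero, ap suc zero,
          pra_model.pl ap zero suc rc kk ss, pra_model.ti ap zero suc rc kk ss))"

definition is_data :: "'a semiring_data \<Rightarrow> bool" where
  "is_data = (\<lambda>(C, z, u, p, t). nat_semiring_on C z u p t)"

definition data :: "tm semiring_data" where
  "data = (if is_data refuting_data then refuting_data
     else let f = (\<lambda>n. Var (n, N)) in (range f, f 0, f 1,
       \<lambda>a b. f (inv f a + inv f b), \<lambda>a b. f (inv f a * inv f b)))"

definition "data_C = fst data"
definition "data_z = fst (snd data)"
definition "data_u = fst (snd (snd data))"
definition "data_p = fst (snd (snd (snd data)))"
definition "data_t = snd (snd (snd (snd data)))"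

interpretation data: nat_semiring_on data_C data_z data_u data_p data_t
proof -
  have "inj (\<lambda>n. Var (n, N))" by (auto simp: inj_def)
  from nat_semiring_on_image[OF this] have "is_data data"
    by (simp add: data_def is_data_def Let_def)
  then show "nat_semiring_on data_C data_z data_u data_p data_t"
    by (simp add: is_data_def data_C_def data_z_def data_u_def data_p_def data_t_def case_prod_beta)
qed

section \<open>The numbers as a semiring type\<close>

typedef num_sr = data_C
  using data.z_in by blast

setup_lifting type_definition_num_sr

instantiation num_sr :: comm_semiring_1
begin
lift_definition zero_num_sr :: num_sr is data_z by (rule data.z_in)
lift_definition one_num_sr :: num_sr is data_u by (rule data.u_in)
lift_definition plus_num_sr :: "num_sr \<Rightarrow> num_sr \<Rightarrow> num_sr" is data_p by (rule data.p_in)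
lift_definition times_num_sr :: "num_sr \<Rightarrow> num_sr \<Rightarrow> num_sr" is data_t by (rule data.t_in)
instance
proof
  fix a b c :: num_sr
  show "a + b + c = a + (b + c)" by transfer (rule data.p_assoc)
  show "a + b = b + a" by transfer (rule data.p_comm)
  show "0 + a = a" by transfer (rule data.p_z)
  show "a * b * c = a * (b * c)" by transfer (rule data.t_assoc)
  show "a * b = b * a" by transfer (rule data.t_comm)
  show "1 * a = a" by transfer (rule data.t_u)
  show "0 * a = 0" by transfer (rule data.t_z)
  show "a * 0 = 0" by transfer (metis data.t_z data.t_comm data.z_in)
  show "(a + b) * c = a * c + b * c" by transfer (rule data.distrib)
  show "(0::num_sr) \<noteq> 1" by transfer (rule data.z_neq_u)
qed
end

instance num_sr :: cancel_semigroup_add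
proof
  fix a b c :: num_sr
  show *: "a + b = a + c \<Longrightarrow> b = c" for a b c :: num_sr by transfer (rule data.p_cancel)
  show "b + a = c + a \<Longrightarrow> b = c" using *[of a b c] by (simp add: add.commute)
qed

lemma num_sr_times_eq_0: "(a :: num_sr) * b = 0 \<Longrightarrow> a = 0 \<or> b = 0"
  by transfer (rule data.t_eq_z)

lemma num_sr_plus_eq_0: "(a :: num_sr) + b = 0 \<Longrightarrow> b = 0"
  by transfer (rule data.p_eq_z)

lemma num_sr_pred: "(a :: num_sr) \<noteq> 0 \<Longrightarrow> \<exists>b. a = 1 + b"
  by transfer (use data.pred in auto)

lemma num_sr_total: "\<exists>c. (a :: num_sr) = b + c \<or> b = a + c"
  by transfer (use data.total in auto)

lifting_forget num_sr.lifting

section \<open>The ordered ring of differences\<close>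

fun diff_rel :: "num_sr \<times> num_sr \<Rightarrow> num_sr \<times> num_sr \<Rightarrow> bool" where
  "diff_rel (a, b) (c, d) \<longleftrightarrow> a + d = c + b"

quotient_type num_ring = "num_sr \<times> num_sr" / diff_rel morphisms Rep_num_ring Abs_num_ring
proof (rule equivpI)
  show "reflp diff_rel" by (auto simp: reflp_def)
  show "symp diff_rel" by (auto simp: symp_def)
  show "transp diff_rel"
  proof (rule transpI, clarsimp)
    fix a b c d e f :: num_sr
    assume "a + d = c + b" "c + f = e + d"
    \<comment> \<open>Both sides are sums of the two assumptions, so \<open>c + d\<close> can be
      cancelled.\<close>
    then have "(c + d) + (a + f) = (c + d) + (e + b)" by (metis add.assoc add.commute)
    then show "a + f = e + b" by simp
  qed
qed

text \<open>Well-definedness of the product of differences in its left factor; transitivity joins it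
  with the same fact for the right factor.\<close>

lemma num_sr_sub_mult_left:
  fixes a b c d x y :: num_sr
  assumes "a + d = c + b"
  shows "(a * x + b * y) + (c * y + d * x) = (c * x + d * y) + (a * y + b * x)"
proof -
  have "(a * x + b * y) + (c * y + d * x) = (a + d) * x + (c + b) * y" by (simp add: algebra_simps)
  also have "\<dots> = (c + b) * x + (a + d) * y" by (simp add: assms)
  finally show ?thesis by (simp add: algebra_simps)
qed

instantiation num_ring :: comm_ring_1
begin
lift_definition zero_num_ring :: num_ring is "(0, 0)" .
lift_definition one_num_ring :: num_ring is "(1, 0)" .
lift_definition plus_num_ring :: "num_ring \<Rightarrow> num_ring \<Rightarrow> num_ring"
  is "\<lambda>(a, b) (c, d). (a + c, b + d)"
proof clarsimp
  fix a b c d e f g h :: num_sr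
  assume "a + d = c + b" "e + h = g + f"
  then have "(a + d) + (e + h) = (c + b) + (g + f)" by simp
  then show "a + e + (d + h) = c + g + (b + f)" by (simp add: ac_simps)
qed
lift_definition uminus_num_ring :: "num_ring \<Rightarrow> num_ring" is "\<lambda>(a, b). (b, a)"
  by (auto simp: add.commute)
lift_definition times_num_ring :: "num_ring \<Rightarrow> num_ring \<Rightarrow> num_ring"
  is "\<lambda>(a, b) (c, d). (a * c + b * d, a * d + b * c)"
proof clarsimp
  fix a b c d e f g h :: num_sr
  assume 1: "a + d = c + b" and 2: "e + h = g + f"
  have "diff_rel (a * e + b * f, a * f + b * e) (c * e + d * f, c * f + d * e)"
    using num_sr_sub_mult_left[OF 1, of e f] by simp
  moreover have "diff_rel (c * e + d * f, c * f + d * e) (c * g + d * h, c * h + d * g)"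
    using num_sr_sub_mult_left[OF 2, of c d] by (simp add: ac_simps)
  ultimately have "diff_rel (a * e + b * f, a * f + b * e) (c * g + d * h, c * h + d * g)"
    using equivp_transp[OF num_ring_equivp] by blast
  then show "a * e + b * f + (c * h + d * g) = c * g + d * h + (a * f + b * e)" by simp
qed
definition minus_num_ring :: "num_ring \<Rightarrow> num_ring \<Rightarrow> num_ring" where
  "minus_num_ring a b = a + - b"
instance
proof
  fix a b c :: num_ring
  show "a + b + c = a + (b + c)" by transfer (auto simp: ac_simps)
  show "a + b = b + a" by transfer (auto simp: ac_simps)
  show "0 + a = a" by transfer auto
  show "- a + a = 0" by transfer (auto simp: ac_simps)
  show "a - b = a + - b" by (simp add: minus_num_ring_def)
  show "a * b * c = a * (b * c)" by transfer (auto simp: algebra_simps)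
  show "a * b = b * a" by transfer (auto simp: ac_simps)
  show "1 * a = a" by transfer auto
  show "(a + b) * c = a * c + b * c" by transfer (auto simp: algebra_simps)
  show "(0::num_ring) \<noteq> 1" by transfer simp
qed
end

lift_definition of_num :: "num_sr \<Rightarrow> num_ring" is "\<lambda>a. (a, 0)" .

lemma of_num_simps [simp]:
  "of_num 0 = 0" "of_num 1 = 1" "of_num (a + b) = of_num a + of_num b"
  "of_num (a * b) = of_num a * of_num b" "of_num a = of_num b \<longleftrightarrow> a = b"
  by (transfer, simp)+

lemma num_ring_sign: "\<exists>c. a = of_num c \<or> a = - of_num c"
proof transfer
  fix a :: "num_sr \<times> num_sr"
  obtain p q where a: "a = (p, q)" by fastforce
  obtain c where "p = q + c \<or> q = p + c" using num_sr_total by blast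
  then show "\<exists>c. diff_rel a (c, 0) \<or> diff_rel a (case (c, 0) of (a, b) \<Rightarrow> (b, a))"
    unfolding a by (intro exI[of _ c]) (auto simp: ac_simps)
qed

instantiation num_ring :: linordered_idom
begin
definition less_eq_num_ring :: "num_ring \<Rightarrow> num_ring \<Rightarrow> bool" where
  "a \<le> b \<longleftrightarrow> (\<exists>c. b = a + of_num c)"
definition less_num_ring :: "num_ring \<Rightarrow> num_ring \<Rightarrow> bool" where
  "a < b \<longleftrightarrow> a \<le> b \<and> a \<noteq> (b :: num_ring)"
definition abs_num_ring :: "num_ring \<Rightarrow> num_ring" where
  "\<bar>a :: num_ring\<bar> = (if a < 0 then - a else a)"
definition sgn_num_ring :: "num_ring \<Rightarrow> num_ring" where
  "sgn (a :: num_ring) = (if a = 0 then 0 else if 0 < a then 1 else - 1)"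
instance
proof
  fix a b c :: num_ring
  show refl: "a \<le> a" unfolding less_eq_num_ring_def by (intro exI[of _ 0]) simp
  show trans: "a \<le> b \<Longrightarrow> b \<le> c \<Longrightarrow> a \<le> c"
    unfolding less_eq_num_ring_def by (metis add.assoc of_num_simps(3))
  show antisym: "a \<le> b \<Longrightarrow> b \<le> a \<Longrightarrow> a = b" for a b :: num_ring
  proof -
    assume "a \<le> b" "b \<le> a"
    then obtain c d where cd: "b = a + of_num c" "a = b + of_num d"
      unfolding less_eq_num_ring_def by blast
    then have "of_num (c + d) = of_num 0" by (simp add: algebra_simps)
    \<comment> \<open>Numbers that add up to zero are zero.\<close>
    then have "d = 0" using num_sr_plus_eq_0 unfolding of_num_simps(5) by blast
    then show "a = b" using cd by simp
  qed
  show "a \<le> b \<or> b \<le> a"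
  proof -
    obtain d where "b - a = of_num d \<or> b - a = - of_num d" using num_ring_sign by blast
    then have "b = a + of_num d \<or> a = b + of_num d" by (auto simp: algebra_simps)
    then show ?thesis unfolding less_eq_num_ring_def by blast
  qed
  show "a < b \<longleftrightarrow> a \<le> b \<and> \<not> b \<le> a"
    using antisym refl unfolding less_num_ring_def by blast
  show "a \<le> b \<Longrightarrow> c + a \<le> c + b"
    unfolding less_eq_num_ring_def by (auto simp: algebra_simps)
  have pos: "0 < x \<longleftrightarrow> (\<exists>c. c \<noteq> 0 \<and> x = of_num c)" for x
    unfolding less_num_ring_def less_eq_num_ring_def using of_num_simps(1,5) by (metis add_0)
  have less: "x < y \<longleftrightarrow> 0 < y - x" for x y :: num_ring
    unfolding less_num_ring_def less_eq_num_ring_def by (auto simp: algebra_simps)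
  have pos_mult: "0 < x * y" if "0 < x" "0 < y" for x y :: num_ring
    using that num_sr_times_eq_0 unfolding pos by (metis of_num_simps(4))
  show "a < b \<Longrightarrow> 0 < c \<Longrightarrow> c * a < c * b"
    using pos_mult[of c "b - a"] unfolding less[of a] less[of "c * a"] by (simp add: right_diff_distrib)
  show "\<bar>a\<bar> = (if a < 0 then - a else a)" by (simp add: abs_num_ring_def)
  show "sgn a = (if a = 0 then 0 else if 0 < a then 1 else - 1)" by (simp add: sgn_num_ring_def)
qed
end

lemma of_num_nonneg: "0 \<le> of_num a"
  unfolding less_eq_num_ring_def by auto

lemma num_ring_pos_ge_1: "0 < (a :: num_ring) \<Longrightarrow> 1 \<le> a"
proof -
  assume "0 < a"
  then obtain c where c: "a = of_num c" "a \<noteq> 0"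
    unfolding less_num_ring_def less_eq_num_ring_def by auto
  then have "c \<noteq> 0" using of_num_simps(1) by blast
  then obtain b where "c = 1 + b" using num_sr_pred by blast
  then show ?thesis using c of_num_nonneg[of b] by simp
qed

text \<open>By discreteness a nonzero denominator has absolute value at least 1, so the absolute
  value of the numerator already bounds the fraction. Thus the numbers are cofinal in the
  field.\<close>

lemma fract_le_of_num: "\<exists>c. (x :: num_ring fract) \<le> Fract (of_num c) 1"
proof (cases x rule: Fract_cases)
  case (Fract a b)
  obtain c where c: "\<bar>a\<bar> = of_num c"
    using abs_ge_zero[of a] unfolding less_eq_num_ring_def by auto
  \<comment> \<open>Comparing \<open>Fract a b\<close> with an integer means comparing after
    multiplication by \<open>b * b\<close>.\<close>
  have "a * b \<le> \<bar>a\<bar> * \<bar>b\<bar>" by (metis abs_ge_self abs_mult)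
  also have "\<dots> \<le> \<bar>a\<bar> * (\<bar>b\<bar> * \<bar>b\<bar>)"
    using num_ring_pos_ge_1[of "\<bar>b\<bar>"] Fract mult_left_mono[of 1 "\<bar>b\<bar>" "\<bar>b\<bar>"]
    by (intro mult_left_mono) (auto simp del: abs_mult_self_eq)
  finally have "a * b \<le> of_num c * (b * b)" by (simp add: c)
  then have "x \<le> Fract (of_num c) 1" using Fract by (simp add: mult.assoc)
  then show ?thesis ..
qed


section \<open>Rational and real numbers in a model\<close>

text \<open>Cofinality of the numbers, \<open>\<iota>_unbounded\<close>, takes the place of the
  Archimedean axiom: the field may have elements above all standard integers.\<close>

locale embedded_model = pra_model +
  fixes \<iota> :: "'a \<Rightarrow> 'k :: linordered_field"
  assumes \<iota>_eq: "a \<in> D N \<Longrightarrow> b \<in> D N \<Longrightarrow> \<iota> a = \<iota> b \<longleftrightarrow> a = b"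
    and \<iota>_zero [simp]: "\<iota> zero = 0"
    and \<iota>_one: "\<iota> (suc \<bullet> zero) = 1"
    and \<iota>_pl [simp]: "a \<in> D N \<Longrightarrow> b \<in> D N \<Longrightarrow> \<iota> (pl a b) = \<iota> a + \<iota> b"
    and \<iota>_ti [simp]: "a \<in> D N \<Longrightarrow> b \<in> D N \<Longrightarrow> \<iota> (ti a b) = \<iota> a * \<iota> b"
    and \<iota>_nonneg [simp]: "a \<in> D N \<Longrightarrow> 0 \<le> \<iota> a"
    and \<iota>_unbounded: "\<exists>n\<in>D N. x \<le> \<iota> n"
begin

lemma \<iota>_suc [simp]: "a \<in> D N \<Longrightarrow> \<iota> (suc \<bullet> a) = \<iota> a + 1"
  using \<iota>_pl[of a "suc \<bullet> zero"] \<iota>_one by simp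

text \<open>Links the order defined by truncated subtraction with the order of the field, from which
  all comparisons are then taken.\<close>

lemma mo_cases:
  assumes "a \<in> D N" "b \<in> D N"
  shows "\<iota> a \<le> \<iota> b \<and> mo a b = zero \<or> \<iota> b < \<iota> a \<and> mo a b \<noteq> zero \<and> \<iota> (mo a b) = \<iota> a - \<iota> b"
proof (cases "mo a b = zero")
  case True
  then have "pl a (mo b a) = b" using mo_total assms by blast
  then have "\<iota> b = \<iota> a + \<iota> (mo b a)" using assms by (metis \<iota>_pl arith_in(2))
  then show ?thesis using True assms \<iota>_nonneg[of "mo b a"] by simp
next
  case False
  then have "pl b (mo a b) = a" using mo_total assms by blast
  then have "\<iota> a = \<iota> b + \<iota> (mo a b)" using assms by (metis \<iota>_pl arith_in(2))
  moreover have "\<iota> (mo a b) > 0"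
    using False assms \<iota>_eq[of "mo a b" zero] \<iota>_nonneg[of "mo a b"] by (simp add: order_less_le)
  ultimately show ?thesis using False by simp
qed

lemma mo_eq_zero: "a \<in> D N \<Longrightarrow> b \<in> D N \<Longrightarrow> mo a b = zero \<longleftrightarrow> \<iota> a \<le> \<iota> b"
  using mo_cases[of a b] by auto

lemma \<iota>_mo [simp]: "a \<in> D N \<Longrightarrow> b \<in> D N \<Longrightarrow> \<iota> (mo a b) = (if \<iota> a \<le> \<iota> b then 0 else \<iota> a - \<iota> b)"
  using mo_cases[of a b] by auto

text \<open>A positive difference of numbers is itself a successor, so the numbers stay discrete
  inside the field.\<close>

lemma \<iota>_less_suc: "a \<in> D N \<Longrightarrow> b \<in> D N \<Longrightarrow> \<iota> a + 1 \<le> \<iota> b \<longleftrightarrow> \<iota> a < \<iota> b"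
proof
  assume a: "a \<in> D N" and b: "b \<in> D N" and "\<iota> a < \<iota> b"
  then have m: "mo b a \<noteq> zero" "\<iota> (mo b a) = \<iota> b - \<iota> a" using mo_cases[of b a] by auto
  then have "mo b a = suc \<bullet> pd (mo b a)" using a b N_cases[of "mo b a"] by auto
  then have "\<iota> (mo b a) = \<iota> (pd (mo b a)) + 1" using a b \<iota>_suc[of "pd (mo b a)"] by simp
  moreover have "0 \<le> \<iota> (pd (mo b a))" using a b by simp
  ultimately show "\<iota> a + 1 \<le> \<iota> b" using m(2) by linarith
qed simp

lemma \<iota>_pd: "a \<in> D N \<Longrightarrow> a \<noteq> zero \<Longrightarrow> \<iota> (pd a) = \<iota> a - 1"
  using N_cases[of a] \<iota>_suc[of "pd a"] by simp

lemma \<iota>_eq_0 [simp]: "a \<in> D N \<Longrightarrow> \<iota> a = 0 \<longleftrightarrow> a = zero"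
  using \<iota>_eq[of a zero] by simp

lemma sat_leq [simp]:
  "valid e \<Longrightarrow> wt s \<Longrightarrow> wt t \<Longrightarrow> ty_of s = N \<Longrightarrow> ty_of t = N \<Longrightarrow>
   sat e (s \<^bold>\<le> t) \<longleftrightarrow> \<iota> (tval e s) \<le> \<iota> (tval e t)"
  by (simp add: leq_def mo_eq_zero)

lemma sat_lt [simp]:
  "valid e \<Longrightarrow> wt s \<Longrightarrow> wt t \<Longrightarrow> ty_of s = N \<Longrightarrow> ty_of t = N \<Longrightarrow>
   sat e (s \<^bold>< t) \<longleftrightarrow> \<iota> (tval e s) < \<iota> (tval e t)"
  by (simp add: lt_def \<iota>_less_suc)

subsection \<open>Powers of two\<close>

definition h :: "'a \<Rightarrow> 'k" where
  "h n = 1 / \<iota> (p2 n)"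

lemma p2_ge: "n \<in> D N \<Longrightarrow> \<iota> n + 1 \<le> \<iota> (p2 n)"
proof (rule induction_nx[of n dflt "Succ \<cdot> Var nx \<^bold>\<le> pow2_tm \<cdot> Var nx"])
  fix n assume n: "n \<in> D N" and "\<iota> n + 1 \<le> \<iota> (p2 n)"
  then have "\<iota> n + 1 + 1 \<le> \<iota> (p2 n) + \<iota> (p2 n)" using \<iota>_nonneg[OF n] by linarith
  then show "\<iota> (suc \<bullet> n) + 1 \<le> \<iota> (p2 (suc \<bullet> n))" using n by simp
qed simp_all

lemma p2_pos [simp]: "n \<in> D N \<Longrightarrow> 0 < \<iota> (p2 n)"
  using p2_ge[of n] \<iota>_nonneg[of n] by linarith

lemma p2_nonzero [simp]: "n \<in> D N \<Longrightarrow> p2 n \<noteq> zero"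
  using p2_pos \<iota>_zero less_irrefl by metis

lemma p2_pl: "m \<in> D N \<Longrightarrow> n \<in> D N \<Longrightarrow> p2 (pl m n) = ti (p2 m) (p2 n)"
proof (rule induction_nx[of n "dflt(ny := m)"
      "pow2_tm \<cdot> (Var ny \<^bold>+ Var nx) \<^bold>= pow2_tm \<cdot> Var ny \<^bold>* (pow2_tm \<cdot> Var nx)"])
  fix n assume *: "m \<in> D N" "n \<in> D N" "p2 (pl m n) = ti (p2 m) (p2 n)"
  then have "\<iota> (p2 (pl m (suc \<bullet> n))) = \<iota> (ti (p2 m) (p2 (suc \<bullet> n)))" by (simp add: algebra_simps)
  then show "p2 (pl m (suc \<bullet> n)) = ti (p2 m) (p2 (suc \<bullet> n))" using * by (subst (asm) \<iota>_eq) simp_all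
qed simp_all

lemma h_pos [simp]: "n \<in> D N \<Longrightarrow> 0 < h n"
  by (simp add: h_def)

lemma h_nonneg [simp]: "n \<in> D N \<Longrightarrow> 0 \<le> h n"
  by (simp add: h_def)

lemma h_suc [simp]: "n \<in> D N \<Longrightarrow> h (suc \<bullet> n) = h n / 2"
  by (simp add: h_def)

lemma h_zero [simp]: "h zero = 1"
  by (simp add: h_def)

lemma h_pl: "m \<in> D N \<Longrightarrow> n \<in> D N \<Longrightarrow> h (pl m n) = h m * h n"
  by (simp add: h_def p2_pl)

lemma h_le_1: "n \<in> D N \<Longrightarrow> h n \<le> 1"
proof -
  assume n: "n \<in> D N"
  then have "1 \<le> \<iota> (p2 n)" using p2_ge[OF n] \<iota>_nonneg[OF n] by linarith
  then show "h n \<le> 1" by (simp add: h_def)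
qed

lemma \<iota>_le_pl: "m \<in> D N \<Longrightarrow> n \<in> D N \<Longrightarrow> \<iota> m \<le> \<iota> n \<Longrightarrow> n = pl m (mo n m)"
  using mo_total[of m n] mo_total[of n m] mo_eq_zero[of m n] by metis

lemma h_antimono: "m \<in> D N \<Longrightarrow> n \<in> D N \<Longrightarrow> \<iota> m \<le> \<iota> n \<Longrightarrow> h n \<le> h m"
proof -
  assume m: "m \<in> D N" and n: "n \<in> D N" and le: "\<iota> m \<le> \<iota> n"
  have "h n = h m * h (mo n m)" using \<iota>_le_pl[OF m n le] h_pl[OF m, of "mo n m"] m n by simp
  also have "\<dots> \<le> h m" using m n h_le_1[of "mo n m"] by (simp add: mult_left_le)
  finally show ?thesis .
qed

lemma ex_h_less: "0 < x \<Longrightarrow> \<exists>n\<in>D N. h n < x"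
proof -
  assume x: "0 < x"
  obtain n where n: "n \<in> D N" "1 / x \<le> \<iota> n" using \<iota>_unbounded by blast
  then have "1 / x < \<iota> (p2 n)" using p2_ge[of n] by linarith
  then have "h n < x" using x n by (simp add: h_def field_simps)
  then show ?thesis using n by blast
qed

lemma le_by_h:
  assumes m: "m \<in> D N" and le: "\<And>n. n \<in> D N \<Longrightarrow> \<iota> m \<le> \<iota> n \<Longrightarrow> x \<le> y + 4 * h n"
  shows "x \<le> y"
proof (rule ccontr)
  assume "\<not> x \<le> y"
  then obtain n where n: "n \<in> D N" "h n < (x - y) / 4" using ex_h_less[of "(x - y) / 4"] by auto
  have "h (pl m n) \<le> h n" using m n by (intro h_antimono) simp_all
  then show False using le[of "pl m n"] n m by simp
qed

subsection \<open>Coding of rational numbers\<close>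

definition "tri_el = tval dflt tri_tm"
definition "root_el = tval dflt root_tm"
definition "first_el = tval dflt first_tm"
definition "second_el = tval dflt second_tm"
definition "pr a b = tval dflt pair_tm \<bullet> a \<bullet> b"

lemma tval_coding_el:
  "tval e tri_tm = tri_el" "tval e root_tm = root_el" "tval e first_tm = first_el"
  "tval e second_tm = second_el"
  unfolding tri_el_def root_el_def first_el_def second_el_def by (rule tval_closed, simp)+

lemma coding_el_in [simp]: "tri_el \<in> D T1" "root_el \<in> D T1" "first_el \<in> D T1" "second_el \<in> D T1"
  by (simp_all add: tri_el_def root_el_def first_el_def second_el_def)

declare tval_coding_el [simp]

lemma coding_in [simp]:
  assumes "a \<in> D N"
  shows "tri_el \<bullet> a \<in> D N" "root_el \<bullet> a \<in> D N" "first_el \<bullet> a \<in> D N" "second_el \<bullet> a \<in> D N"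
  using assms by (simp_all add: T1_in)

lemma tval_pair [simp]:
  "tval e (pair s t) = pr (tval e s) (tval e t)"
  using tval_closed[of pair_tm e] by (auto simp: pair_def closed_pair pr_def)

lemma pr_in [simp]: "a \<in> D N \<Longrightarrow> b \<in> D N \<Longrightarrow> pr a b \<in> D N"
  unfolding pr_def by (auto intro!: ap_in[of _ N] simp: closed_pair)

lemma tri_rec [simp]:
  "tri_el \<bullet> zero = zero"
  "a \<in> D N \<Longrightarrow> tri_el \<bullet> (suc \<bullet> a) = pl (tri_el \<bullet> a) (suc \<bullet> a)"
  by (simp_all add: tri_el_def tri_tm_def del: tval_coding_el)

text \<open>The closed form is doubled to make it an equation between numbers, which is
  quantifier-free and therefore provable by induction.\<close>

lemma two_tri: "a \<in> D N \<Longrightarrow> 2 * \<iota> (tri_el \<bullet> a) = \<iota> a * (\<iota> a + 1)"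
proof (rule induction_nx[of a dflt
      "tri_tm \<cdot> Var nx \<^bold>+ tri_tm \<cdot> Var nx \<^bold>= Var nx \<^bold>* (Succ \<cdot> Var nx)"])
  fix a assume "a \<in> D N" "2 * \<iota> (tri_el \<bullet> a) = \<iota> a * (\<iota> a + 1)"
  then show "2 * \<iota> (tri_el \<bullet> (suc \<bullet> a)) = \<iota> (suc \<bullet> a) * (\<iota> (suc \<bullet> a) + 1)"
    by (simp add: algebra_simps)
next
  fix n assume n: "n \<in> D N"
  have "2 * \<iota> (tri_el \<bullet> n) = \<iota> n * (\<iota> n + 1) \<longleftrightarrow>
      \<iota> (pl (tri_el \<bullet> n) (tri_el \<bullet> n)) = \<iota> (ti n (suc \<bullet> n))" using n by (simp del: ti_rec)
  also have "\<dots> \<longleftrightarrow> pl (tri_el \<bullet> n) (tri_el \<bullet> n) = ti n (suc \<bullet> n)" using n by (intro \<iota>_eq) simp_all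
  finally show "2 * \<iota> (tri_el \<bullet> n) = \<iota> n * (\<iota> n + 1) \<longleftrightarrow> sat (dflt(nx := n))
     (tri_tm \<cdot> Var nx \<^bold>+ tri_tm \<cdot> Var nx \<^bold>= Var nx \<^bold>* (Succ \<cdot> Var nx))" by (simp del: ti_rec)
qed simp_all

text \<open>The inner recursor has a constant step function and so acts as a case distinction on
  zero; the tested difference vanishes when the next triangular number has been reached.\<close>

lemma root_rec:
  "root_el \<bullet> zero = zero"
  "a \<in> D N \<Longrightarrow> root_el \<bullet> (suc \<bullet> a) =
     (if \<iota> (tri_el \<bullet> (suc \<bullet> (root_el \<bullet> a))) \<le> \<iota> a + 1 then suc \<bullet> (root_el \<bullet> a) else root_el \<bullet> a)"
proof -
  show "root_el \<bullet> zero = zero"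
    unfolding root_el_def by (simp add: root_tm_def)
  assume a: "a \<in> D N"
  let ?r = "root_el \<bullet> a" and ?m = "mo (tri_el \<bullet> (suc \<bullet> (root_el \<bullet> a))) (suc \<bullet> a)"
  have "root_el \<bullet> (suc \<bullet> a) = rc \<bullet> ?m \<bullet> (suc \<bullet> ?r) \<bullet> (kk T1 N \<bullet> (kk N N \<bullet> ?r))"
    unfolding root_el_def using a ap_in[OF kk_in] by (simp add: root_tm_def del: mo_suc_suc)
  also have "\<dots> = (if ?m = zero then suc \<bullet> ?r else ?r)"
  proof (cases "?m = zero")
    case False
    then have "?m = suc \<bullet> pd ?m" using N_cases[of ?m] a by simp
    moreover have "kk N N \<bullet> ?r \<in> D T1" "kk T1 N \<bullet> (kk N N \<bullet> ?r) \<in> D (N \<rightarrow>\<^sub>t T1)"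
      using a by (auto intro!: ap_in[OF kk_in])
    moreover have "pd ?m \<in> D N" using a by simp
    ultimately show ?thesis using a False rc_suc[of "pd ?m" "suc \<bullet> ?r" "kk T1 N \<bullet> (kk N N \<bullet> ?r)"]
      by (simp del: rc_suc)
  next
    case True
    moreover have "kk T1 N \<bullet> (kk N N \<bullet> ?r) \<in> D (N \<rightarrow>\<^sub>t T1)"
      using a by (auto intro!: ap_in[OF kk_in])
    ultimately show ?thesis using a by simp
  qed
  finally show "root_el \<bullet> (suc \<bullet> a) =
     (if \<iota> (tri_el \<bullet> (suc \<bullet> (root_el \<bullet> a))) \<le> \<iota> a + 1 then suc \<bullet> (root_el \<bullet> a) else root_el \<bullet> a)"
    using a mo_eq_zero[of "tri_el \<bullet> (suc \<bullet> ?r)" "suc \<bullet> a"] by simp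
qed

text \<open>By discreteness the next triangular number is at least \<open>a + 1\<close>. Hence a
  step from \<open>a\<close> to its successor passes at most one triangular number, and a single
  increment of the root suffices.\<close>

lemma root_spec:
  "a \<in> D N \<Longrightarrow> \<iota> (tri_el \<bullet> (root_el \<bullet> a)) \<le> \<iota> a \<and> \<iota> a < \<iota> (tri_el \<bullet> (suc \<bullet> (root_el \<bullet> a)))"
proof (rule induction_nx[of a dflt "tri_tm \<cdot> (root_tm \<cdot> Var nx) \<^bold>\<le> Var nx \<^bold>\<and>
     Var nx \<^bold>< tri_tm \<cdot> (Succ \<cdot> (root_tm \<cdot> Var nx))"])
  fix a assume a: "a \<in> D N"
    and IH: "\<iota> (tri_el \<bullet> (root_el \<bullet> a)) \<le> \<iota> a \<and> \<iota> a < \<iota> (tri_el \<bullet> (suc \<bullet> (root_el \<bullet> a)))"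
  have "\<iota> a + 1 \<le> \<iota> (tri_el \<bullet> (suc \<bullet> (root_el \<bullet> a)))"
    using IH a by (subst \<iota>_less_suc) simp_all
  then show "\<iota> (tri_el \<bullet> (root_el \<bullet> (suc \<bullet> a))) \<le> \<iota> (suc \<bullet> a) \<and>
      \<iota> (suc \<bullet> a) < \<iota> (tri_el \<bullet> (suc \<bullet> (root_el \<bullet> (suc \<bullet> a))))"
    using a IH \<iota>_nonneg[of "root_el \<bullet> a"] by (auto simp: root_rec)
qed (simp_all add: root_rec)

text \<open>Consecutive triangular numbers cut the numbers into disjoint blocks; that
  \<open>tri_el\<close> is monotone is read off from its closed form in the field.\<close>

lemma root_unique:
  assumes r: "r \<in> D N" and a: "a \<in> D N"
    and le: "\<iota> (tri_el \<bullet> r) \<le> \<iota> a" and less: "\<iota> a < \<iota> (tri_el \<bullet> (suc \<bullet> r))"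
  shows "root_el \<bullet> a = r"
proof -
  have mono: "\<iota> (tri_el \<bullet> (suc \<bullet> m)) \<le> \<iota> (tri_el \<bullet> n)"
    if "m \<in> D N" "n \<in> D N" "\<iota> m < \<iota> n" for m n
  proof -
    have "\<iota> m + 1 \<le> \<iota> n" using that by (subst \<iota>_less_suc) simp_all
    then have "(\<iota> m + 1) * (\<iota> m + 1 + 1) \<le> \<iota> n * (\<iota> n + 1)"
      using that by (intro mult_mono) simp_all
    then show ?thesis using two_tri[of "suc \<bullet> m"] two_tri[of n] that by simp
  qed
  have "\<not> \<iota> (root_el \<bullet> a) < \<iota> r" "\<not> \<iota> r < \<iota> (root_el \<bullet> a)"
    using mono[of "root_el \<bullet> a" r] mono[of r "root_el \<bullet> a"] root_spec[OF a] le less r a by fastforce+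
  then show ?thesis using \<iota>_eq[of "root_el \<bullet> a" r] r a by simp
qed

lemma second_pr [simp]: "a \<in> D N \<Longrightarrow> b \<in> D N \<Longrightarrow> second_el \<bullet> pr a b = b"
  and first_pr [simp]: "a \<in> D N \<Longrightarrow> b \<in> D N \<Longrightarrow> first_el \<bullet> pr a b = a"
proof -
  assume a: "a \<in> D N" and b: "b \<in> D N"
  have p: "pr a b = pl (tri_el \<bullet> pl a b) b" using a b by (simp add: pr_def pair_tm_def)
  \<comment> \<open>As \<open>b\<close> is at most \<open>pl a b\<close>, the code stays below the
    next triangular number.\<close>
  have r: "root_el \<bullet> pr a b = pl a b"
    using a b by (intro root_unique) (simp_all add: p add_nonneg_pos)
  show s: "second_el \<bullet> pr a b = b"
  proof -
    have "second_el \<bullet> pr a b = mo (pr a b) (tri_el \<bullet> (root_el \<bullet> pr a b))"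
      unfolding second_el_def using a b by (simp add: second_tm_def)
    also have "\<dots> = mo (pl b (tri_el \<bullet> pl a b)) (tri_el \<bullet> pl a b)"
      unfolding r unfolding p using a b pl_comm[of b "tri_el \<bullet> pl a b"] by simp
    finally show ?thesis using a b by simp
  qed
  show "first_el \<bullet> pr a b = a"
  proof -
    have "first_el \<bullet> pr a b = mo (root_el \<bullet> pr a b) (second_el \<bullet> pr a b)"
      unfolding first_el_def using a b by (simp add: first_tm_def)
    then show ?thesis using a b by (simp add: r s)
  qed
qed

end


lemma diff_divide_le_iff:
  fixes p n d p' n' d' :: "'k :: linordered_field"
  assumes "0 < d" "0 < d'"
  shows "(p - n) / d \<le> (p' - n') / d' \<longleftrightarrow> p * d' + n' * d \<le> p' * d + n * d'"
    and "(p - n) / d < (p' - n') / d' \<longleftrightarrow> p * d' + n' * d < p' * d + n * d'"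
  using assms by (simp_all add: pos_divide_le_eq pos_divide_less_eq field_simps)

section \<open>Evaluation of codes of rationals and approximations of reals\<close>

context embedded_model
begin

text \<open>Total on the numbers: the code stores the denominator less one, so every number denotes
  a fraction with positive denominator.\<close>

definition val :: "'a \<Rightarrow> 'k" where
  "val q = (\<iota> (first_el \<bullet> (first_el \<bullet> q)) - \<iota> (second_el \<bullet> (first_el \<bullet> q))) / (\<iota> (second_el \<bullet> q) + 1)"

definition "radd a b = tval dflt ratadd_tm \<bullet> a \<bullet> b"
definition "rminus_el = tval dflt ratminus_tm"
definition "rabs_el = tval dflt ratabs_tm"

lemma val_pr:
  assumes "a \<in> D N" "b \<in> D N" "d \<in> D N" "d \<noteq> zero"
  shows "val (pr (pr a b) (pd d)) = (\<iota> a - \<iota> b) / \<iota> d"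
  using assms by (simp add: val_def \<iota>_pd)

lemma den_pos [simp]: "a \<in> D N \<Longrightarrow> 0 < \<iota> a + 1"
  using \<iota>_nonneg[of a] by linarith

lemma den_nonzero [simp]: "a \<in> D N \<Longrightarrow> \<iota> a + 1 \<noteq> 0"
  using den_pos[of a] by linarith

lemma ti_suc_nonzero [simp]:
  assumes "a \<in> D N" "b \<in> D N"
  shows "ti (suc \<bullet> a) (suc \<bullet> b) \<noteq> zero"
  using ti_eq_zero[of "suc \<bullet> a" "suc \<bullet> b"] assms by fastforce

lemma tval_mk_rat [simp]:
  "tval e (mk_rat s t u) = pr (pr (tval e s) (tval e t)) (pd (tval e u))"
  by (auto simp: mk_rat_def)

lemma tval_pos_neg_den [simp]:
  "tval e (pos q) = first_el \<bullet> (first_el \<bullet> tval e q)"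
  "tval e (neg q) = second_el \<bullet> (first_el \<bullet> tval e q)"
  "tval e (den q) = suc \<bullet> (second_el \<bullet> tval e q)"
  by (auto simp: pos_def neg_def den_def)

lemma tval_ratadd [simp]:
  "tval e (ratadd s t) = radd (tval e s) (tval e t)"
  using tval_closed[of ratadd_tm e] by (auto simp: ratadd_def closed_ratadd radd_def)

lemma rat_el_in [simp]: "rminus_el \<in> D T1" "rabs_el \<in> D T1"
  by (simp_all add: rminus_el_def rabs_el_def)

lemma rat_in [simp]:
  "a \<in> D N \<Longrightarrow> b \<in> D N \<Longrightarrow> radd a b \<in> D N"
  "a \<in> D N \<Longrightarrow> rminus_el \<bullet> a \<in> D N" "a \<in> D N \<Longrightarrow> rabs_el \<bullet> a \<in> D N"
  unfolding radd_def by (auto intro!: ap_in[of _ N] simp: closed_ratadd)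

lemma tval_rat_el [simp]: "tval e ratminus_tm = rminus_el" "tval e ratabs_tm = rabs_el"
  unfolding rminus_el_def rabs_el_def by (rule tval_closed, simp)+

lemma val_radd [simp]: "a \<in> D N \<Longrightarrow> b \<in> D N \<Longrightarrow> val (radd a b) = val a + val b"
proof -
  assume a: "a \<in> D N" and b: "b \<in> D N"
  have *: "(p * d' + p' * d - (n * d' + n' * d)) / (d * d') = (p - n) / d + (p' - n') / d'"
    if "d \<noteq> 0" "d' \<noteq> 0" for p n d p' n' d' :: 'k
    using that by (simp add: field_simps)
  show ?thesis
    unfolding radd_def using a b
    by (simp add: ratadd_tm_def val_pr * del: ti_rec ti_suc_left) (simp add: val_def)
qed

lemma val_rminus [simp]: "a \<in> D N \<Longrightarrow> val (rminus_el \<bullet> a) = - val a"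
  unfolding rminus_el_def
  by (simp add: ratminus_tm_def val_pr del: tval_rat_el)
    (simp add: val_def minus_divide_left)

lemma val_rabs [simp]: "a \<in> D N \<Longrightarrow> val (rabs_el \<bullet> a) = \<bar>val a\<bar>"
proof -
  assume a: "a \<in> D N"
  show ?thesis
    unfolding rabs_el_def using a
    by (simp add: ratabs_tm_def val_pr del: tval_rat_el)
      (auto simp: val_def abs_if divide_less_0_iff not_less minus_divide_left)
qed

lemma tval_ratdist [simp]:
  "tval e (ratdist s t) = rabs_el \<bullet> radd (tval e s) (rminus_el \<bullet> tval e t)"
  by (auto simp: ratdist_def)

lemma sat_rat [simp]:
  assumes "valid e" "wt s" "wt t" "ty_of s = N" "ty_of t = N"
  shows "sat e (s \<^bold>\<le>\<^sub>Q t) \<longleftrightarrow> val (tval e s) \<le> val (tval e t)"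
    and "sat e (s \<^bold><\<^sub>Q t) \<longleftrightarrow> val (tval e s) < val (tval e t)"
  using assms by (simp_all add: ratle_def ratless_def val_def diff_divide_le_iff del: ti_rec)

lemma val_eps [simp]:
  "tval e t \<in> D N \<Longrightarrow> val (tval e (eps t)) = h (tval e t)"
  "tval e t \<in> D N \<Longrightarrow> val (tval e (eps2 t)) = 2 * h (tval e t)"
  by (simp_all add: eps_def eps2_def val_pr h_def)

lemma val_zero_one [simp]:
  "val (pr (pr zero zero) zero) = 0" "val (pr (pr (suc \<bullet> zero) zero) zero) = 1"
  by (simp_all add: val_def)

subsection \<open>Real numbers\<close>

text \<open>The relations are stated for field-valued sequences. Thus a real can be compared with a
  sequence such as midpoint minus radius without a term for the latter.\<close>

definition cauchy :: "('a \<Rightarrow> 'k) \<Rightarrow> bool" where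
  "cauchy u \<longleftrightarrow> (\<forall>n\<in>D N. \<forall>i\<in>D N. \<bar>u n - u (pl n i)\<bar> < h n)"

definition req :: "('a \<Rightarrow> 'k) \<Rightarrow> ('a \<Rightarrow> 'k) \<Rightarrow> bool" where
  "req u v \<longleftrightarrow> (\<forall>n\<in>D N. \<bar>u n - v n\<bar> \<le> 2 * h n)"

definition rle :: "('a \<Rightarrow> 'k) \<Rightarrow> ('a \<Rightarrow> 'k) \<Rightarrow> bool" where
  "rle u v \<longleftrightarrow> (\<forall>n\<in>D N. u n \<le> v n + 2 * h n)"

definition rless :: "('a \<Rightarrow> 'k) \<Rightarrow> ('a \<Rightarrow> 'k) \<Rightarrow> bool" where
  "rless u v \<longleftrightarrow> (\<exists>n\<in>D N. u n + 2 * h n < v n)"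

definition seq :: "'a \<Rightarrow> 'a \<Rightarrow> 'k" where
  "seq x n = val (x \<bullet> n)"

lemma cauchyD: "cauchy u \<Longrightarrow> m \<in> D N \<Longrightarrow> n \<in> D N \<Longrightarrow> \<iota> m \<le> \<iota> n \<Longrightarrow> \<bar>u m - u n\<bar> < h m"
  using \<iota>_le_pl[of m n] unfolding cauchy_def by (metis arith_in(2))

lemma req_sym: "req u v \<Longrightarrow> req v u"
  by (simp add: req_def abs_minus_commute)

text \<open>At a late index \<open>n\<close> the two equalities cost \<open>4 * h n\<close>, which
  vanishes; the rates of convergence of the outer sequences bring the estimate back to the index
  \<open>m\<close>.\<close>

lemma req_trans:
  assumes "cauchy u" "cauchy w" "req u v" "req v w"
  shows "req u w"
  unfolding req_def
proof
  fix m assume m: "m \<in> D N"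
  show "\<bar>u m - w m\<bar> \<le> 2 * h m"
  proof (rule le_by_h[OF m])
    fix n assume n: "n \<in> D N" "\<iota> m \<le> \<iota> n"
    have "\<bar>u m - u n\<bar> < h m" "\<bar>w m - w n\<bar> < h m" "\<bar>u n - v n\<bar> \<le> 2 * h n" "\<bar>v n - w n\<bar> \<le> 2 * h n"
      using assms cauchyD m n unfolding req_def by blast+
    then show "\<bar>u m - w m\<bar> \<le> 2 * h m + 4 * h n" by linarith
  qed
qed

context
  fixes e :: "var \<Rightarrow> 'a"
  assumes e: "valid e"
begin

lemma sat_is_real [simp]:
  "wt x \<Longrightarrow> ty_of x = T1 \<Longrightarrow> sat e (is_real x) \<longleftrightarrow> cauchy (seq (tval e x))"
  using e by (simp add: is_real_def Let_def cauchy_def seq_def T1_in)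

lemma sat_realeq [simp]:
  "wt x \<Longrightarrow> ty_of x = T1 \<Longrightarrow> wt y \<Longrightarrow> ty_of y = T1 \<Longrightarrow>
   sat e (x \<^bold>=\<^sub>R y) \<longleftrightarrow> req (seq (tval e x)) (seq (tval e y))"
  using e by (simp add: realeq_def Let_def req_def seq_def T1_in)

lemma sat_realle [simp]:
  "wt x \<Longrightarrow> ty_of x = T1 \<Longrightarrow> wt y \<Longrightarrow> ty_of y = T1 \<Longrightarrow>
   sat e (x \<^bold>\<le>\<^sub>R y) \<longleftrightarrow> rle (seq (tval e x)) (seq (tval e y))"
  using e by (simp add: realle_def Let_def rle_def seq_def T1_in)

lemma sat_realless [simp]:
  "wt x \<Longrightarrow> ty_of x = T1 \<Longrightarrow> wt y \<Longrightarrow> ty_of y = T1 \<Longrightarrow>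
   sat e (x \<^bold><\<^sub>R y) \<longleftrightarrow> rless (seq (tval e x)) (seq (tval e y))"
  using e by (simp add: realless_def Let_def rless_def seq_def T1_in)

lemma seq_real_of_rat:
  "wt q \<Longrightarrow> ty_of q = N \<Longrightarrow> n \<in> D N \<Longrightarrow> seq (tval e (real_of_rat q)) n = val (tval e q)"
  using e by (simp add: real_of_rat_def seq_def)

lemma seq_realdist:
  "wt x \<Longrightarrow> ty_of x = T1 \<Longrightarrow> wt y \<Longrightarrow> ty_of y = T1 \<Longrightarrow> n \<in> D N \<Longrightarrow>
   seq (tval e (realdist x y)) n = \<bar>seq (tval e x) (suc \<bullet> n) - seq (tval e y) (suc \<bullet> n)\<bar>"
  using e by (simp add: realdist_def Let_def seq_def T1_in)

end

end


section \<open>The covering\<close>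

abbreviation "Av \<equiv> (0, T2) :: var"
abbreviation "Yv \<equiv> (1, T2) :: var"
abbreviation "pv \<equiv> (2, T2) :: var"
abbreviation "Kv \<equiv> (0, N) :: var"
abbreviation "nv \<equiv> (1, N) :: var"
abbreviation "bv \<equiv> (0, T1) :: var"
abbreviation "cv \<equiv> (1, T1) :: var"

text \<open>The comparison \<open>ratle\<close> as a number that is zero exactly when it holds, for
  use inside terms.\<close>

definition ratle_tm :: "tm \<Rightarrow> tm \<Rightarrow> tm" where
  "ratle_tm q r = (pos q \<^bold>* den r \<^bold>+ neg r \<^bold>* den q) \<^bold>- (pos r \<^bold>* den q \<^bold>+ neg q \<^bold>* den r)"

definition half :: "tm \<Rightarrow> tm" where
  "half q = mk_rat (pos q) (neg q) (Succ \<cdot> one \<^bold>* den q)"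

text \<open>Averaging does not enlarge the error of approximation, so unlike in
  \<open>realdist\<close> the index is not shifted.\<close>

definition mid_tm :: tm where
  "mid_tm = (\<^bold>\<lambda>nv. half (ratadd (Var bv \<cdot> Var nv) (Var cv \<cdot> Var nv)))"

definition radius_tm :: "tm \<Rightarrow> tm" where
  "radius_tm x = eps (Succ \<cdot> (Succ \<cdot> (Var Kv \<^bold>+ Var Yv \<cdot> x)))"

text \<open>Subtracting from \<open>one\<close> reverses the comparison: a zero occurs exactly at an
  index that refutes the equality of the left end and midpoint minus radius. The search for a zero
  is what \<open>(\<exists>\<^sup>2)\<close> decides.\<close>

definition test_tm :: tm where
  "test_tm = (\<^bold>\<lambda>nv. one \<^bold>- ratle_tm
     (ratdist (Var bv \<cdot> Var nv) (ratadd (mid_tm \<cdot> Var nv) (ratminus_tm \<cdot> radius_tm mid_tm))) (eps2 (Var nv)))"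

definition intervals_tm :: tm where
  "intervals_tm = (\<^bold>\<lambda>bv. \<^bold>\<lambda>cv. Var Av \<cdot> mid_tm \<^bold>* (Var pv \<cdot> test_tm))"

text \<open>The factor \<open>A\<close> makes the index respect equality of reals everywhere:
  \<open>Y\<close> does so only inside the unit interval, and outside \<open>A\<close> the product
  is zero.\<close>

definition index_tm :: tm where
  "index_tm = (\<^bold>\<lambda>bv. \<^bold>\<lambda>cv. Var Av \<cdot> mid_tm \<^bold>* (Var Yv \<cdot> mid_tm))"

definition lengths_tm :: tm where
  "lengths_tm = (\<^bold>\<lambda>nv. real_of_rat (eps (Var Kv \<^bold>+ Succ \<cdot> Var nv)))"

text \<open>The radius depends on the real but not on the index of approximation, so the shifted
  sequence converges at the same rate.\<close>

definition left_tm :: tm where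
  "left_tm = (\<^bold>\<lambda>nv. ratadd (Var bv \<cdot> Var nv) (ratminus_tm \<cdot> radius_tm (Var bv)))"

definition right_tm :: tm where
  "right_tm = (\<^bold>\<lambda>nv. ratadd (Var bv \<cdot> Var nv) (radius_tm (Var bv)))"

lemma abs_mid_diff:
  fixes x y :: "'k :: linordered_field"
  shows "\<bar>x - x'\<bar> < e \<Longrightarrow> \<bar>y - y'\<bar> < e \<Longrightarrow> \<bar>(x + y) / 2 - (x' + y') / 2\<bar> < e"
    and "\<bar>x - x'\<bar> \<le> e \<Longrightarrow> \<bar>y - y'\<bar> \<le> e \<Longrightarrow> \<bar>(x + y) / 2 - (x' + y') / 2\<bar> \<le> e"
  by (simp_all add: abs_less_iff abs_le_iff field_simps)

lemma abs_mid_ends: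
  fixes x y :: "'k :: linordered_field"
  shows "\<bar>y - ((x + y) / 2 + r)\<bar> = \<bar>x - ((x + y) / 2 - r)\<bar>"
    and "0 \<le> r \<Longrightarrow> \<bar>x - ((x + y) / 2 - r)\<bar> \<le> e \<Longrightarrow> \<bar>x - y\<bar> \<le> 2 * r + 2 * e"
  by (simp add: abs_if field_simps, auto simp: abs_le_iff field_simps)

context embedded_model
begin

abbreviation one_el ("\<one>") where "\<one> \<equiv> suc \<bullet> zero"

definition reals :: "'a set" where
  "reals = {x \<in> D T1. cauchy (seq x)}"

definition unit :: "'a \<Rightarrow> bool" where
  "unit x \<longleftrightarrow> (\<forall>n\<in>D N. 0 \<le> seq x n + 2 * h n) \<and> (\<forall>n\<in>D N. seq x n \<le> 1 + 2 * h n)"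

lemma ratle_tm_simps [simp]:
  "tvars (ratle_tm q r) = tvars q \<union> tvars r"
  "wt (ratle_tm q r) \<longleftrightarrow> wt q \<and> wt r \<and> ty_of q = N \<and> ty_of r = N" "ty_of (ratle_tm q r) = N"
  by (auto simp: ratle_tm_def)

lemma tval_ratle_tm:
  "valid e \<Longrightarrow> wt q \<Longrightarrow> wt r \<Longrightarrow> ty_of q = N \<Longrightarrow> ty_of r = N \<Longrightarrow>
   tval e (ratle_tm q r) = zero \<longleftrightarrow> val (tval e q) \<le> val (tval e r)"
  using sat_rat(1)[of e q r] by (simp only: ratle_def leq_def ratle_tm_def sat.simps tval.simps)

lemma half_simps [simp]:
  "tvars (half q) = tvars q" "wt (half q) \<longleftrightarrow> wt q \<and> ty_of q = N" "ty_of (half q) = N"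
  by (auto simp: half_def)

lemma val_half [simp]:
  assumes "valid e" "wt q" "ty_of q = N"
  shows "val (tval e (half q)) = val (tval e q) / 2"
proof -
  let ?s = "second_el \<bullet> tval e q"
  have "?s \<in> D N" using assms by simp
  then have "\<iota> (ti (suc \<bullet> \<one>) (suc \<bullet> ?s)) = (\<iota> ?s + 1) * 2" by (subst \<iota>_ti) simp_all
  moreover have "val (tval e (half q)) = (\<iota> (first_el \<bullet> (first_el \<bullet> tval e q)) -
      \<iota> (second_el \<bullet> (first_el \<bullet> tval e q))) / \<iota> (ti (suc \<bullet> \<one>) (suc \<bullet> ?s))"
    unfolding half_def using assms by (simp add: val_pr del: ti_suc_left ti_rec \<iota>_ti)
  ultimately show ?thesis by (simp only: val_def divide_divide_eq_left)
qed

lemma mid_simps [simp]: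
  "tvars mid_tm = {bv, cv}" "wt mid_tm" "ty_of mid_tm = T1"
  by (auto simp: mid_tm_def)

lemma radius_simps [simp]:
  "tvars (radius_tm x) = {Kv, Yv} \<union> tvars x"
  "wt (radius_tm x) \<longleftrightarrow> wt x \<and> ty_of x = T1" "ty_of (radius_tm x) = N"
  by (auto simp: radius_tm_def)

lemma test_simps [simp]: "tvars test_tm = {bv, cv, Kv, Yv}" "wt test_tm" "ty_of test_tm = T1"
  by (auto simp: test_tm_def)

lemma covering_simps [simp]:
  "wt intervals_tm" "ty_of intervals_tm = T11" "wt index_tm" "ty_of index_tm = T11"
  "wt lengths_tm" "ty_of lengths_tm = N \<rightarrow>\<^sub>t T1" "wt left_tm" "ty_of left_tm = T1"
  "wt right_tm" "ty_of right_tm = T1"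
  by (simp_all add: intervals_tm_def index_tm_def lengths_tm_def left_tm_def right_tm_def)

lemma le_one_cases: "a \<in> D N \<Longrightarrow> \<iota> a \<le> 1 \<Longrightarrow> a = zero \<or> a = \<one>"
proof (rule disjCI)
  assume a: "a \<in> D N" "\<iota> a \<le> 1" and "a \<noteq> \<one>"
  then have "\<iota> a < 1" using \<iota>_eq[of a \<one>] by simp
  then have "\<not> 0 < \<iota> a" using \<iota>_less_suc[of zero a] a by simp
  then show "a = zero" using a \<iota>_nonneg[of a] \<iota>_eq_0[of a] by fastforce
qed

end

section \<open>Verification of the cover\<close>

locale covering = embedded_model +
  fixes A Y p K
  assumes A_in: "A \<in> D T2" and Y_in: "Y \<in> D T2" and p_in: "p \<in> D T2" and K_in [simp]: "K \<in> D N"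
    and A_le: "x \<in> reals \<Longrightarrow> \<iota> (A \<bullet> x) \<le> 1"
    and A_cong: "x \<in> reals \<Longrightarrow> y \<in> reals \<Longrightarrow> req (seq x) (seq y) \<Longrightarrow> A \<bullet> x = A \<bullet> y"
    and A_unit: "x \<in> reals \<Longrightarrow> A \<bullet> x = \<one> \<Longrightarrow> unit x"
    and Y_cong: "x \<in> reals \<Longrightarrow> y \<in> reals \<Longrightarrow> unit x \<Longrightarrow> unit y \<Longrightarrow> req (seq x) (seq y) \<Longrightarrow> Y \<bullet> x = Y \<bullet> y"
    and Y_inj: "x \<in> reals \<Longrightarrow> y \<in> reals \<Longrightarrow> A \<bullet> x = \<one> \<Longrightarrow> A \<bullet> y = \<one> \<Longrightarrow> Y \<bullet> x = Y \<bullet> y \<Longrightarrow>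
      req (seq x) (seq y)"
    and p_le: "f \<in> D T1 \<Longrightarrow> \<iota> (p \<bullet> f) \<le> 1"
    and p_zero: "f \<in> D T1 \<Longrightarrow> p \<bullet> f = zero \<longleftrightarrow> (\<exists>n\<in>D N. f \<bullet> n = zero)"
begin

definition env :: "var \<Rightarrow> 'a" where
  "env = dflt(Av := A, Yv := Y, pv := p, Kv := K)"

lemma env [simp]: "valid env" "env Av = A" "env Yv = Y" "env pv = p" "env Kv = K"
  "env (Suc 0, T2) = Y"
  using A_in Y_in p_in by (simp_all add: env_def)

definition "mid b c = tval (env(bv := b, cv := c)) mid_tm"
definition "test b c = tval (env(bv := b, cv := c)) test_tm"
definition "intervals = tval env intervals_tm"
definition "index = tval env index_tm"
definition "lengths = tval env lengths_tm"
definition "radius x = h (suc \<bullet> (suc \<bullet> pl K (Y \<bullet> x)))"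
definition "left a = tval (env(bv := a)) left_tm"
definition "right a = tval (env(bv := a)) right_tm"

lemma reals_D: "x \<in> reals \<Longrightarrow> x \<in> D T1"
  by (simp add: reals_def)

lemma in_simps [simp]:
  "b \<in> D T1 \<Longrightarrow> c \<in> D T1 \<Longrightarrow> mid b c \<in> D T1"
  "b \<in> D T1 \<Longrightarrow> c \<in> D T1 \<Longrightarrow> test b c \<in> D T1"
  "intervals \<in> D T11" "index \<in> D T11" "lengths \<in> D (N \<rightarrow>\<^sub>t T1)"
  "b \<in> D T1 \<Longrightarrow> left b \<in> D T1" "b \<in> D T1 \<Longrightarrow> right b \<in> D T1"
  "x \<in> D T1 \<Longrightarrow> A \<bullet> x \<in> D N" "x \<in> D T1 \<Longrightarrow> Y \<bullet> x \<in> D N" "x \<in> D T1 \<Longrightarrow> p \<bullet> x \<in> D N"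
  "x \<in> D T1 \<Longrightarrow> n \<in> D N \<Longrightarrow> x \<bullet> n \<in> D N"
  unfolding mid_def test_def intervals_def index_def lengths_def left_def right_def
  using A_in Y_in p_in by (auto intro: ap_in)

lemma seq_mid:
  assumes "b \<in> D T1" "c \<in> D T1" "n \<in> D N"
  shows "seq (mid b c) n = (seq b n + seq c n) / 2"
  using assms unfolding mid_def seq_def mid_tm_def by simp

lemma val_radius:
  assumes "valid e" "e Kv = K" "e Yv = Y" "wt t" "ty_of t = T1"
  shows "val (tval e (radius_tm t)) = radius (tval e t)"
  using assms tval_in'[of e t T1] by (simp add: radius_tm_def radius_def del: h_suc tval_in')

lemma seq_left:
  assumes "a \<in> D T1" "n \<in> D N"
  shows "seq (left a) n = seq a n - radius a"
  using assms val_radius[of "env(bv := a, nv := n)" "Var bv"]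
  unfolding left_def seq_def left_tm_def by simp

lemma seq_right:
  assumes "a \<in> D T1" "n \<in> D N"
  shows "seq (right a) n = seq a n + radius a"
  using assms val_radius[of "env(bv := a, nv := n)" "Var bv"]
  unfolding right_def seq_def right_tm_def by simp

lemma test_zero:
  assumes "b \<in> D T1" "c \<in> D T1" "n \<in> D N"
  shows "test b c \<bullet> n = zero \<longleftrightarrow>
    \<not> \<bar>seq b n - (seq (mid b c) n - radius (mid b c))\<bar> \<le> 2 * h n"
proof -
  let ?e = "env(bv := b, cv := c, nv := n)"
  have mid: "tval (env(bv := b, (Suc 0, T1) := c)) mid_tm = mid b c" by (simp add: mid_def)
  let ?s = "ratdist (Var bv \<cdot> Var nv) (ratadd (mid_tm \<cdot> Var nv) (ratminus_tm \<cdot> radius_tm mid_tm))"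
  let ?r = "ratle_tm ?s (eps2 (Var nv))"
  have e: "valid ?e" using assms by simp
  have r: "tval ?e (radius_tm mid_tm) \<in> D N" using assms by simp
  have v: "val (tval ?e ?s) = \<bar>seq b n - (seq (mid b c) n - radius (mid b c))\<bar>"
    using assms r val_radius[OF e _ _ mid_simps(2,3)] by (simp add: mid seq_def)
  have "tval ?e ?r = zero \<longleftrightarrow> val (tval ?e ?s) \<le> val (tval ?e (eps2 (Var nv)))"
    using e by (intro tval_ratle_tm) simp_all
  also have "\<dots> \<longleftrightarrow> \<bar>seq b n - (seq (mid b c) n - radius (mid b c))\<bar> \<le> 2 * h n"
    unfolding v using assms by simp
  finally have "tval ?e ?r = zero \<longleftrightarrow> \<bar>seq b n - (seq (mid b c) n - radius (mid b c))\<bar> \<le> 2 * h n" .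
  moreover have "test b c \<bullet> n = mo \<one> (tval ?e ?r)"
    unfolding test_def test_tm_def using assms by simp
  moreover have "mo \<one> (tval ?e ?r) = zero \<longleftrightarrow> tval ?e ?r \<noteq> zero"
  proof -
    have in_N: "tval ?e ?r \<in> D N" using e by simp
    then show ?thesis using mo_eq_zero[of \<one> "tval ?e ?r"] \<iota>_less_suc[of zero "tval ?e ?r"]
        \<iota>_nonneg[OF in_N] \<iota>_eq_0[OF in_N] by (auto simp: order_less_le)
  qed
  ultimately show ?thesis by simp
qed

text \<open>Only the left end is compared with the midpoint; the right end then fits by symmetry.\<close>

definition "fits b c \<longleftrightarrow> req (seq b) (\<lambda>n. seq (mid b c) n - radius (mid b c))"

text \<open>\<open>p\<close> takes only the values zero and one, and zero means that some index
  refutes the equality behind \<open>fits\<close>.\<close>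

lemma p_test:
  assumes "b \<in> D T1" "c \<in> D T1"
  shows "p \<bullet> test b c = \<one> \<longleftrightarrow> fits b c"
proof -
  have "p \<bullet> test b c = \<one> \<longleftrightarrow> p \<bullet> test b c \<noteq> zero"
    using le_one_cases[of "p \<bullet> test b c"] p_le[of "test b c"] assms by auto
  also have "\<dots> \<longleftrightarrow> fits b c"
    unfolding fits_def req_def using p_zero[of "test b c"] test_zero[OF assms] assms by auto
  finally show ?thesis .
qed

lemma intervals_eq:
  assumes "b \<in> D T1" "c \<in> D T1"
  shows "intervals \<bullet> b \<bullet> c = ti (A \<bullet> mid b c) (p \<bullet> test b c)"
  unfolding intervals_def intervals_tm_def mid_def test_def using assms by simp

lemma index_eq:
  assumes "b \<in> D T1" "c \<in> D T1"
  shows "index \<bullet> b \<bullet> c = ti (A \<bullet> mid b c) (Y \<bullet> mid b c)"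
  unfolding index_def index_tm_def mid_def using assms by simp

lemma mid_reals:
  assumes "b \<in> reals" "c \<in> reals"
  shows "mid b c \<in> reals"
proof -
  have bc: "b \<in> D T1" "c \<in> D T1" using assms reals_D by auto
  then show ?thesis
    using assms unfolding reals_def cauchy_def by (simp add: seq_mid abs_mid_diff)
qed

lemma mid_cong:
  assumes "b \<in> D T1" "c \<in> D T1" "b' \<in> D T1" "c' \<in> D T1"
    and "req (seq b) (seq b')" "req (seq c) (seq c')"
  shows "req (seq (mid b c)) (seq (mid b' c'))"
  using assms unfolding req_def by (simp add: seq_mid abs_mid_diff)

lemma intervals_one:
  assumes "b \<in> reals" "c \<in> reals"
  shows "intervals \<bullet> b \<bullet> c = \<one> \<longleftrightarrow> A \<bullet> mid b c = \<one> \<and> fits b c"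
    and "\<iota> (intervals \<bullet> b \<bullet> c) \<le> 1"
proof -
  have bc: "b \<in> D T1" "c \<in> D T1" using assms reals_D by auto
  have A: "A \<bullet> mid b c = zero \<or> A \<bullet> mid b c = \<one>"
    using A_le mid_reals[OF assms] le_one_cases bc by simp
  have p: "p \<bullet> test b c = zero \<or> p \<bullet> test b c = \<one>"
    using p_le le_one_cases bc by simp
  show "intervals \<bullet> b \<bullet> c = \<one> \<longleftrightarrow> A \<bullet> mid b c = \<one> \<and> fits b c"
    unfolding p_test[OF bc, symmetric] intervals_eq[OF bc] using A p by auto
  show "\<iota> (intervals \<bullet> b \<bullet> c) \<le> 1"
    unfolding intervals_eq[OF bc] using A p by auto
qed

lemma cauchy_shift: "cauchy u \<Longrightarrow> cauchy (\<lambda>n. u n - x)"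
  by (simp add: cauchy_def)

text \<open>The radius depends on the pair only through the value of \<open>Y\<close> at the
  midpoint. That the two values agree is an assumption, as it can be had only for midpoints in the
  unit interval.\<close>

lemma fits_cong:
  assumes b: "b \<in> reals" "b' \<in> reals" and c: "c \<in> reals" "c' \<in> reals"
    and req: "req (seq b) (seq b')" "req (seq c) (seq c')"
    and Y: "Y \<bullet> mid b c = Y \<bullet> mid b' c'" and fits: "fits b c"
  shows "fits b' c'"
proof -
  have D: "b \<in> D T1" "b' \<in> D T1" "c \<in> D T1" "c' \<in> D T1" using b c reals_D by auto
  let ?u = "\<lambda>n. seq (mid b c) n - radius (mid b c)" and ?v = "\<lambda>n. seq (mid b' c') n - radius (mid b' c')"
  have "cauchy (seq b')" "cauchy ?u" "cauchy ?v"
    using b mid_reals[OF b(1) c(1)] mid_reals[OF b(2) c(2)] cauchy_shift by (auto simp: reals_def)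
  moreover have "req ?u ?v"
    using mid_cong[OF D(1,3,2,4) req] Y by (simp add: req_def radius_def)
  moreover have "req (seq b') (seq b)" using req by (simp add: req_sym)
  ultimately show ?thesis using fits req_trans unfolding fits_def by blast
qed

text \<open>If the midpoint is outside \<open>A\<close>, both products vanish whatever
  \<open>Y\<close> and \<open>p\<close> return; if it is in \<open>A\<close>, it lies in the unit
  interval and \<open>Y\<close> respects equality there.\<close>

lemma intervals_cong:
  assumes b: "b \<in> reals" "b' \<in> reals" and c: "c \<in> reals" "c' \<in> reals"
    and req: "req (seq b) (seq b')" "req (seq c) (seq c')"
  shows "intervals \<bullet> b \<bullet> c = intervals \<bullet> b' \<bullet> c'" "index \<bullet> b \<bullet> c = index \<bullet> b' \<bullet> c'"
proof -
  have D: "b \<in> D T1" "b' \<in> D T1" "c \<in> D T1" "c' \<in> D T1" using b c reals_D by auto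
  have m: "mid b c \<in> reals" "mid b' c' \<in> reals" using b c mid_reals by auto
  have mm: "req (seq (mid b c)) (seq (mid b' c'))" using mid_cong D req by blast
  then have A: "A \<bullet> mid b c = A \<bullet> mid b' c'" using A_cong m by blast
  have A01: "A \<bullet> mid b c = zero \<or> A \<bullet> mid b c = \<one>"
    using A_le m le_one_cases D by simp
  have Y: "Y \<bullet> mid b c = Y \<bullet> mid b' c'" if "A \<bullet> mid b c = \<one>"
    using that A A_unit Y_cong m mm by metis
  show "index \<bullet> b \<bullet> c = index \<bullet> b' \<bullet> c'"
    using A01 Y A D by (auto simp: index_eq)
  have "fits b c \<longleftrightarrow> fits b' c'" if "A \<bullet> mid b c = \<one>"
    using fits_cong[OF b c req Y[OF that]] req_sym
      fits_cong[OF b(2,1) c(2,1) _ _ Y[OF that, symmetric]] req by blast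
  then have "A \<bullet> mid b c = \<one> \<Longrightarrow> p \<bullet> test b c = \<one> \<longleftrightarrow> p \<bullet> test b' c' = \<one>"
    using p_test D by simp
  then have "A \<bullet> mid b c = \<one> \<Longrightarrow> p \<bullet> test b c = p \<bullet> test b' c'"
    using le_one_cases[of "p \<bullet> test b c"] le_one_cases[of "p \<bullet> test b' c'"] p_le D by fastforce
  then show "intervals \<bullet> b \<bullet> c = intervals \<bullet> b' \<bullet> c'"
    using A01 A D by (auto simp: intervals_eq)
qed

lemma fits_right:
  assumes "b \<in> D T1" "c \<in> D T1" "fits b c"
  shows "req (seq c) (\<lambda>n. seq (mid b c) n + radius (mid b c))"
  using assms unfolding fits_def req_def by (simp add: seq_mid abs_mid_ends)

text \<open>Equal indices mean equal values of \<open>Y\<close> at midpoints in \<open>A\<close>.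
  Injectivity then makes the midpoints equal, the radii agree as well, and both ends are determined
  by these data.\<close>

lemma index_inj:
  assumes b: "b \<in> reals" "b' \<in> reals" and c: "c \<in> reals" "c' \<in> reals"
    and one: "intervals \<bullet> b \<bullet> c = \<one>" "intervals \<bullet> b' \<bullet> c' = \<one>"
    and eq: "index \<bullet> b \<bullet> c = index \<bullet> b' \<bullet> c'"
  shows "req (seq b) (seq b') \<and> req (seq c) (seq c')"
proof -
  have D: "b \<in> D T1" "b' \<in> D T1" "c \<in> D T1" "c' \<in> D T1" using b c reals_D by auto
  have m: "mid b c \<in> reals" "mid b' c' \<in> reals" using b c mid_reals by auto
  have A: "A \<bullet> mid b c = \<one>" "A \<bullet> mid b' c' = \<one>" and f: "fits b c" "fits b' c'"
    using one intervals_one b c by auto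
  then have Y: "Y \<bullet> mid b c = Y \<bullet> mid b' c'" using eq D by (simp add: index_eq)
  then have mm: "req (seq (mid b c)) (seq (mid b' c'))" using Y_inj m A by blast
  have r: "radius (mid b c) = radius (mid b' c')" using Y by (simp add: radius_def)
  \<comment> \<open>Treats both ends at once, with \<open>s\<close> minus the radius on the left and
    the radius on the right.\<close>
  have ends: "req u w" if "cauchy u" "cauchy w" "req u (\<lambda>n. seq (mid b c) n + s)"
    "req w (\<lambda>n. seq (mid b' c') n + s)" for u w s
  proof -
    have "cauchy (\<lambda>n. seq (mid b' c') n + s)"
      using m cauchy_shift[of "seq (mid b' c')" "- s"] by (simp add: reals_def)
    moreover have "req (\<lambda>n. seq (mid b c) n + s) (\<lambda>n. seq (mid b' c') n + s)"
      using mm by (simp add: req_def)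
    ultimately show ?thesis using that req_trans req_sym by metis
  qed
  have "req (seq b) (seq b')"
    using ends[of "seq b" "seq b'" "- radius (mid b c)"] b f r by (simp add: fits_def reals_def)
  moreover have "req (seq c) (seq c')"
    using ends[of "seq c" "seq c'" "radius (mid b c)"] c r
      fits_right[OF D(1,3) f(1)] fits_right[OF D(2,4) f(2)] by (simp add: reals_def)
  ultimately show ?thesis by blast
qed

lemma intervals_cover:
  assumes a: "a \<in> reals" "A \<bullet> a = \<one>"
  shows "\<exists>b\<in>reals. \<exists>c\<in>reals. intervals \<bullet> b \<bullet> c = \<one> \<and> rless (seq b) (seq a) \<and> rless (seq a) (seq c)"
proof -
  have D: "a \<in> D T1" using a reals_D by simp
  have lr: "left a \<in> D T1" "right a \<in> D T1" using D by auto
  have l: "left a \<in> reals" and r: "right a \<in> reals"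
    using a D by (auto simp: reals_def cauchy_def seq_left seq_right)
  let ?m = "mid (left a) (right a)"
  have m: "?m \<in> reals" using l r by (rule mid_reals)
  have s: "seq ?m n = seq a n" if "n \<in> D N" for n
    using that D lr by (simp add: seq_mid seq_left seq_right)
  \<comment> \<open>The midpoint has the same approximations as \<open>a\<close> but possibly other
    codes for them, so \<open>A\<close> and \<open>Y\<close> are transferred by their congruence
    laws and not by identity.\<close>
  then have req: "req (seq ?m) (seq a)" by (simp add: req_def)
  then have A: "A \<bullet> ?m = \<one>" using A_cong m a by metis
  then have "Y \<bullet> ?m = Y \<bullet> a" using Y_cong A_unit m a req by blast
  then have "fits (left a) (right a)"
    using s D by (simp add: fits_def req_def seq_left radius_def)
  then have "intervals \<bullet> left a \<bullet> right a = \<one>" using A intervals_one l r by simp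
  \<comment> \<open>Two halvings beyond the radius make \<open>2 * h ?n\<close> half of it; one
    halving would give equality, where \<open>rless\<close> is strict.\<close>
  moreover let ?n = "suc \<bullet> (suc \<bullet> (suc \<bullet> (suc \<bullet> pl K (Y \<bullet> a))))"
  have n: "?n \<in> D N" "2 * h ?n < radius a"
    using D by (simp_all add: radius_def)
  have "seq (left a) ?n + 2 * h ?n < seq a ?n" "seq a ?n + 2 * h ?n < seq (right a) ?n"
    using n seq_left[OF D n(1)] seq_right[OF D n(1)] by linarith+
  then have "rless (seq (left a)) (seq a)" "rless (seq a) (seq (right a))"
    unfolding rless_def using n(1) by blast+
  ultimately show ?thesis using l r by blast
qed

lemma seq_lengths:
  assumes "n \<in> D N" "k \<in> D N"
  shows "seq (lengths \<bullet> n) k = h K * h n / 2"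
  using assms unfolding lengths_def lengths_tm_def seq_def by (simp add: real_of_rat_def h_pl)

lemma intervals_length:
  assumes bc: "b \<in> reals" "c \<in> reals" and one: "intervals \<bullet> b \<bullet> c = \<one>" and n: "n \<in> D N"
  shows "\<bar>seq b (suc \<bullet> n) - seq c (suc \<bullet> n)\<bar> \<le> seq (lengths \<bullet> (index \<bullet> b \<bullet> c)) n + 2 * h n"
proof -
  have D: "b \<in> D T1" "c \<in> D T1" using bc reals_D by auto
  have A: "A \<bullet> mid b c = \<one>" and f: "fits b c" using one intervals_one bc by auto
  have i: "index \<bullet> b \<bullet> c = Y \<bullet> mid b c" using A D by (simp add: index_eq)
  have "seq (lengths \<bullet> (index \<bullet> b \<bullet> c)) n = 2 * radius (mid b c)"
    unfolding i using D n by (simp add: seq_lengths radius_def h_pl)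
  \<comment> \<open>\<open>realdist\<close> reads index \<open>suc \<bullet> n\<close>, where
    \<open>fits\<close> allows the error \<open>h n\<close>; passing to the length doubles it to
    exactly the tolerance of \<open>rle\<close>.\<close>
  moreover have "\<bar>seq b (suc \<bullet> n) - (seq (mid b c) (suc \<bullet> n) - radius (mid b c))\<bar> \<le> 2 * h (suc \<bullet> n)"
    using f n unfolding fits_def req_def by (meson suc_in')
  moreover have "0 \<le> radius (mid b c)" using D by (simp add: radius_def)
  ultimately show ?thesis using D n abs_mid_ends(2)[of _ _ _ "h n"] by (simp add: seq_mid)
qed

end


section \<open>Partial sums of the lengths\<close>

context embedded_model
begin

text \<open>The sum of the first \<open>j\<close> terms plus the remaining tail is constant, which
  induction can handle without limits. A rational has many codes, so equality of values is expressed
  in the formula by two inequalities.\<close>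

lemma geometric_sum:
  assumes F: "F \<in> D (N \<rightarrow>\<^sub>t N \<rightarrow>\<^sub>t N)" and K: "K \<in> D N" and j: "j \<in> D N"
    and step: "\<And>r i. r \<in> D N \<Longrightarrow> i \<in> D N \<Longrightarrow> val (F \<bullet> r \<bullet> i) = val r + h K * h i / 2"
  shows "val (rc \<bullet> j \<bullet> pr (pr zero zero) zero \<bullet> F) + h K * h j = h K"
proof (rule induction_nx[OF j, of "dflt((0, N \<rightarrow>\<^sub>t N \<rightarrow>\<^sub>t N) := F, ny := K)"
    "(ratadd (Rc \<cdot> Var nx \<cdot> zeroQ \<cdot> Var (0, N \<rightarrow>\<^sub>t N \<rightarrow>\<^sub>t N)) (eps (Var ny \<^bold>+ Var nx)) \<^bold>\<le>\<^sub>Q eps (Var ny)) \<^bold>\<and>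
     (eps (Var ny) \<^bold>\<le>\<^sub>Q ratadd (Rc \<cdot> Var nx \<cdot> zeroQ \<cdot> Var (0, N \<rightarrow>\<^sub>t N \<rightarrow>\<^sub>t N)) (eps (Var ny \<^bold>+ Var nx)))"])
  fix n assume "n \<in> D N" "val (rc \<bullet> n \<bullet> pr (pr zero zero) zero \<bullet> F) + h K * h n = h K"
  then show "val (rc \<bullet> (suc \<bullet> n) \<bullet> pr (pr zero zero) zero \<bullet> F) + h K * h (suc \<bullet> n) = h K"
    using F step[of "rc \<bullet> n \<bullet> pr (pr zero zero) zero \<bullet> F" n] by (simp add: field_simps)
qed (use F K in \<open>auto simp: h_pl\<close>)

text \<open>The shift of the index by the number of summands has no effect here, because every
  summand is a constant sequence of approximations.\<close>

lemma seq_partial_sum: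
  assumes e: "valid e" and s: "wt s" "ty_of s = N \<rightarrow>\<^sub>t T1" and m: "wt m" "ty_of m = N"
    and K: "K \<in> D N" and k: "k \<in> D N"
    and geometric: "\<And>i k. i \<in> D N \<Longrightarrow> k \<in> D N \<Longrightarrow> seq (tval e s \<bullet> i) k = h K * h i / 2"
  shows "seq (tval e (partial_sum s m)) k + h K * h (tval e m) = h K"
proof -
  let ?k = "newv 0 N [s, m]" and ?r = "newv 1 N [s, m]" and ?i = "newv 2 N [s, m]"
  let ?t = "\<^bold>\<lambda>?r. \<^bold>\<lambda>?i. ratadd (Var ?r) (s \<cdot> Var ?i \<cdot> (Var ?k \<^bold>+ m))"
  let ?F = "tval (e(?k := k)) ?t"
  have F: "?F \<in> D (N \<rightarrow>\<^sub>t N \<rightarrow>\<^sub>t N)" using e k s m by simp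
  have "tval e s \<in> D (N \<rightarrow>\<^sub>t T1)" "tval e m \<in> D N" using e s m by simp_all
  then have "tval e s \<bullet> i \<bullet> pl k (tval e m) \<in> D N" if "i \<in> D N" for i
    using that k by (auto intro: ap_in[of _ N])
  then have "val (?F \<bullet> r \<bullet> i) = val r + h K * h i / 2" if "r \<in> D N" "i \<in> D N" for r i
    using that e s m k geometric[of i "pl k (tval e m)"] by (simp add: seq_def)
  from geometric_sum[OF F K _ this, of "tval e m"] show ?thesis
    using e s m k by (simp add: seq_def partial_sum_def Let_def)
qed

section \<open>Meaning of the defined predicates in a model\<close>

lemma sat_is_set:
  "valid e \<Longrightarrow> wt F \<Longrightarrow> ty_of F = T2 \<Longrightarrow> sat e (is_set F) \<longleftrightarrow>
   (\<forall>x\<in>reals. \<iota> (tval e F \<bullet> x) \<le> 1) \<and>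
   (\<forall>x\<in>reals. \<forall>y\<in>reals. req (seq x) (seq y) \<longrightarrow> tval e F \<bullet> x = tval e F \<bullet> y)"
  by (simp add: is_set_def Let_def reals_def) blast

lemma sat_in_unit: "valid e \<Longrightarrow> wt x \<Longrightarrow> ty_of x = T1 \<Longrightarrow> sat e (in_unit x) \<longleftrightarrow> unit (tval e x)"
  by (simp add: in_unit_def unit_def rle_def seq_real_of_rat)

lemma sat_subset_unit:
  "valid e \<Longrightarrow> wt F \<Longrightarrow> ty_of F = T2 \<Longrightarrow> sat e (subset_unit F) \<longleftrightarrow>
   (\<forall>x\<in>reals. tval e F \<bullet> x = \<one> \<longrightarrow> unit x)"
  by (simp add: subset_unit_def Let_def reals_def mem_def sat_in_unit) blast

lemma sat_unit_fun:
  "valid e \<Longrightarrow> wt F \<Longrightarrow> ty_of F = T2 \<Longrightarrow> sat e (unit_fun F) \<longleftrightarrow>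
   (\<forall>x\<in>reals. \<forall>y\<in>reals. unit x \<longrightarrow> unit y \<longrightarrow> req (seq x) (seq y) \<longrightarrow> tval e F \<bullet> x = tval e F \<bullet> y)"
  by (simp add: unit_fun_def Let_def reals_def sat_in_unit) blast

lemma sat_inj_on_set:
  "valid e \<Longrightarrow> wt Y \<Longrightarrow> ty_of Y = T2 \<Longrightarrow> wt A \<Longrightarrow> ty_of A = T2 \<Longrightarrow> sat e (inj_on_set Y A) \<longleftrightarrow>
   (\<forall>x\<in>reals. \<forall>y\<in>reals. tval e A \<bullet> x = \<one> \<longrightarrow> tval e A \<bullet> y = \<one> \<longrightarrow>
      tval e Y \<bullet> x = tval e Y \<bullet> y \<longrightarrow> req (seq x) (seq y))"
  by (simp add: inj_on_set_def Let_def reals_def mem_def) blast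

lemma sat_fun2:
  "valid e \<Longrightarrow> wt F \<Longrightarrow> ty_of F = T11 \<Longrightarrow> sat e (fun2 F) \<longleftrightarrow>
   (\<forall>b\<in>reals. \<forall>c\<in>reals. \<forall>b'\<in>reals. \<forall>c'\<in>reals. req (seq b) (seq b') \<longrightarrow> req (seq c) (seq c') \<longrightarrow>
      tval e F \<bullet> b \<bullet> c = tval e F \<bullet> b' \<bullet> c')"
  by (simp add: fun2_def Let_def reals_def) blast

lemma sat_is_set2:
  "valid e \<Longrightarrow> wt F \<Longrightarrow> ty_of F = T11 \<Longrightarrow> sat e (is_set2 F) \<longleftrightarrow>
   (\<forall>b\<in>reals. \<forall>c\<in>reals. \<iota> (tval e F \<bullet> b \<bullet> c) \<le> 1) \<and> sat e (fun2 F)"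
  by (simp add: is_set2_def Let_def reals_def) blast

lemma sat_inj_on_set2:
  "valid e \<Longrightarrow> wt Z \<Longrightarrow> ty_of Z = T11 \<Longrightarrow> wt B \<Longrightarrow> ty_of B = T11 \<Longrightarrow> sat e (inj_on_set2 Z B) \<longleftrightarrow>
   (\<forall>b\<in>reals. \<forall>c\<in>reals. \<forall>b'\<in>reals. \<forall>c'\<in>reals. tval e B \<bullet> b \<bullet> c = \<one> \<longrightarrow> tval e B \<bullet> b' \<bullet> c' = \<one> \<longrightarrow>
      tval e Z \<bullet> b \<bullet> c = tval e Z \<bullet> b' \<bullet> c' \<longrightarrow> req (seq b) (seq b') \<and> req (seq c) (seq c'))"
  by (simp add: inj_on_set2_def Let_def reals_def mem2_def) blast

lemma sat_covers:
  "valid e \<Longrightarrow> wt B \<Longrightarrow> ty_of B = T11 \<Longrightarrow> wt A \<Longrightarrow> ty_of A = T2 \<Longrightarrow> sat e (covers B A) \<longleftrightarrow>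
   (\<forall>a\<in>reals. tval e A \<bullet> a = \<one> \<longrightarrow>
      (\<exists>b\<in>reals. \<exists>c\<in>reals. tval e B \<bullet> b \<bullet> c = \<one> \<and> rless (seq b) (seq a) \<and> rless (seq a) (seq c)))"
  by (simp add: covers_def Let_def reals_def mem_def mem2_def) blast

lemma sat_lengths_bounded:
  "valid e \<Longrightarrow> wt B \<Longrightarrow> ty_of B = T11 \<Longrightarrow> wt Z \<Longrightarrow> ty_of Z = T11 \<Longrightarrow> wt l \<Longrightarrow> ty_of l = N \<rightarrow>\<^sub>t T1 \<Longrightarrow>
   sat e (lengths_bounded B Z l) \<longleftrightarrow>
   (\<forall>b\<in>reals. \<forall>c\<in>reals. tval e B \<bullet> b \<bullet> c = \<one> \<longrightarrow>
      (\<forall>n\<in>D N. tval e Z \<bullet> b \<bullet> c = n \<longrightarrow>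
         (\<forall>k\<in>D N. \<bar>seq b (suc \<bullet> k) - seq c (suc \<bullet> k)\<bar> \<le> seq (tval e l \<bullet> n) k + 2 * h k)))"
  by (simp add: lengths_bounded_def Let_def reals_def mem2_def rle_def seq_realdist) blast

lemma sat_nonneg_reals:
  "valid e \<Longrightarrow> wt l \<Longrightarrow> ty_of l = N \<rightarrow>\<^sub>t T1 \<Longrightarrow> sat e (nonneg_reals l) \<longleftrightarrow>
   (\<forall>n\<in>D N. cauchy (seq (tval e l \<bullet> n)) \<and> (\<forall>k\<in>D N. 0 \<le> seq (tval e l \<bullet> n) k + 2 * h k))"
  by (simp add: nonneg_reals_def Let_def rle_def seq_real_of_rat)

lemma sat_series_sums:
  assumes e: "valid e" and l: "wt l" "ty_of l = N \<rightarrow>\<^sub>t T1" and s: "wt s" "ty_of s = T1" and K: "K \<in> D N"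
    and geometric: "\<And>i k. i \<in> D N \<Longrightarrow> k \<in> D N \<Longrightarrow> seq (tval e l \<bullet> i) k = h K * h i / 2"
    and limit: "\<And>k. k \<in> D N \<Longrightarrow> seq (tval e s) k = h K"
  shows "sat e (series_sums l s)"
proof -
  let ?k = "newv 0 N [l, s]" and ?m = "newv 1 N [l, s]" and ?n = "newv 2 N [l, s]"
  let ?u = "realdist (partial_sum l (Var ?n)) s" and ?v = "real_of_rat (eps (Var ?k))"
  \<comment> \<open>The witness for \<open>m\<close> is \<open>k\<close> itself: beyond it the tail
    \<open>h K * h n\<close> is at most \<open>h k\<close>, as \<open>h K\<close> is at most
    1.\<close>
  have rle: "rle (seq (tval (e(?k := k, ?m := k, ?n := n)) ?u)) (seq (tval (e(?k := k, ?m := k, ?n := n)) ?v))"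
    if k: "k \<in> D N" and n: "n \<in> D N" and kn: "\<iota> k \<le> \<iota> n" for k n
    unfolding rle_def
  proof
    fix j assume j: "j \<in> D N"
    let ?f = "e(?k := k, ?m := k, ?n := n)"
    have f: "valid ?f" using e k n by simp
    have lf: "tval ?f l = tval e l" "tval ?f s = tval e s" "tval ?f (Var ?n) = n" by simp_all
    have "seq (tval ?f (partial_sum l (Var ?n))) (suc \<bullet> j) + h K * h n = h K"
      using seq_partial_sum[OF f l, of "Var ?n" K "suc \<bullet> j"] K j geometric unfolding lf by simp
    then have "seq (tval ?f (partial_sum l (Var ?n))) (suc \<bullet> j) - h K = - (h K * h n)"
      by (simp add: algebra_simps)
    then have *: "\<bar>seq (tval ?f (partial_sum l (Var ?n))) (suc \<bullet> j) - h K\<bar> = h K * h n"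
      using K n by (simp only: abs_minus_cancel abs_of_nonneg h_nonneg mult_nonneg_nonneg)
    have "seq (tval ?f ?u) j = \<bar>seq (tval ?f (partial_sum l (Var ?n))) (suc \<bullet> j) - seq (tval ?f s) (suc \<bullet> j)\<bar>"
      using l s j by (intro seq_realdist[OF f]) simp_all
    also have "\<dots> = h K * h n"
      using * limit[of "suc \<bullet> j"] j by (simp only: lf suc_in')
    finally have "seq (tval ?f ?u) j = h K * h n" .
    moreover have "seq (tval ?f ?v) j = h k"
      using seq_real_of_rat[OF f, of "eps (Var ?k)" j] j k by simp
    moreover have "h K * h n \<le> h k"
      using h_antimono[OF k n kn] mult_left_le_one_le[of "h n" "h K"] h_le_1[OF K]
        h_nonneg[OF n] h_nonneg[OF K] by linarith
    ultimately show "seq (tval ?f ?u) j \<le> seq (tval ?f ?v) j + 2 * h j" using h_nonneg[OF j] by linarith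
  qed
  have "sat (e(?k := k, ?m := k, ?n := n)) (Var ?m \<^bold>\<le> Var ?n \<^bold>\<longrightarrow> ?u \<^bold>\<le>\<^sub>R ?v)"
    if "k \<in> D N" "n \<in> D N" for k n
  proof -
    have f: "valid (e(?k := k, ?m := k, ?n := n))" using e that by simp
    have "sat (e(?k := k, ?m := k, ?n := n)) (Var ?m \<^bold>\<le> Var ?n) \<longleftrightarrow> \<iota> k \<le> \<iota> n"
      using f by (subst sat_leq) simp_all
    moreover have "sat (e(?k := k, ?m := k, ?n := n)) (?u \<^bold>\<le>\<^sub>R ?v) \<longleftrightarrow>
        rle (seq (tval (e(?k := k, ?m := k, ?n := n)) ?u)) (seq (tval (e(?k := k, ?m := k, ?n := n)) ?v))"
      using f l s by (intro sat_realle) simp_all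
    ultimately show ?thesis using rle[OF that] by (auto simp only: sat.simps)
  qed
  then show ?thesis
    unfolding series_sums_def Let_def by (simp only: sat.simps sat_all_v snd_newv) blast
qed

lemma sat_series_le:
  assumes e: "valid e" and l: "wt l" "ty_of l = N \<rightarrow>\<^sub>t T1" and d: "wt d" "ty_of d = T1" and K: "K \<in> D N"
    and geometric: "\<And>i k. i \<in> D N \<Longrightarrow> k \<in> D N \<Longrightarrow> seq (tval e l \<bullet> i) k = h K * h i / 2"
    and le: "\<And>k. k \<in> D N \<Longrightarrow> h K \<le> seq (tval e d) k + 2 * h k"
  shows "sat e (series_le l d)"
proof -
  \<comment> \<open>The sum of the series is the rational \<open>2^-K\<close>, taken as a constant
    sequence.\<close>
  define s where "s = tval (dflt(nx := K)) (real_of_rat (eps (Var nx)))"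
  have s: "s \<in> D T1" using K by (simp add: s_def)
  have seq_s: "seq s k = h K" if "k \<in> D N" for k
    using that K seq_real_of_rat[of "dflt(nx := K)" "eps (Var nx)" k] by (simp add: s_def)
  let ?s = "newv 0 T1 [l, d]"
  have "valid (e(?s := s))" "tval (e(?s := s)) l = tval e l" "tval (e(?s := s)) (Var ?s) = s"
    using e s by simp_all
  then have "sat (e(?s := s)) (series_sums l (Var ?s))"
    using l K geometric seq_s by (intro sat_series_sums) simp_all
  moreover have "cauchy (seq s)" "rle (seq s) (seq (tval e d))"
    using seq_s le by (simp_all add: cauchy_def rle_def)
  ultimately show ?thesis
    unfolding series_le_def Let_def using e d s by auto
qed

end

context covering
begin

text \<open>Stated for arbitrary variables of the right sorts, so that the bound names produced by
  \<open>newv\<close> do not matter. Only here is \<open>K\<close> related to the given bound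
  \<open>d\<close>.\<close>

lemma sat_covering:
  assumes e: "valid e"
    and ty: "snd X = T2" "snd d = T1" "snd l = N \<rightarrow>\<^sub>t T1" "snd B = T11" "snd Z = T11"
    and vals: "e X = A" "e l = lengths" "e B = intervals" "e Z = index"
    and d: "e d \<in> reals" "\<And>k. k \<in> D N \<Longrightarrow> h K \<le> seq (e d) k + 2 * h k"
  shows "sat e (nonneg_reals (Var l) \<^bold>\<and> is_set2 (Var B) \<^bold>\<and> fun2 (Var Z) \<^bold>\<and>
    inj_on_set2 (Var Z) (Var B) \<^bold>\<and> covers (Var B) (Var X) \<^bold>\<and>
    lengths_bounded (Var B) (Var Z) (Var l) \<^bold>\<and> series_le (Var l) (Var d))"
proof -
  have "sat e (nonneg_reals (Var l))"
    using e ty vals by (simp add: sat_nonneg_reals cauchy_def seq_lengths)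
  moreover have "sat e (fun2 (Var Z))"
    using e ty vals intervals_cong(2) by (simp add: sat_fun2)
  moreover have "sat e (is_set2 (Var B))"
    using e ty vals intervals_cong(1) intervals_one(2) by (simp add: sat_is_set2 sat_fun2)
  moreover have "sat e (inj_on_set2 (Var Z) (Var B))"
    using e ty vals index_inj by (simp add: sat_inj_on_set2)
  moreover have "sat e (covers (Var B) (Var X))"
    using e ty vals intervals_cover by (simp add: sat_covers)
  moreover have "sat e (lengths_bounded (Var B) (Var Z) (Var l))"
    using e ty vals intervals_length by (simp add: sat_lengths_bounded)
  moreover have "sat e (series_le (Var l) (Var d))"
    using e ty vals d seq_lengths by (intro sat_series_le[where K = K]) simp_all
  ultimately show ?thesis by simp
qed

end

context embedded_model
begin

text \<open>An index \<open>n\<close> that witnesses positivity serves as the exponent itself. The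
  coarser of the two approximations pays for the comparison: \<open>h n\<close> out of
  \<open>u n\<close> for later indices, \<open>h k\<close> out of the tolerance for earlier
  ones.\<close>

lemma ex_power_below:
  assumes d: "cauchy u" and n: "n \<in> D N" "2 * h n < u n" and k: "k \<in> D N"
  shows "h n \<le> u k + 2 * h k"
proof (cases "\<iota> n \<le> \<iota> k")
  case True
  then have "\<bar>u n - u k\<bar> < h n" using cauchyD d n k by blast
  then show ?thesis using n(2) h_nonneg[OF k] by linarith
next
  case False
  then have "\<bar>u k - u n\<bar> < h k" using cauchyD d n k by simp
  then show ?thesis using n(2) h_nonneg[OF k] h_nonneg[OF n(1)] by linarith
qed

lemma sat_countable_sets_weak_measure_zero:
  assumes e: "valid e" and ex: "Exists2 \<in> T"
  shows "sat e countable_sets_weak_measure_zero"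
proof -
  have "sat e Exists2" using axioms ex wff_Exists2 e by blast
  then obtain p where p: "p \<in> D T2" "\<And>f. f \<in> D T1 \<Longrightarrow> \<iota> (p \<bullet> f) \<le> 1"
    "\<And>f. f \<in> D T1 \<Longrightarrow> p \<bullet> f = zero \<longleftrightarrow> (\<exists>n\<in>D N. f \<bullet> n = zero)"
    using e by (simp add: Exists2_def Let_def) blast
  have main: "sat (e(Av := A)) (weak_measure_zero (Var Av))"
    if A: "A \<in> D T2" and A_set: "sat (e(Av := A)) (is_set (Var Av))"
      "sat (e(Av := A)) (subset_unit (Var Av))" "sat (e(Av := A)) (countable_set (Var Av))" for A
  proof -
    have eA: "valid (e(Av := A))" using e A by simp
    let ?Y = "newv 0 T2 [Var Av]"
    obtain Y where Y: "Y \<in> D T2" "sat (e(Av := A, ?Y := Y)) (unit_fun (Var ?Y))"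
      "sat (e(Av := A, ?Y := Y)) (inj_on_set (Var ?Y) (Var Av))"
      using A_set(3) unfolding countable_set_def Let_def by (auto simp: newv_def)
    have eY: "valid (e(Av := A, ?Y := Y))" using eA Y by simp
    have A_sem: "\<forall>x\<in>reals. \<iota> (A \<bullet> x) \<le> 1"
      "\<forall>x\<in>reals. \<forall>y\<in>reals. req (seq x) (seq y) \<longrightarrow> A \<bullet> x = A \<bullet> y"
      "\<forall>x\<in>reals. A \<bullet> x = \<one> \<longrightarrow> unit x"
      using A_set(1,2) eA by (simp_all add: sat_is_set sat_subset_unit)
    have Y_sem: "\<forall>x\<in>reals. \<forall>y\<in>reals. unit x \<longrightarrow> unit y \<longrightarrow> req (seq x) (seq y) \<longrightarrow> Y \<bullet> x = Y \<bullet> y"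
      "\<forall>x\<in>reals. \<forall>y\<in>reals. A \<bullet> x = \<one> \<longrightarrow> A \<bullet> y = \<one> \<longrightarrow> Y \<bullet> x = Y \<bullet> y \<longrightarrow> req (seq x) (seq y)"
      using Y(2,3) eY by (simp_all add: sat_unit_fun sat_inj_on_set newv_def)
    let ?d = "newv 0 T1 [Var Av]" and ?l = "newv 0 (N \<rightarrow>\<^sub>t T1) [Var Av]"
      and ?B = "newv 0 T11 [Var Av]" and ?Z = "newv 1 T11 [Var Av]"
    have "\<exists>l\<in>D (N \<rightarrow>\<^sub>t T1). \<exists>B\<in>D T11. \<exists>Z\<in>D T11. sat (e(Av := A, ?d := d, ?l := l, ?B := B, ?Z := Z))
        (nonneg_reals (Var ?l) \<^bold>\<and> is_set2 (Var ?B) \<^bold>\<and> fun2 (Var ?Z) \<^bold>\<and>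
           inj_on_set2 (Var ?Z) (Var ?B) \<^bold>\<and> covers (Var ?B) (Var Av) \<^bold>\<and>
           lengths_bounded (Var ?B) (Var ?Z) (Var ?l) \<^bold>\<and> series_le (Var ?l) (Var ?d))"
      if d: "d \<in> reals" and n: "n \<in> D N" "2 * h n < seq d n" for d n
    proof -
      have dD: "d \<in> D T1" "cauchy (seq d)" using d by (simp_all add: reals_def)
      \<comment> \<open>The exponent \<open>K\<close> of the cover is the index at which
        \<open>d\<close> is seen to be positive.\<close>
      interpret covering D "(\<bullet>)" zero suc rc kk ss T \<iota> A Y p n
        by unfold_locales (fact A Y(1) p(1) n(1) | use A_sem Y_sem p(2,3) in blast)+
      let ?e = "e(Av := A, ?d := d, ?l := lengths, ?B := intervals, ?Z := index)"
      have "sat ?e (nonneg_reals (Var ?l) \<^bold>\<and> is_set2 (Var ?B) \<^bold>\<and> fun2 (Var ?Z) \<^bold>\<and>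
           inj_on_set2 (Var ?Z) (Var ?B) \<^bold>\<and> covers (Var ?B) (Var Av) \<^bold>\<and>
           lengths_bounded (Var ?B) (Var ?Z) (Var ?l) \<^bold>\<and> series_le (Var ?l) (Var ?d))"
        by (rule sat_covering) (use eA dD d ex_power_below[OF dD(2) n] in \<open>simp_all add: newv_def\<close>)
      then show ?thesis using in_simps(3-5) by blast
    qed
    note * = this
    have "\<exists>l\<in>D (N \<rightarrow>\<^sub>t T1). \<exists>B\<in>D T11. \<exists>Z\<in>D T11. sat (e(Av := A, ?d := d, ?l := l, ?B := B, ?Z := Z))
        (nonneg_reals (Var ?l) \<^bold>\<and> is_set2 (Var ?B) \<^bold>\<and> fun2 (Var ?Z) \<^bold>\<and>
           inj_on_set2 (Var ?Z) (Var ?B) \<^bold>\<and> covers (Var ?B) (Var Av) \<^bold>\<and>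
           lengths_bounded (Var ?B) (Var ?Z) (Var ?l) \<^bold>\<and> series_le (Var ?l) (Var ?d))"
      if d: "d \<in> D T1" "sat (e(Av := A, ?d := d)) (is_real (Var ?d))"
        "sat (e(Av := A, ?d := d)) (real_of_rat zeroQ \<^bold><\<^sub>R Var ?d)" for d
    proof -
      have ed: "valid (e(Av := A, ?d := d))" using eA d(1) by simp
      have "d \<in> reals" using d ed by (simp add: reals_def)
      moreover obtain n where "n \<in> D N" "2 * h n < seq d n"
        using d(3) ed by (auto simp: rless_def seq_real_of_rat)
      ultimately show ?thesis by (rule *)
    qed
    then show ?thesis
      unfolding weak_measure_zero_def Let_def by (simp only: sat_all_v sat.simps snd_newv) blast
  qed
  then show ?thesis
    unfolding countable_sets_weak_measure_zero_def Let_def by auto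
qed

end

section \<open>Embedding the countermodel into the global field\<close>

sublocale henkin_model \<subseteq> pra_model ntrm nap "nf Zero" "nf Succ" "nf Rc" "\<lambda>\<rho> \<tau>. nf (Kc \<rho> \<tau>)"
  "\<lambda>\<delta> \<rho> \<tau>. nf (Sc \<delta> \<rho> \<tau>)" T
  by unfold_locales (rule base)

definition embed :: "tm \<Rightarrow> num_ring fract" where
  "embed a = Fract (of_num (Abs_num_sr a)) 1"

lemma embed_eq: "a \<in> data_C \<Longrightarrow> b \<in> data_C \<Longrightarrow> embed a = embed b \<longleftrightarrow> a = b"
  by (simp add: embed_def eq_fract Abs_num_sr_inject)

lemma embed_hom:
  "embed data_z = 0" "embed data_u = 1"
  "a \<in> data_C \<Longrightarrow> b \<in> data_C \<Longrightarrow> embed (data_p a b) = embed a + embed b"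
  "a \<in> data_C \<Longrightarrow> b \<in> data_C \<Longrightarrow> embed (data_t a b) = embed a * embed b"
proof -
  have "Abs_num_sr data_z = 0" "Abs_num_sr data_u = 1"
    by (simp_all add: zero_num_sr_def one_num_sr_def)
  then show "embed data_z = 0" "embed data_u = 1"
    by (simp_all add: embed_def Zero_fract_def One_fract_def)
  assume ab: "a \<in> data_C" "b \<in> data_C"
  then have "Abs_num_sr (data_p a b) = Abs_num_sr a + Abs_num_sr b"
    "Abs_num_sr (data_t a b) = Abs_num_sr a * Abs_num_sr b"
    by (simp_all add: plus_num_sr_def times_num_sr_def Abs_num_sr_inverse)
  then show "embed (data_p a b) = embed a + embed b" "embed (data_t a b) = embed a * embed b"
    by (simp_all add: embed_def)
qed

lemma embed_nonneg: "0 \<le> embed a"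
  by (simp add: embed_def zero_le_Fract_iff of_num_nonneg)

lemma embed_unbounded: "\<exists>n\<in>data_C. x \<le> embed n"
proof -
  obtain c where c: "x \<le> Fract (of_num c) 1" using fract_le_of_num by blast
  have "x \<le> embed (Rep_num_sr c)" using c by (simp add: embed_def Rep_num_sr_inverse)
  then show ?thesis using Rep_num_sr by blast
qed

theorem theorem4:
  shows "ACA0_omega \<tturnstile> countable_sets_weak_measure_zero"
proof (rule ccontr)
  let ?\<phi> = countable_sets_weak_measure_zero
  assume "\<not> ACA0_omega \<tturnstile> ?\<phi>"
  then have "consistent ACA0_omega [\<^bold>\<not> ?\<phi>]"
    using derives.raa[OF wff_countable_sets_weak_measure_zero, of ACA0_omega "[]"] by (auto simp: provable_def consistent_def)
  then have "\<exists>H. henkin_set ACA0_omega H \<and> (\<^bold>\<not> ?\<phi>) \<in> H" using ex_henkin_set by fastforce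
  then have H: "henkin_set ACA0_omega refuting_set" "(\<^bold>\<not> ?\<phi>) \<in> refuting_set"
    unfolding refuting_set_def by (metis (mono_tags, lifting) someI_ex)+
  have base: "E_PRA_omega \<subseteq> ACA0_omega" by (auto simp: ACA0_omega_def RCA0_omega_def)
  interpret henkin_model ACA0_omega refuting_set using H(1) base by unfold_locales
  \<comment> \<open>Under the assumption the chosen set is a genuine Henkin set, so its numbers pass
    the test and the global data are theirs rather than the fallback.\<close>
  have data_eq: "data = refuting_data"
    using numbers.nat_semiring_on_axioms by (simp add: data_def is_data_def refuting_data_def Let_def)
  have data: "data_C = ntrm N" "data_z = nf Zero" "data_u = nap (nf Succ) (nf Zero)"
    "data_p = pl" "data_t = ti"
    by (simp_all add: data_C_def data_z_def data_u_def data_p_def data_t_def data_eq refuting_data_def Let_def)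
  interpret embedded_model ntrm nap "nf Zero" "nf Succ" "nf Rc" "\<lambda>\<rho> \<tau>. nf (Kc \<rho> \<tau>)"
    "\<lambda>\<delta> \<rho> \<tau>. nf (Sc \<delta> \<rho> \<tau>)" ACA0_omega embed
    using embed_eq embed_hom embed_nonneg embed_unbounded unfolding data by unfold_locales
  \<comment> \<open>Each free variable is interpreted by its own class, so truth is membership in
    the Henkin set, which contains the negation.\<close>
  have "sat (\<lambda>x. nf (Var x)) (\<^bold>\<not> ?\<phi>)"
    using sat_iff_H[of Var "\<^bold>\<not> ?\<phi>"] H(2) wff_countable_sets_weak_measure_zero by simp
  moreover have "valid (\<lambda>x. nf (Var x))" by (auto simp: valid_def trm_def intro: nf_in)
  then have "sat (\<lambda>x. nf (Var x)) ?\<phi>" by (rule sat_countable_sets_weak_measure_zero) (simp add: ACA0_omega_def)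
  ultimately show False by simp
qed

end
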